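(* Fix the number $n$ of variables and $k\in\mathbb N$. The following statements are equivalent: (i) every truncated tracial sequence $y=(y_w)_{\deg w\le 2k}$ with positive definite tracial moment matrix $M_k(y)$ has a tracial moment representation, i.e. there are $N,s\in\mathbb N$, $\lambda_i\in\mathbb R_{\ge0}$ with $\sum_{i=1}^N\lambda_i=1$, and tuples $\underline A^{(i)}$ of $n$ real symmetric $s\times s$ matrices such that $y_w=\sum_{i=1}^N\lambda_i\operatorname{Tr}(w(\underline A^{(i)}))$ for all words $w$ with $\deg w\le 2k$; (ii) every trace-positive polynomial $f\in\mathbb R\langle\underline X\rangle$ of degree $\le 2k$ is an element of $\Theta_k^2$.
   Context: $\mathbb R\langle\underline X\rangle$ is the free unital associative $\mathbb R$-algebra on non-commuting variables $\underline X=(X_1,\dots,X_n)$, with involution $p\mapsto p^*$ fixing $\mathbb R$ and each $X_i$ (so it reverses words). The degree of a polynomial is the length of its longest word; $\mathbb R\langle\underline X\rangle_{\le m}$ is the space of polynomials of degree $\le m$. Polynomials $f,g$ are cyclically equivalent, $f\overset{\mathrm{cyc}}{\sim}g$, if $f-g$ is a sum of commutators $pq-qp$ with $p,q\in\mathbb R\langle\underline X\rangle$; two words are cyclically equivalent iff one is a cyclic permutation of the other. $\operatorname{Tr}(A)=\frac1s\operatorname{tr}(A)$ for $A\in\mathbb R^{s\times s}$ is the normalized trace. A truncated tracial sequence of order $m$ is a family of real numbers $(y_w)$ indexed by words $w$ with $\deg w\le m$ such that $y_w=y_u$ whenever $w\overset{\mathrm{cyc}}{\sim}u$, $y_w=y_{w^*}$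 for all such $w$, and $y_\emptyset=1$ for the empty word. Its tracial moment matrix of order $k$ ($2k\le m$) is $M_k(y)=(y_{u^*v})_{u,v}$, indexed by words $u,v$ of length $\le k$. A polynomial $f\in\mathbb R\langle\underline X\rangle$ is trace-positive if $\operatorname{Tr}(f(\underline A))\ge0$ for all $s\in\mathbb N$ and all $n$-tuples $\underline A$ of real symmetric $s\times s$ matrices. $\Theta^2=\{f\in\mathbb R\langle\underline X\rangle\mid f\overset{\mathrm{cyc}}{\sim}\sum_i g_i^*g_i\text{ for some (finitely many) }g_i\in\mathbb R\langle\underline X\rangle\}$ and $\Theta_k^2=\Theta^2\cap\mathbb R\langle\underline X\rangle_{\le 2k}$. *)

theory Defs
  imports
    "HOL-Library.Poly_Mapping"
    "Jordan_Normal_Form.Matrix"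
begin

text \<open>Words are lists over a finite type \<open>'n\<close> of letters, so the number of variables is
  \<open>CARD('n)\<close>. With concatenation as the additive monoid structure on lists, the convolution
  product of \<^theory>\<open>HOL-Library.Poly_Mapping\<close> is the product of the free algebra.\<close>

instantiation list :: (type) monoid_add
begin

definition zero_list :: "'a list" where "zero_list = []"

definition plus_list :: "'a list \<Rightarrow> 'a list \<Rightarrow> 'a list" where "plus_list = append"

instance
  by standard (simp_all add: zero_list_def plus_list_def)

end

type_synonym 'n nc_poly = "'n list \<Rightarrow>\<^sub>0 real"

abbreviation word_poly :: "'n list \<Rightarrow> 'n nc_poly" where
  "word_poly w \<equiv> Poly_Mapping.single w 1"

text \<open>The zero polynomial gets degree 0, so that it has degree at most \<open>m\<close> for every \<open>m\<close>.\<close>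

definition nc_degree :: "'n nc_poly \<Rightarrow> nat" where
  "nc_degree f = Max (insert 0 (length ` Poly_Mapping.keys f))"

text \<open>The coefficient of \<open>w\<close> in \<open>nc_star p\<close> is the coefficient of \<open>rev w\<close> in \<open>p\<close>.\<close>

definition nc_star :: "'n nc_poly \<Rightarrow> 'n nc_poly" where
  "nc_star p = Poly_Mapping.map_key rev p"

definition cyc_equiv :: "'n nc_poly \<Rightarrow> 'n nc_poly \<Rightarrow> bool" where
  "cyc_equiv f g \<longleftrightarrow> (\<exists>pqs. f - g = (\<Sum>(p, q)\<leftarrow>pqs. p * q - q * p))"

definition Theta_sq :: "'n nc_poly set" where
  "Theta_sq = {f. \<exists>gs. cyc_equiv f (\<Sum>g\<leftarrow>gs. nc_star g * g)}"

definition Theta_sq_trunc :: "nat \<Rightarrow> 'n nc_poly set" where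
  "Theta_sq_trunc k = Theta_sq \<inter> {f. nc_degree f \<le> 2 * k}"

definition normalized_trace :: "real mat \<Rightarrow> real" where
  "normalized_trace A = (\<Sum>i<dim_row A. A $$ (i, i)) / real (dim_row A)"

definition sym_tuple :: "nat \<Rightarrow> ('n \<Rightarrow> real mat) \<Rightarrow> bool" where
  "sym_tuple s A \<longleftrightarrow> (\<forall>x. A x \<in> carrier_mat s s \<and> transpose_mat (A x) = A x)"

primrec eval_word :: "nat \<Rightarrow> ('n \<Rightarrow> real mat) \<Rightarrow> 'n list \<Rightarrow> real mat" where
  "eval_word s A [] = 1\<^sub>m s"
| "eval_word s A (x # w) = A x * eval_word s A w"

text \<open>The linear combination of the matrices \<open>eval_word s A w\<close> is taken entrywise, since
  \<^typ>\<open>real mat\<close> contains matrices of all sizes and hence carries no additive monoid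
  structure.\<close>

definition eval_poly_mat :: "nat \<Rightarrow> ('n \<Rightarrow> real mat) \<Rightarrow> 'n nc_poly \<Rightarrow> real mat" where
  "eval_poly_mat s A f =
     mat s s (\<lambda>(i, j). \<Sum>w\<in>Poly_Mapping.keys f.
       Poly_Mapping.lookup f w * eval_word s A w $$ (i, j))"

definition trace_positive :: "'n nc_poly \<Rightarrow> bool" where
  "trace_positive f \<longleftrightarrow>
     (\<forall>s>0. \<forall>A. sym_tuple s A \<longrightarrow> normalized_trace (eval_poly_mat s A f) \<ge> 0)"

text \<open>A truncated sequence of order \<open>m\<close> is a function on all words of which only the values
  at words of length at most \<open>m\<close> matter.\<close>

definition tracial_seq :: "nat \<Rightarrow> ('n list \<Rightarrow> real) \<Rightarrow> bool" where
  "tracial_seq m y \<longleftrightarrow>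
     (\<forall>w u. length w \<le> m \<longrightarrow> length u \<le> m \<longrightarrow> cyc_equiv (word_poly w) (word_poly u) \<longrightarrow> y w = y u) \<and>
     (\<forall>w. length w \<le> m \<longrightarrow> y w = y (rev w)) \<and>
     y [] = 1"

definition moment_matrix :: "('n list \<Rightarrow> real) \<Rightarrow> 'n list \<Rightarrow> 'n list \<Rightarrow> real" where
  "moment_matrix y u v = y (rev u @ v)"

definition pos_def_on :: "'i set \<Rightarrow> ('i \<Rightarrow> 'i \<Rightarrow> real) \<Rightarrow> bool" where
  "pos_def_on I M \<longleftrightarrow>
     (\<forall>u\<in>I. \<forall>v\<in>I. M u v = M v u) \<and>
     (\<forall>c. (\<exists>u\<in>I. c u \<noteq> 0) \<longrightarrow> (\<Sum>u\<in>I. \<Sum>v\<in>I. c u * M u v * c v) > 0)"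

definition has_tracial_rep :: "nat \<Rightarrow> ('n list \<Rightarrow> real) \<Rightarrow> bool" where
  "has_tracial_rep m y \<longleftrightarrow>
     (\<exists>(N::nat) (s::nat) (l :: nat \<Rightarrow> real) (A :: nat \<Rightarrow> 'n \<Rightarrow> real mat).
        s > 0 \<and>
        (\<forall>i<N. l i \<ge> 0) \<and> (\<Sum>i<N. l i) = 1 \<and>
        (\<forall>i<N. sym_tuple s (A i)) \<and>
        (\<forall>w. length w \<le> m \<longrightarrow> y w = (\<Sum>i<N. l i * normalized_trace (eval_word s (A i) w))))"

end

theory Submission
  imports Defs "Jordan_Normal_Form.Determinant" "HOL-Library.Multiset"
begin

text \<open>Both implications are finite-dimensional duality between tracial sequences and polynomials
  modulo cyclic equivalence. A sequence outside the convex set of representable sequences is properly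
  separated from it by a trace-positive polynomial; if that polynomial is a sum of hermitian squares,
  positive definiteness kills every square. Conversely a functional separating \<open>f\<close> from the sums of
  squares, perturbed by a faithful matrix trace, becomes a representable sequence that is negative on
  \<open>f\<close>.

  Separation by symmetric functionals only reaches polynomials \<open>f\<close> that are cyclically equivalent to
  \<open>f\<^sup>*\<close>. A word that is not cyclically equivalent to its reverse gives a difference
  \<open>w - w\<^sup>*\<close> of vanishing trace outside \<open>\<Theta>\<^sup>2\<close>; such words of length at most \<open>2k\<close> exist only for
  at least three letters and \<open>k \<ge> 2\<close> or two letters and \<open>k \<ge> 3\<close>. In these cases (i) fails as well, because
  noncommutative versions of the Choi-Lam and Motzkin polynomials are trace-positive and symmetric but
  not in \<open>\<Theta>\<^sup>2\<close>.\<close>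

section \<open>Separation and compactness in finite dimension\<close>

text \<open>The representable sequences are not shown to form a closed set: neither the size nor the
  norm of the matrices is bounded. So separation is never strict; it gives a functional that is
  nonnegative on the whole convex set and positive at one of its points, and it is this one positive
  value that is finally contradicted. The cone of sums of squares is handled with the same weak
  separation. With \<open>e\<close> the sum of \<open>nc_star v * v\<close> over all short words
  \<open>v\<close>, each \<open>f + \<epsilon> e\<close> is shown to lie in the cone, and a limit of
  Gram matrices removes \<epsilon>. Both directions lean on one kind of tuple of matrices, whose
  trace is positive on every nonzero square up to a given degree. It bounds the degrees of the
  squares that represent \<open>f\<close>, bounds their coefficients, and supplies the perturbation
  that makes a functional positive definite.\<close>

lemma proper_separation:
  fixes C :: "('i \<Rightarrow> real) set"
  assumes "finite I" and "C \<noteq> {}"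
    and "\<And>c d t. c \<in> C \<Longrightarrow> d \<in> C \<Longrightarrow> 0 \<le> t \<Longrightarrow> t \<le> 1 \<Longrightarrow> (\<lambda>i. (1 - t) * c i + t * d i) \<in> C"
    and "\<And>c. c \<in> C \<Longrightarrow> \<exists>i\<in>I. c i \<noteq> 0"
  shows "\<exists>a. (\<forall>c\<in>C. 0 \<le> (\<Sum>i\<in>I. a i * c i)) \<and> (\<exists>c\<in>C. 0 < (\<Sum>i\<in>I. a i * c i))"
  using assms
proof (induction I arbitrary: C rule: finite_induct)
  case empty
  then show ?case by auto
next
  case (insert j J)
  note conv = insert.prems(2) and nz = insert.prems(3)
  have upd: "(\<Sum>i\<in>insert j J. (a(j := \<alpha>)) i * c i) = \<alpha> * c j + (\<Sum>i\<in>J. a i * c i)" for a c and \<alpha> :: real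
  proof -
    have "(\<Sum>i\<in>J. (a(j := \<alpha>)) i * c i) = (\<Sum>i\<in>J. a i * c i)"
      using insert.hyps by (intro sum.cong) auto
    then show ?thesis using insert.hyps by simp
  qed
  \<comment> \<open>Elimination of the coordinate \<open>j\<close>. If no point of \<open>C\<close>
    lies on the \<open>j\<close>-axis, the induction hypothesis applies to \<open>C\<close> itself.
    Otherwise \<open>c0\<close> lies on the axis, the part of \<open>C\<close> on the other side of
    \<open>h = 0\<close> is separated by induction, and the functional found is tilted by a multiple
    \<alpha> of \<open>h\<close>.\<close>
  show ?case
  proof (cases "\<forall>c\<in>C. \<exists>i\<in>J. c i \<noteq> 0")
    case True
    then obtain a where "\<forall>c\<in>C. 0 \<le> (\<Sum>i\<in>J. a i * c i)" "\<exists>c\<in>C. 0 < (\<Sum>i\<in>J. a i * c i)"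
      using insert.IH[of C] insert.prems by blast
    then show ?thesis using upd[of a 0] by (intro exI[of _ "a(j := 0)"]) simp
  next
    case False
    then obtain c0 where c0: "c0 \<in> C" "\<And>i. i \<in> J \<Longrightarrow> c0 i = 0" by blast
    with nz have "c0 j \<noteq> 0" by blast
    define \<sigma> where "\<sigma> = sgn (c0 j)"
    define h where "h c = \<sigma> * c j" for c :: "'i \<Rightarrow> real"
    have h0: "h c0 > 0" using \<open>c0 j \<noteq> 0\<close> by (simp add: h_def \<sigma>_def sgn_if)
    have hcomb: "h (\<lambda>i. (1 - t) * c i + t * d i) = (1 - t) * h c + t * h d" for c d t
      by (simp add: h_def algebra_simps)
    define S where "S a c = (\<Sum>i\<in>J. a i * c i)" for a c :: "'i \<Rightarrow> real"
    have Scomb: "S a (\<lambda>i. (1 - t) * c i + t * d i) = (1 - t) * S a c + t * S a d" for a c d t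
      by (simp add: S_def algebra_simps sum.distrib sum_distrib_left sum_subtractf)
    have total: "(\<Sum>i\<in>insert j J. (a(j := \<alpha> * \<sigma>)) i * c i) = \<alpha> * h c + S a c" for a c \<alpha>
      by (simp only: upd) (simp add: h_def S_def)
    have comb_nz: False if "c \<in> C" "h c \<le> 0" "\<forall>i\<in>J. c i = 0" for c
    proof -
      \<comment> \<open>The parameter at which \<open>h\<close> vanishes on the segment from
        \<open>c0\<close> to \<open>c\<close>; all coordinates vanish there.\<close>
      define t where "t = h c0 / (h c0 - h c)"
      have t: "0 \<le> t" "t \<le> 1" using h0 that(2) by (auto simp: t_def divide_simps)
      define d where "d = (\<lambda>i. (1 - t) * c0 i + t * c i)"
      have "d \<in> C" unfolding d_def using conv c0 that t by blast
      moreover have "h d = 0"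
      proof -
        have "h d = h c0 + t * (h c - h c0)" unfolding d_def hcomb by (simp add: algebra_simps)
        also have "t * (h c - h c0) = - h c0" using h0 that(2) unfolding t_def by (simp add: field_simps)
        finally show ?thesis by simp
      qed
      moreover have "\<forall>i\<in>J. d i = 0" using c0 that by (simp add: d_def)
      ultimately show False using nz[of d] \<open>c0 j \<noteq> 0\<close>
        by (auto simp: h_def \<sigma>_def sgn_if split: if_splits)
    qed
    show ?thesis
    proof (cases "\<exists>c\<in>C. h c < 0")
      case False
      have "\<forall>c\<in>C. 0 \<le> (\<Sum>i\<in>insert j J. ((\<lambda>_. 0)(j := 1 * \<sigma>)) i * c i)"
        unfolding total using False by (force simp: S_def)
      moreover have "0 < (\<Sum>i\<in>insert j J. ((\<lambda>_. 0)(j := 1 * \<sigma>)) i * c0 i)"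
        unfolding total using h0 by (simp add: S_def)
      ultimately show ?thesis using c0(1) by blast
    next
      case True
      then obtain cm where cm: "cm \<in> C" "h cm < 0" by blast
      let ?D = "{c \<in> C. h c \<le> 0}"
      have "\<exists>a. (\<forall>c\<in>?D. 0 \<le> (\<Sum>i\<in>J. a i * c i)) \<and> (\<exists>c\<in>?D. 0 < (\<Sum>i\<in>J. a i * c i))"
      proof (rule insert.IH)
        show "?D \<noteq> {}" using cm by force
        show "(\<lambda>i. (1 - t) * c i + t * d i) \<in> ?D" if "c \<in> ?D" "d \<in> ?D" "0 \<le> t" "t \<le> 1" for c d t
          using that conv by (auto simp: hcomb intro!: add_nonpos_nonpos mult_nonneg_nonpos)
        show "\<exists>i\<in>J. c i \<noteq> 0" if "c \<in> ?D" for c using comb_nz[of c] that by blast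
      qed
      then obtain a c1 where a: "\<And>c. c \<in> C \<Longrightarrow> h c \<le> 0 \<Longrightarrow> 0 \<le> S a c"
        and c1: "c1 \<in> C" "h c1 \<le> 0" "0 < S a c1" unfolding S_def by blast
      \<comment> \<open>Points with \<open>h > 0\<close> bound the tilt \<alpha> from below, points
        with \<open>h < 0\<close> from above. The bounds are compatible because a segment between
        two such points crosses \<open>h = 0\<close>, where \<open>S a\<close> is
        nonnegative.\<close>
      have cross: "- S a c / h c \<le> S a d / - h d" if "c \<in> C" "d \<in> C" "h c > 0" "h d < 0" for c d
      proof -
        define t where "t = h c / (h c - h d)"
        have t: "0 \<le> t" "t \<le> 1" using that by (auto simp: t_def divide_simps)
        have t1: "1 - t = - h d / (h c - h d)" using that by (simp add: t_def field_simps)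
        let ?e = "\<lambda>i. (1 - t) * c i + t * d i"
        have "h ?e = (- h d * h c + h c * h d) / (h c - h d)"
          unfolding hcomb unfolding t1 unfolding t_def by (simp only: add_divide_distrib times_divide_eq_left)
        then have "h ?e = 0" by simp
        then have "0 \<le> S a ?e" using a[of ?e] conv that t by simp
        then have "0 \<le> (- h d * S a c + h c * S a d) / (h c - h d)"
          unfolding Scomb unfolding t1 unfolding t_def by (simp only: add_divide_distrib times_divide_eq_left)
        then have "0 \<le> - h d * S a c + h c * S a d" using that
          by (simp add: zero_le_divide_iff)
        then show ?thesis using that by (simp add: field_simps)
      qed
      \<comment> \<open>The lower bounds for \<alpha>. The point \<open>c0\<close> contributes 0,
        hence \<alpha> is nonnegative; strictness then comes from \<open>c0\<close> if \<alpha> is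
        positive and from \<open>c1\<close> if it is 0.\<close>
      define P where "P = (\<lambda>c. - S a c / h c) ` {c \<in> C. h c > 0}"
      have c0P: "0 \<in> P" unfolding P_def using c0 h0 by (force simp: S_def image_iff intro!: bexI[of _ c0])
      have bdd: "bdd_above P" unfolding P_def
        by (rule bdd_aboveI[of _ "S a cm / - h cm"]) (use cross cm in blast)
      define \<alpha> where "\<alpha> = Sup P"
      have \<alpha>0: "0 \<le> \<alpha>" unfolding \<alpha>_def using cSup_upper[OF c0P bdd] .
      have nonneg: "0 \<le> \<alpha> * h c + S a c" if c: "c \<in> C" for c
      proof (cases "h c" "0 :: real" rule: linorder_cases)
        case less
        have "\<alpha> \<le> S a c / - h c" unfolding \<alpha>_def
          by (rule cSup_least) (use c0P cross c less in \<open>auto simp: P_def\<close>)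
        then show ?thesis using less by (simp add: field_simps)
      next
        case equal
        then show ?thesis using a[OF c] by simp
      next
        case greater
        have "- S a c / h c \<le> \<alpha>" unfolding \<alpha>_def
          by (rule cSup_upper[OF _ bdd]) (use c greater in \<open>auto simp: P_def\<close>)
        then show ?thesis using greater by (simp add: field_simps)
      qed
      have "\<exists>c\<in>C. 0 < \<alpha> * h c + S a c"
      proof (cases "\<alpha> = 0")
        case True
        then show ?thesis using c1 by auto
      next
        case False
        then have "0 < \<alpha> * h c0 + S a c0" using \<alpha>0 h0 c0 by (simp add: S_def)
        then show ?thesis using c0 by blast
      qed
      with nonneg show ?thesis unfolding total[symmetric] by blast
    qed
  qed
qed

text \<open>Bolzano-Weierstrass, one coordinate at a time. Points are functions on a finite index
  set because the dimensions in use, such as the number of words of length at most \<open>k\<close>,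
  are not fixed by a type.\<close>

lemma bounded_seq_convergent_subseq:
  fixes X :: "nat \<Rightarrow> 'i \<Rightarrow> real"
  assumes "finite I" and "\<And>n i. i \<in> I \<Longrightarrow> \<bar>X n i\<bar> \<le> B"
  shows "\<exists>l r. strict_mono r \<and> (\<forall>i\<in>I. (\<lambda>n. X (r n) i) \<longlonglongrightarrow> l i)"
  using assms
proof (induction I rule: finite_induct)
  case empty
  show ?case by (auto intro: strict_mono_id)
next
  case (insert j J)
  then obtain l r where r: "strict_mono r" "\<forall>i\<in>J. (\<lambda>n. X (r n) i) \<longlonglongrightarrow> l i" by auto
  obtain q where q: "strict_mono q" "monoseq (\<lambda>n. X (r (q n)) j)"
    using seq_monosub[of "\<lambda>n. X (r n) j"] by auto
  have "Bseq (\<lambda>n. X (r (q n)) j)"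
    using insert.prems by (intro BseqI'[of _ B]) simp
  then obtain x where x: "(\<lambda>n. X (r (q n)) j) \<longlonglongrightarrow> x"
    using q(2) Bseq_monoseq_convergent convergentD by blast
  have "(\<lambda>n. X (r (q n)) i) \<longlonglongrightarrow> l i" if "i \<in> J" for i
    using LIMSEQ_subseq_LIMSEQ[OF r(2)[rule_format, OF that] q(1)] by (simp add: o_def)
  then have "\<forall>i\<in>insert j J. (\<lambda>n. X ((r \<circ> q) n) i) \<longlonglongrightarrow> (l(j := x)) i"
    using x insert.hyps by auto
  then show ?case using strict_mono_o[OF r(1) q(1)] by blast
qed

text \<open>Splitting off one index by a Schur complement factorizes a positive semidefinite matrix
  without eigenvalues. This turns a limit of Gram matrices back into squares of polynomials.\<close>

lemma psd_sum_of_squares: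
  fixes M :: "'i \<Rightarrow> 'i \<Rightarrow> real"
  assumes "finite I"
    and "\<And>u v. u \<in> I \<Longrightarrow> v \<in> I \<Longrightarrow> M u v = M v u"
    and "\<And>c. 0 \<le> (\<Sum>u\<in>I. \<Sum>v\<in>I. c u * M u v * c v)"
  shows "\<exists>gs. \<forall>u\<in>I. \<forall>v\<in>I. M u v = (\<Sum>g\<leftarrow>gs. g u * g v)"
  using assms
proof (induction I arbitrary: M rule: finite_induct)
  case empty
  then show ?case by auto
next
  case (insert a J)
  note sym = insert.prems(1)
  have expand: "(\<Sum>u\<in>insert a J. \<Sum>v\<in>insert a J. c u * M u v * c v)
      = M a a * (c a)\<^sup>2 + 2 * c a * (\<Sum>v\<in>J. M a v * c v) + (\<Sum>u\<in>J. \<Sum>v\<in>J. c u * M u v * c v)" for c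
  proof -
    have 1: "(\<Sum>u\<in>J. c u * M u a * c a) = c a * (\<Sum>v\<in>J. M a v * c v)"
      unfolding sum_distrib_left by (rule sum.cong) (auto simp: sym)
    have 2: "(\<Sum>v\<in>J. c a * M a v * c v) = c a * (\<Sum>v\<in>J. M a v * c v)"
      unfolding sum_distrib_left by (rule sum.cong) auto
    show ?thesis
      using insert.hyps by (simp add: sum.distrib 1 2 power2_eq_square)
  qed
  have Maa: "M a a \<ge> 0"
  proof -
    have z: "(\<Sum>v\<in>J. M a v * (if v = a then 1 else 0)) = 0"
      "(\<Sum>u\<in>J. \<Sum>v\<in>J. (if u = a then 1 else 0) * M u v * (if v = a then 1 else 0)) = (0::real)"
      using insert.hyps by (auto intro!: sum.neutral)
    show ?thesis
      using insert.prems(2)[of "\<lambda>v. if v = a then 1 else 0"] unfolding expand z by simp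
  qed
  have full: "0 \<le> M a a * t\<^sup>2 + 2 * t * (\<Sum>v\<in>J. M a v * c v) + (\<Sum>u\<in>J. \<Sum>v\<in>J. c u * M u v * c v)" for t c
  proof -
    have 1: "(\<Sum>v\<in>J. M a v * (c(a := t)) v) = (\<Sum>v\<in>J. M a v * c v)"
      using insert.hyps by (intro sum.cong) auto
    have 2: "(\<Sum>u\<in>J. \<Sum>v\<in>J. (c(a := t)) u * M u v * (c(a := t)) v) = (\<Sum>u\<in>J. \<Sum>v\<in>J. c u * M u v * c v)"
      using insert.hyps by (intro sum.cong) auto
    show ?thesis using insert.prems(2)[of "c(a := t)"] unfolding expand 1 2 by simp
  qed
  \<comment> \<open>If \<open>M a a = 0\<close>, division by zero yields 0 and \<open>N\<close>
    equals \<open>M\<close>; that is the right value, because the row of \<open>a\<close> then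
    vanishes by \<open>row0\<close>.\<close>
  define N where "N u v = M u v - M a u * M a v / M a a" for u v
  have "\<exists>gs. \<forall>u\<in>J. \<forall>v\<in>J. N u v = (\<Sum>g\<leftarrow>gs. g u * g v)"
  proof (rule insert.IH)
    show "N u v = N v u" if "u \<in> J" "v \<in> J" for u v using that sym by (simp add: N_def)
    fix c :: "'i \<Rightarrow> real"
    let ?s = "\<Sum>v\<in>J. M a v * c v" and ?Q = "\<Sum>u\<in>J. \<Sum>v\<in>J. c u * M u v * c v"
    have "(\<Sum>u\<in>J. \<Sum>v\<in>J. c u * N u v * c v) = ?Q - (\<Sum>u\<in>J. \<Sum>v\<in>J. (M a u * c u) * (M a v * c v)) / M a a"
      by (simp add: N_def algebra_simps sum_subtractf sum_divide_distrib)
    also have "(\<Sum>u\<in>J. \<Sum>v\<in>J. (M a u * c u) * (M a v * c v)) = ?s\<^sup>2"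
      by (simp add: power2_eq_square sum_product)
    finally have eq: "(\<Sum>u\<in>J. \<Sum>v\<in>J. c u * N u v * c v) = ?Q - ?s\<^sup>2 / M a a" .
    show "0 \<le> (\<Sum>u\<in>J. \<Sum>v\<in>J. c u * N u v * c v)"
    proof (cases "M a a = 0")
      case True
      then show ?thesis unfolding eq using full[of 0 c] by simp
    next
      case False
      then show ?thesis unfolding eq using full[of "- ?s / M a a" c]
        by (simp add: field_simps power2_eq_square)
    qed
  qed
  then obtain gs where gs: "\<And>u v. u \<in> J \<Longrightarrow> v \<in> J \<Longrightarrow> N u v = (\<Sum>g\<leftarrow>gs. g u * g v)" by blast
  \<comment> \<open>Otherwise the form takes the value -1 at the unit vector of \<open>v\<close>
    plus \<open>- (M v v + 1) / (2 * M a v)\<close> times that of \<open>a\<close>.\<close>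
  have row0: "M a v = 0" if "M a a = 0" "v \<in> J" for v
  proof (rule ccontr)
    assume nz: "M a v \<noteq> 0"
    define \<delta> where "\<delta> w = (if w = v then 1 else 0 :: real)" for w
    have mult_\<delta>: "x * \<delta> w = (if w = v then x else 0)" for x w by (simp add: \<delta>_def)
    have 1: "(\<Sum>w\<in>J. M a w * \<delta> w) = M a v"
      using insert.hyps that by (simp add: mult_\<delta>)
    have "(\<Sum>w\<in>J. \<delta> u * M u w * \<delta> w) = (if u = v then M v v else 0)" for u
      using insert.hyps that by (simp add: mult_\<delta>) (simp add: \<delta>_def)
    then have "(\<Sum>u\<in>J. \<Sum>w\<in>J. \<delta> u * M u w * \<delta> w) = M v v"
      using insert.hyps that by simp
    then show False using full[of "- (M v v + 1) / (2 * M a v)" \<delta>] that nz 1 by (simp add: field_simps)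
  qed
  define h where "h u = M a u / sqrt (M a a)" for u
  define ext where "ext g = g(a := 0)" for g :: "'i \<Rightarrow> real"
  have "M u v = (\<Sum>g\<leftarrow>h # map ext gs. g u * g v)" if uv: "u \<in> insert a J" "v \<in> insert a J" for u v
  proof -
    have hh: "h u * h v = M a u * M a v / M a a" using Maa by (simp add: h_def)
    have row: "M a w = M a a * M a w / M a a" if "w \<in> insert a J" for w
      using row0[of w] that by (cases "M a a = 0") auto
    show ?thesis
    proof (cases "u = a \<or> v = a")
      case True
      have "(\<Sum>g\<leftarrow>map ext gs. g u * g v) = 0" using True by (induction gs) (auto simp: ext_def)
      moreover have "M u v = M a u * M a v / M a a" using True row[of u] row[of v] uv sym[of u a] by auto
      ultimately show ?thesis using hh by simp
    next
      case False
      then have "(\<Sum>g\<leftarrow>map ext gs. g u * g v) = (\<Sum>g\<leftarrow>gs. g u * g v)"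
        by (simp add: ext_def o_def)
      then show ?thesis using hh gs[of u v] uv False by (simp add: N_def)
    qed
  qed
  then show ?case by blast
qed

text \<open>Compactness of the unit sphere: if no \<kappa> worked, unit vectors with values at most
  \<open>1 / real (Suc n)\<close> would accumulate at a unit vector where the form is not
  positive.\<close>

lemma pos_def_lower_bound:
  fixes M :: "'i \<Rightarrow> 'i \<Rightarrow> real"
  assumes "finite I"
    and pd: "\<And>c. \<exists>u\<in>I. c u \<noteq> 0 \<Longrightarrow> 0 < (\<Sum>u\<in>I. \<Sum>v\<in>I. c u * M u v * c v)"
  shows "\<exists>\<kappa>>0. \<forall>c. \<kappa> * (\<Sum>u\<in>I. (c u)\<^sup>2) \<le> (\<Sum>u\<in>I. \<Sum>v\<in>I. c u * M u v * c v)"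
proof (rule ccontr)
  define Q where "Q c = (\<Sum>u\<in>I. \<Sum>v\<in>I. c u * M u v * c v)" for c
  define S where "S c = (\<Sum>u\<in>I. (c u)\<^sup>2)" for c :: "'i \<Rightarrow> real"
  assume "\<not> ?thesis"
  then have small: "\<exists>c. Q c < \<kappa> * S c" if "\<kappa> > 0" for \<kappa> using that unfolding Q_def S_def by (meson not_le)
  have "\<exists>c. Q c < 1 / real (Suc n) * S c" for n by (rule small) simp
  then obtain c where c: "\<And>n. Q (c n) < 1 / real (Suc n) * S (c n)" by metis
  have Spos: "S (c n) > 0" for n
  proof -
    have "S (c n) \<noteq> 0"
    proof
      assume "S (c n) = 0"
      then have "\<forall>u\<in>I. c n u = 0" using assms(1) by (simp add: S_def sum_nonneg_eq_0_iff)
      then have "Q (c n) = 0" by (simp add: Q_def)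
      with c[of n] \<open>S (c n) = 0\<close> show False by simp
    qed
    moreover have "S (c n) \<ge> 0" by (simp add: S_def sum_nonneg)
    ultimately show ?thesis by simp
  qed
  define d where "d n u = c n u / sqrt (S (c n))" for n u
  have Sd: "S (d n) = 1" for n
  proof -
    have "S (d n) = (\<Sum>u\<in>I. (c n u)\<^sup>2 / S (c n))" unfolding S_def[of "d n"] d_def
      using Spos[of n] by (simp add: power_divide)
    then show ?thesis using Spos[of n] by (simp add: S_def flip: sum_divide_distrib)
  qed
  have Qd: "Q (d n) \<le> 1 / real (Suc n)" for n
  proof -
    have "Q (d n) = (\<Sum>u\<in>I. \<Sum>v\<in>I. (c n u * M u v * c n v) / S (c n))" unfolding Q_def d_def
      using Spos[of n] by (intro sum.cong refl) (simp add: field_simps)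
    also have "\<dots> = Q (c n) / S (c n)" by (simp add: Q_def sum_divide_distrib)
    also have "\<dots> \<le> 1 / real (Suc n)" using c[of n] Spos[of n] by (simp add: field_simps)
    finally show ?thesis .
  qed
  have bound: "\<bar>d n u\<bar> \<le> 1" if "u \<in> I" for n u
  proof -
    have "(d n u)\<^sup>2 \<le> S (d n)" unfolding S_def
      using assms(1) that by (intro member_le_sum) auto
    then show ?thesis by (simp add: Sd abs_square_le_1)
  qed
  from bounded_seq_convergent_subseq[of I d, OF assms(1) bound] obtain l r
    where r: "strict_mono r" and lim: "\<And>u. u \<in> I \<Longrightarrow> (\<lambda>n. d (r n) u) \<longlonglongrightarrow> l u" by blast
  have "(\<lambda>n. S (d (r n))) \<longlonglongrightarrow> S l" unfolding S_def by (intro tendsto_intros lim)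
  then have Sl: "S l = 1" by (simp add: Sd LIMSEQ_const_iff)
  have "(\<lambda>n. Q (d (r n))) \<longlonglongrightarrow> Q l" unfolding Q_def by (intro tendsto_intros lim)
  moreover have "(\<lambda>n. 1 / real (Suc (r n))) \<longlonglongrightarrow> 0"
    using LIMSEQ_subseq_LIMSEQ[OF lim_inverse_n' [THEN LIMSEQ_Suc] r] by (simp add: o_def)
  ultimately have "Q l \<le> 0" using Qd LIMSEQ_le by blast
  moreover have "\<exists>u\<in>I. l u \<noteq> 0"
  proof (rule ccontr)
    assume "\<not> ?thesis"
    then have "S l = 0" by (simp add: S_def)
    with Sl show False by simp
  qed
  ultimately show False using pd[of l] by (simp add: Q_def)
qed

section \<open>Linear functionals on noncommutative polynomials\<close>

text \<open>The Riesz functional of moment theory: functions on words are the linear functionals on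
  polynomials.\<close>

definition riesz :: "('n list \<Rightarrow> real) \<Rightarrow> 'n nc_poly \<Rightarrow> real" where
  "riesz y f = (\<Sum>w\<in>Poly_Mapping.keys f. Poly_Mapping.lookup f w * y w)"

lemma riesz_cong: "(\<And>w. w \<in> Poly_Mapping.keys f \<Longrightarrow> y w = z w) \<Longrightarrow> riesz y f = riesz z f"
  by (simp add: riesz_def)

lemma riesz_zero [simp]: "riesz y 0 = 0"
  by (simp add: riesz_def)

lemma riesz_single [simp]: "riesz y (Poly_Mapping.single w c) = c * y w"
  by (simp add: riesz_def)

lemma riesz_add: "riesz y (f + g) = riesz y f + riesz y g"
  unfolding riesz_def by (rule setsum_keys_plus_distrib) (simp_all add: distrib_right)

lemma riesz_uminus: "riesz y (- f) = - riesz y f"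
  using riesz_add[of y f "- f"] by simp

lemma riesz_diff: "riesz y (f - g) = riesz y f - riesz y g"
  using riesz_add[of y f "- g"] by (simp add: riesz_uminus)

lemma riesz_sum: "riesz y (\<Sum>i\<in>I. f i) = (\<Sum>i\<in>I. riesz y (f i))"
  by (induction I rule: infinite_finite_induct) (simp_all add: riesz_add)

lemma riesz_sum_list: "riesz y (\<Sum>x\<leftarrow>xs. f x) = (\<Sum>x\<leftarrow>xs. riesz y (f x))"
  by (induction xs) (simp_all add: riesz_add)

lemma riesz_lincomb: "riesz (\<lambda>w. a * y w + b * z w) f = a * riesz y f + b * riesz z f"
  by (simp add: riesz_def sum.distrib sum_distrib_left algebra_simps)

lemma riesz_sum_functional: "riesz (\<lambda>w. \<Sum>i\<in>I. c i * y i w) f = (\<Sum>i\<in>I. c i * riesz (y i) f)"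
  unfolding riesz_def sum_distrib_left
  by (subst sum.swap) (simp add: mult.left_commute)

lemma poly_eq_sum_single: "p = (\<Sum>w\<in>Poly_Mapping.keys p. Poly_Mapping.single w (Poly_Mapping.lookup p w))"
  by (rule poly_mapping_eqI) (simp add: lookup_sum lookup_single when_def in_keys_iff)

lemma riesz_mult:
  "riesz y (p * q) = (\<Sum>u\<in>Poly_Mapping.keys p. \<Sum>v\<in>Poly_Mapping.keys q.
     Poly_Mapping.lookup p u * Poly_Mapping.lookup q v * y (u @ v))"
proof -
  have "p * q = (\<Sum>u\<in>Poly_Mapping.keys p. \<Sum>v\<in>Poly_Mapping.keys q.
      Poly_Mapping.single (u @ v) (Poly_Mapping.lookup p u * Poly_Mapping.lookup q v))"
    by (subst (1) poly_eq_sum_single[of p], subst (1) poly_eq_sum_single[of q])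
      (simp add: sum_product mult_single plus_list_def)
  then show ?thesis by (simp add: riesz_sum)
qed

lemma lookup_nc_star: "Poly_Mapping.lookup (nc_star p) w = Poly_Mapping.lookup p (rev w)"
  by (simp add: nc_star_def map_key.rep_eq)

lemma keys_nc_star: "Poly_Mapping.keys (nc_star p) = rev ` Poly_Mapping.keys p"
proof -
  have "w \<in> Poly_Mapping.keys (nc_star p) \<longleftrightarrow> w \<in> rev ` Poly_Mapping.keys p" for w
    using image_eqI[of w rev "rev w"] by (auto simp: in_keys_iff lookup_nc_star)
  then show ?thesis by blast
qed

lemma riesz_nc_star: "riesz y (nc_star f) = riesz (\<lambda>w. y (rev w)) f"
  unfolding riesz_def keys_nc_star by (subst sum.reindex) (auto simp: lookup_nc_star inj_on_def)

lemma riesz_square: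
  "riesz y (nc_star g * g) = (\<Sum>u\<in>Poly_Mapping.keys g. \<Sum>v\<in>Poly_Mapping.keys g.
     Poly_Mapping.lookup g u * Poly_Mapping.lookup g v * y (rev u @ v))"
  unfolding riesz_mult keys_nc_star by (subst sum.reindex) (auto simp: lookup_nc_star inj_on_def)

lemma riesz_square_superset:
  assumes "finite I" "Poly_Mapping.keys g \<subseteq> I"
  shows "riesz y (nc_star g * g)
    = (\<Sum>u\<in>I. \<Sum>v\<in>I. Poly_Mapping.lookup g u * y (rev u @ v) * Poly_Mapping.lookup g v)"
proof -
  have "riesz y (nc_star g * g) = (\<Sum>u\<in>Poly_Mapping.keys g. \<Sum>v\<in>I.
      Poly_Mapping.lookup g u * y (rev u @ v) * Poly_Mapping.lookup g v)"
    unfolding riesz_square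
    by (intro sum.cong refl sum.mono_neutral_cong_left) (use assms in \<open>auto simp: in_keys_iff\<close>)
  also have "\<dots> = (\<Sum>u\<in>I. \<Sum>v\<in>I. Poly_Mapping.lookup g u * y (rev u @ v) * Poly_Mapping.lookup g v)"
    by (rule sum.mono_neutral_left) (use assms in \<open>auto simp: in_keys_iff intro!: sum.neutral\<close>)
  finally show ?thesis .
qed

text \<open>A hermitian square is fixed by the involution. Hence averaging a functional with its
  reversal does not change its values on squares.\<close>

lemma riesz_square_rev:
  "riesz (\<lambda>w. y (rev w)) (nc_star g * g) = riesz y (nc_star g * g)"
  unfolding riesz_square by (subst sum.swap) (simp add: mult.commute)

definition poly_of_fun :: "'n list set \<Rightarrow> ('n list \<Rightarrow> real) \<Rightarrow> 'n nc_poly" where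
  "poly_of_fun I c = (\<Sum>u\<in>I. Poly_Mapping.single u (c u))"

lemma lookup_poly_of_fun:
  "finite I \<Longrightarrow> Poly_Mapping.lookup (poly_of_fun I c) w = (if w \<in> I then c w else 0)"
  by (simp add: poly_of_fun_def lookup_sum lookup_single when_def)

lemma keys_poly_of_fun: "finite I \<Longrightarrow> Poly_Mapping.keys (poly_of_fun I c) \<subseteq> I"
  by (auto simp: in_keys_iff lookup_poly_of_fun split: if_splits)

lemma riesz_poly_of_fun: "riesz y (poly_of_fun I c) = (\<Sum>u\<in>I. c u * y u)"
  by (simp add: poly_of_fun_def riesz_sum)

lemma nc_degree_le_iff: "nc_degree f \<le> m \<longleftrightarrow> Poly_Mapping.keys f \<subseteq> {w. length w \<le> m}"
  by (auto simp: nc_degree_def)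

lemma finite_words_le: "finite {w :: 'n::finite list. length w \<le> m}"
  using finite_lists_length_le[of "UNIV :: 'n set" m] by simp

section \<open>Cyclic equivalence and the functionals that detect it\<close>

definition tracial :: "('n list \<Rightarrow> real) \<Rightarrow> bool" where
  "tracial y \<longleftrightarrow> (\<forall>u v. y (u @ v) = y (v @ u))"

lemma cyc_equiv_refl [simp]: "cyc_equiv f f"
  unfolding cyc_equiv_def by (intro exI[of _ "[]"]) simp

lemma cyc_equiv_trans: "cyc_equiv f g \<Longrightarrow> cyc_equiv g h \<Longrightarrow> cyc_equiv f h"
proof -
  assume "cyc_equiv f g" "cyc_equiv g h"
  then obtain ps qs where "f - g = (\<Sum>(p, q)\<leftarrow>ps. p * q - q * p)" "g - h = (\<Sum>(p, q)\<leftarrow>qs. p * q - q * p)"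
    by (auto simp: cyc_equiv_def)
  then have "f - h = (\<Sum>(p, q)\<leftarrow>ps @ qs. p * q - q * p)" by (simp flip: \<open>f - g = _\<close> \<open>g - h = _\<close>)
  then show ?thesis unfolding cyc_equiv_def by blast
qed

lemma cyc_equiv_add: "cyc_equiv f g \<Longrightarrow> cyc_equiv f' g' \<Longrightarrow> cyc_equiv (f + f') (g + g')"
proof -
  assume "cyc_equiv f g" "cyc_equiv f' g'"
  then obtain ps qs where *: "f - g = (\<Sum>(p, q)\<leftarrow>ps. p * q - q * p)" "f' - g' = (\<Sum>(p, q)\<leftarrow>qs. p * q - q * p)"
    by (auto simp: cyc_equiv_def)
  have "(f + f') - (g + g') = (f - g) + (f' - g')" by simp
  also have "\<dots> = (\<Sum>(p, q)\<leftarrow>ps @ qs. p * q - q * p)" by (simp only: * map_append sum_list_append)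
  finally show ?thesis unfolding cyc_equiv_def by blast
qed

lemma cyc_equiv_sum: "(\<And>i. i \<in> I \<Longrightarrow> cyc_equiv (f i) (g i)) \<Longrightarrow> cyc_equiv (\<Sum>i\<in>I. f i) (\<Sum>i\<in>I. g i)"
  by (induction I rule: infinite_finite_induct) (simp_all add: cyc_equiv_add)

lemma cyc_equiv_swap: "cyc_equiv (Poly_Mapping.single (u @ v) c) (Poly_Mapping.single (v @ u) c)"
  unfolding cyc_equiv_def
  by (intro exI[of _ "[(Poly_Mapping.single u c, Poly_Mapping.single v 1)]"])
    (simp add: mult_single plus_list_def)

text \<open>Multiples of the empty word play the role of scalars; as they are central, a scalar can
  be moved into one factor of a commutator.\<close>

lemma single_Nil_mult_commute:
  fixes p :: "'n nc_poly"
  shows "Poly_Mapping.single [] c * p = p * Poly_Mapping.single [] c"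
  by (subst (1 2) poly_eq_sum_single[of p])
    (simp add: sum_distrib_left sum_distrib_right mult_single plus_list_def mult.commute[of c])

lemma cyc_equiv_scale:
  assumes "cyc_equiv f g"
  shows "cyc_equiv (Poly_Mapping.single [] c * f) (Poly_Mapping.single [] c * g)"
proof -
  let ?c = "Poly_Mapping.single [] c"
  obtain ps where ps: "f - g = (\<Sum>(p, q)\<leftarrow>ps. p * q - q * p)" using assms by (auto simp: cyc_equiv_def)
  have "?c * (\<Sum>(p, q)\<leftarrow>ps. p * q - q * p) = (\<Sum>(p, q)\<leftarrow>map (\<lambda>(p, q). (?c * p, q)) ps. p * q - q * p)"
  proof (induction ps)
    case (Cons a ps)
    obtain p q where a: "a = (p, q)" by fastforce
    have "?c * (q * p) = q * (?c * p)"
      by (simp only: single_Nil_mult_commute[of c q] flip: mult.assoc)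
    with Cons show ?case by (simp add: a ring_distribs mult.assoc)
  qed simp
  then have "?c * f - ?c * g = (\<Sum>(p, q)\<leftarrow>map (\<lambda>(p, q). (?c * p, q)) ps. p * q - q * p)"
    by (simp only: ps flip: right_diff_distrib)
  then show ?thesis unfolding cyc_equiv_def by blast
qed

lemma riesz_cyc_equiv:
  assumes "tracial y" "cyc_equiv f g"
  shows "riesz y f = riesz y g"
proof -
  obtain ps where ps: "f - g = (\<Sum>(p, q)\<leftarrow>ps. p * q - q * p)" using assms by (auto simp: cyc_equiv_def)
  have comm: "riesz y (p * q) = riesz y (q * p)" for p q
    unfolding riesz_mult using assms(1)
    by (subst sum.swap) (simp add: tracial_def mult.commute)
  have "riesz y (f - g) = (\<Sum>x\<leftarrow>ps. riesz y (case x of (p, q) \<Rightarrow> p * q - q * p))"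
    unfolding ps by (rule riesz_sum_list)
  also have "\<dots> = 0"
    by (induction ps) (auto simp: riesz_diff comm)
  finally show ?thesis by (simp add: riesz_diff)
qed

text \<open>A chosen word in each cyclic class. Rotations of a word satisfy the same predicate, so
  the choice operator picks the same word for all of them.\<close>

definition cyc_rep :: "'n list \<Rightarrow> 'n list" where
  "cyc_rep w = (SOME u. cyc_equiv (word_poly w) (word_poly u))"

lemma cyc_equiv_cyc_rep: "cyc_equiv (word_poly w) (word_poly (cyc_rep w))"
  unfolding cyc_rep_def by (rule someI[of _ w]) simp

lemma cyc_rep_swap: "cyc_rep (u @ v) = cyc_rep (v @ u :: 'n list)"
proof -
  have "cyc_equiv (word_poly (u @ v)) (word_poly w) \<longleftrightarrow> cyc_equiv (word_poly (v @ u)) (word_poly w)" for w :: "'n list"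
    using cyc_equiv_swap cyc_equiv_trans by blast
  then show ?thesis by (simp add: cyc_rep_def)
qed

text \<open>Moving every word of \<open>f - g\<close> to its representative is a change up to
  commutators, and the coefficients then are the sums over cyclic classes, which the class
  indicators compute. All of them are 0.\<close>

lemma cyc_equivI:
  assumes "\<And>c. riesz (\<lambda>w. of_bool (cyc_rep w = c)) f = riesz (\<lambda>w. of_bool (cyc_rep w = c)) g"
  shows "cyc_equiv f g"
proof -
  define h where "h = f - g"
  let ?l = "Poly_Mapping.lookup h" and ?K = "Poly_Mapping.keys h"
  have "cyc_equiv (\<Sum>w\<in>?K. Poly_Mapping.single w (?l w)) (\<Sum>w\<in>?K. Poly_Mapping.single (cyc_rep w) (?l w))"
  proof (rule cyc_equiv_sum)
    fix w
    show "cyc_equiv (Poly_Mapping.single w (?l w)) (Poly_Mapping.single (cyc_rep w) (?l w))"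
      using cyc_equiv_scale[OF cyc_equiv_cyc_rep, of "?l w" w] by (simp add: mult_single plus_list_def)
  qed
  moreover have "(\<Sum>w\<in>?K. Poly_Mapping.single (cyc_rep w) (?l w)) = 0"
  proof (rule poly_mapping_eqI)
    fix c
    have "Poly_Mapping.lookup (\<Sum>w\<in>?K. Poly_Mapping.single (cyc_rep w) (?l w)) c
        = riesz (\<lambda>w. of_bool (cyc_rep w = c)) h"
      unfolding riesz_def lookup_sum by (intro sum.cong) (auto simp: lookup_single when_def)
    also have "\<dots> = 0" using assms by (simp add: h_def riesz_diff)
    finally show "Poly_Mapping.lookup (\<Sum>w\<in>?K. Poly_Mapping.single (cyc_rep w) (?l w)) c = Poly_Mapping.lookup 0 c"
      by simp
  qed
  ultimately have "cyc_equiv h 0" using poly_eq_sum_single[of h] by simp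
  from cyc_equiv_add[OF this cyc_equiv_refl[of g]] show ?thesis by (simp add: h_def)
qed

lemma tracial_cyc_rep: "tracial (\<lambda>w. a (cyc_rep w))"
  unfolding tracial_def by (intro allI arg_cong[where f = a] cyc_rep_swap)

text \<open>Duality makes cyclic equivalence a family of real equations, which survive passage to a
  limit; exhibiting commutators would not.\<close>

lemma cyc_equiv_iff_riesz: "cyc_equiv f g \<longleftrightarrow> (\<forall>y. tracial y \<longrightarrow> riesz y f = riesz y g)"
proof
  assume *: "\<forall>y. tracial y \<longrightarrow> riesz y f = riesz y g"
  show "cyc_equiv f g"
    by (rule cyc_equivI, rule *[rule_format], rule tracial_cyc_rep[where a = "\<lambda>w. of_bool (w = _)"])
next
  assume "cyc_equiv f g"
  then show "\<forall>y. tracial y \<longrightarrow> riesz y f = riesz y g" using riesz_cyc_equiv by blast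
qed

text \<open>Nothing is known about a truncated sequence at long words. Rotation preserves length, so
  replacing those values by 0 gives a function that is cyclically invariant on all words.\<close>

definition truncate :: "nat \<Rightarrow> ('n list \<Rightarrow> real) \<Rightarrow> 'n list \<Rightarrow> real" where
  "truncate m y w = (if length w \<le> m then y w else 0)"

lemma tracial_truncate:
  assumes "tracial_seq m y"
  shows "tracial (truncate m y)"
proof -
  have "truncate m y (u @ v) = truncate m y (v @ u)" for u v
  proof (cases "length (u @ v) \<le> m")
    case True
    then have "length (v @ u) \<le> m" by simp
    with True have "y (u @ v) = y (v @ u)"
      using assms cyc_equiv_swap[of u v 1] unfolding tracial_seq_def by blast
    with True show ?thesis by (simp add: truncate_def)
  qed (simp add: truncate_def)
  then show ?thesis unfolding tracial_def by (intro allI)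
qed

lemma tracial_seqI:
  assumes "tracial y" "\<And>w. y (rev w) = y w" "y [] = 1"
  shows "tracial_seq m y"
  unfolding tracial_seq_def
proof (intro conjI allI impI)
  fix w u :: "'a list"
  assume "cyc_equiv (word_poly w) (word_poly u)"
  from riesz_cyc_equiv[OF assms(1) this] show "y w = y u" by simp
qed (simp_all add: assms)

section \<open>Matrix traces of words\<close>

lemma index_mult_mat_sum:
  assumes "M \<in> carrier_mat s s" "N \<in> carrier_mat s s" "i < s" "j < s"
  shows "(M * N) $$ (i, j) = (\<Sum>l<s. M $$ (i, l) * N $$ (l, j))"
  using assms by (simp add: scalar_prod_def lessThan_atLeast0)

lemma normalized_trace_alt:
  "M \<in> carrier_mat s s \<Longrightarrow> normalized_trace M = (\<Sum>i<s. M $$ (i, i)) / real s"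
  by (simp add: normalized_trace_def)

lemma normalized_trace_mult:
  assumes "M \<in> carrier_mat s s" "N \<in> carrier_mat s s"
  shows "normalized_trace (M * N) = (\<Sum>i<s. \<Sum>j<s. M $$ (i, j) * N $$ (j, i)) / real s"
proof -
  have "M * N \<in> carrier_mat s s" using assms by simp
  from normalized_trace_alt[OF this] show ?thesis
    using index_mult_mat_sum[OF assms] by simp
qed

lemma normalized_trace_mult_commute:
  assumes "M \<in> carrier_mat s s" "N \<in> carrier_mat s s"
  shows "normalized_trace (M * N) = normalized_trace (N * M)"
  unfolding normalized_trace_mult[OF assms] normalized_trace_mult[OF assms(2,1)]
  by (subst sum.swap) (simp add: mult.commute)

lemma sum_swap_pairs:
  "(\<Sum>u\<in>I. \<Sum>v\<in>I'. \<Sum>i\<in>J. \<Sum>j\<in>J'. F u v i j) = (\<Sum>i\<in>J. \<Sum>j\<in>J'. \<Sum>u\<in>I. \<Sum>v\<in>I'. F u v i j)"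
proof -
  have "(\<Sum>u\<in>I. \<Sum>v\<in>I'. \<Sum>i\<in>J. \<Sum>j\<in>J'. F u v i j) = (\<Sum>u\<in>I. \<Sum>i\<in>J. \<Sum>j\<in>J'. \<Sum>v\<in>I'. F u v i j)"
    by (rule sum.cong[OF refl], subst sum.swap, rule sum.cong[OF refl], rule sum.swap)
  also have "\<dots> = (\<Sum>i\<in>J. \<Sum>u\<in>I. \<Sum>j\<in>J'. \<Sum>v\<in>I'. F u v i j)" by (rule sum.swap)
  also have "\<dots> = (\<Sum>i\<in>J. \<Sum>j\<in>J'. \<Sum>u\<in>I. \<Sum>v\<in>I'. F u v i j)"
    by (rule sum.cong[OF refl], rule sum.swap)
  finally show ?thesis .
qed

definition word_trace :: "nat \<Rightarrow> ('n \<Rightarrow> real mat) \<Rightarrow> 'n list \<Rightarrow> real" where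
  "word_trace s A w = normalized_trace (eval_word s A w)"

context
  fixes s :: nat and A :: "'n \<Rightarrow> real mat"
  assumes sym: "sym_tuple s A"
begin

lemma letter_carrier: "A x \<in> carrier_mat s s"
  using sym by (simp add: sym_tuple_def)

lemma letter_symmetric: "i < s \<Longrightarrow> j < s \<Longrightarrow> A x $$ (i, j) = A x $$ (j, i)"
  using sym letter_carrier[of x] by (metis carrier_matD index_transpose_mat(1) sym_tuple_def)

lemma eval_word_carrier: "eval_word s A w \<in> carrier_mat s s"
  by (induction w) (auto intro: mult_carrier_mat letter_carrier)

lemma eval_word_append: "eval_word s A (u @ v) = eval_word s A u * eval_word s A v"
proof (induction u)
  case Nil
  show ?case using eval_word_carrier[of v] by simp
next
  case (Cons x u)
  then show ?case using letter_carrier[of x] eval_word_carrier[of u] eval_word_carrier[of v] by simp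
qed

lemma eval_word_rev: "eval_word s A (rev w) = transpose_mat (eval_word s A w)"
proof (induction w)
  case (Cons x w)
  have "eval_word s A (rev (x # w)) = transpose_mat (eval_word s A w) * A x"
    using Cons letter_carrier[of x] by (simp add: eval_word_append)
  then show ?case
    using sym transpose_mult[OF letter_carrier[of x] eval_word_carrier[of w]] by (simp add: sym_tuple_def)
qed simp

lemma word_trace_append:
  "word_trace s A (u @ v)
    = (\<Sum>i<s. \<Sum>j<s. eval_word s A u $$ (i, j) * eval_word s A v $$ (j, i)) / real s"
  unfolding word_trace_def eval_word_append
  by (rule normalized_trace_mult) (rule eval_word_carrier)+

lemma tracial_word_trace: "tracial (word_trace s A)"
  unfolding tracial_def word_trace_def eval_word_append
  using normalized_trace_mult_commute[OF eval_word_carrier eval_word_carrier] by blast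

lemma word_trace_rev: "word_trace s A (rev w) = word_trace s A w"
  using eval_word_carrier[of w] by (simp add: word_trace_def eval_word_rev normalized_trace_def)

lemma word_trace_Nil: "s > 0 \<Longrightarrow> word_trace s A [] = 1"
  by (simp add: word_trace_def normalized_trace_def)

text \<open>With \<open>g\<close> the polynomial of coefficients \<open>c\<close>, this is the
  normalized trace of the transpose of \<open>g(A)\<close> times \<open>g(A)\<close>, a squared
  Hilbert-Schmidt norm.\<close>

lemma word_trace_quadratic:
  "(\<Sum>u\<in>I. \<Sum>v\<in>I. c u * word_trace s A (rev u @ v) * c v)
    = (\<Sum>i<s. \<Sum>j<s. (\<Sum>u\<in>I. c u * eval_word s A u $$ (j, i))\<^sup>2) / real s"
proof -
  let ?E = "\<lambda>u i j. c u * eval_word s A u $$ (j, i)"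
  have "c u * word_trace s A (rev u @ v) * c v = (\<Sum>i<s. \<Sum>j<s. ?E u i j * ?E v i j) / real s" for u v
  proof -
    have "word_trace s A (rev u @ v)
        = (\<Sum>i<s. \<Sum>j<s. eval_word s A u $$ (j, i) * eval_word s A v $$ (j, i)) / real s"
      unfolding word_trace_append using eval_word_carrier[of u] by (simp add: eval_word_rev)
    then show ?thesis
      by (simp add: sum_distrib_left mult.left_commute mult.commute[of _ "c v"] mult.assoc)
  qed
  then have "(\<Sum>u\<in>I. \<Sum>v\<in>I. c u * word_trace s A (rev u @ v) * c v)
      = (\<Sum>u\<in>I. \<Sum>v\<in>I. \<Sum>i<s. \<Sum>j<s. ?E u i j * ?E v i j) / real s"
    by (simp only: sum_divide_distrib)
  also have "(\<Sum>u\<in>I. \<Sum>v\<in>I. \<Sum>i<s. \<Sum>j<s. ?E u i j * ?E v i j)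
      = (\<Sum>i<s. \<Sum>j<s. \<Sum>u\<in>I. \<Sum>v\<in>I. ?E u i j * ?E v i j)"
    by (rule sum_swap_pairs)
  finally show ?thesis by (simp only: power2_eq_square sum_product)
qed

lemma riesz_word_trace: "riesz (word_trace s A) f = normalized_trace (eval_poly_mat s A f)"
proof -
  let ?l = "Poly_Mapping.lookup f" and ?K = "Poly_Mapping.keys f"
  have "word_trace s A w = (\<Sum>i<s. eval_word s A w $$ (i, i)) / real s" for w
    unfolding word_trace_def by (rule normalized_trace_alt[OF eval_word_carrier])
  then have "riesz (word_trace s A) f = (\<Sum>w\<in>?K. \<Sum>i<s. ?l w * eval_word s A w $$ (i, i)) / real s"
    by (simp only: riesz_def sum_divide_distrib sum_distrib_left times_divide_eq_right)
  also have "(\<Sum>w\<in>?K. \<Sum>i<s. ?l w * eval_word s A w $$ (i, i)) = (\<Sum>i<s. \<Sum>w\<in>?K. ?l w * eval_word s A w $$ (i, i))"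
    by (rule sum.swap)
  finally show ?thesis by (simp add: normalized_trace_def eval_poly_mat_def)
qed

end

lemma trace_positiveD:
  "trace_positive f \<Longrightarrow> s > 0 \<Longrightarrow> sym_tuple s A \<Longrightarrow> 0 \<le> riesz (word_trace s A) f"
  by (simp add: riesz_word_trace trace_positive_def)

lemma trace_positiveI:
  "(\<And>s A. s > 0 \<Longrightarrow> sym_tuple s A \<Longrightarrow> 0 \<le> riesz (word_trace s A) f) \<Longrightarrow> trace_positive f"
  by (simp add: riesz_word_trace trace_positive_def)

lemma has_tracial_rep_alt:
  "has_tracial_rep m y \<longleftrightarrow> (\<exists>(N::nat) s l A. s > 0 \<and> (\<forall>i<N. l i \<ge> 0) \<and> (\<Sum>i<N. l i) = 1 \<and>
     (\<forall>i<N. sym_tuple s (A i)) \<and>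
     (\<forall>w. length w \<le> m \<longrightarrow> y w = (\<Sum>i<N. l i * word_trace s (A i) w)))"
  by (simp add: has_tracial_rep_def word_trace_def)

lemma has_tracial_rep_word_trace: "s > 0 \<Longrightarrow> sym_tuple s A \<Longrightarrow> has_tracial_rep m (word_trace s A)"
  unfolding has_tracial_rep_alt
  by (intro exI[of _ 1] exI[of _ s] exI[of _ "\<lambda>_. 1"] exI[of _ "\<lambda>_. A"]) simp

lemma has_tracial_rep_riesz:
  assumes "has_tracial_rep m y"
  obtains N s l A where "s > 0" "\<And>i. i < N \<Longrightarrow> l i \<ge> (0 :: real)" "\<And>i. i < (N :: nat) \<Longrightarrow> sym_tuple s (A i)"
    "\<And>f. nc_degree f \<le> m \<Longrightarrow> riesz y f = (\<Sum>i<N. l i * riesz (word_trace s (A i)) f)"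
proof -
  obtain N s l A where *: "s > 0" "\<forall>i<N. l i \<ge> (0 :: real)" "\<forall>i<(N :: nat). sym_tuple s (A i)"
    "\<forall>w. length w \<le> m \<longrightarrow> y w = (\<Sum>i<N. l i * word_trace s (A i) w)"
    using assms unfolding has_tracial_rep_alt by (elim exE conjE) (rule that, assumption+)
  have "riesz y f = (\<Sum>i<N. l i * riesz (word_trace s (A i)) f)" if "nc_degree f \<le> m" for f
  proof -
    have "riesz y f = riesz (\<lambda>w. \<Sum>i<N. l i * word_trace s (A i) w) f"
      using * that by (intro riesz_cong) (auto simp: nc_degree_le_iff)
    then show ?thesis by (simp add: riesz_sum_functional)
  qed
  with * show ?thesis by (intro that[of s N l A]) auto
qed

lemma has_tracial_rep_trace_positive:
  assumes "has_tracial_rep m y" "nc_degree f \<le> m" "trace_positive f"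
  shows "0 \<le> riesz y f"
proof (rule has_tracial_rep_riesz[OF assms(1)])
  fix N s l A
  assume *: "s > 0" "\<And>i. i < N \<Longrightarrow> l i \<ge> (0 :: real)" "\<And>i. i < (N :: nat) \<Longrightarrow> sym_tuple s (A i)"
    "\<And>f. nc_degree f \<le> m \<Longrightarrow> riesz y f = (\<Sum>i<N. l i * riesz (word_trace s (A i)) f)"
  show ?thesis unfolding *(4)[OF assms(2)]
    by (rule sum_nonneg) (use * trace_positiveD[OF assms(3)] in auto)
qed

lemma has_tracial_rep_cyc_equiv:
  assumes "has_tracial_rep m y" "nc_degree f \<le> m" "cyc_equiv f 0"
  shows "riesz y f = 0"
proof (rule has_tracial_rep_riesz[OF assms(1)])
  fix N s l A
  assume *: "\<And>i. i < (N :: nat) \<Longrightarrow> sym_tuple s (A i)"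
    "\<And>f. nc_degree f \<le> m \<Longrightarrow> riesz y f = (\<Sum>i<N. l i * riesz (word_trace s (A i)) f)"
  show ?thesis unfolding *(2)[OF assms(2)]
    using riesz_cyc_equiv[OF tracial_word_trace[OF *(1)] assms(3)] by simp
qed

section \<open>Convexity of the set of representable sequences\<close>

lemma block_index_less: "q < s \<Longrightarrow> r < m \<Longrightarrow> q * m + r < s * (m :: nat)"
  using mult_le_mono1[of "Suc q" s m] by simp

text \<open>The Kronecker product with the identity of size \<open>m\<close>, where row
  \<open>q * m + r\<close> is position \<open>r\<close> of block \<open>q\<close>. A representation
  has one common matrix size, so combining sizes \<open>s\<close> and \<open>s'\<close> requires
  passing to \<open>s * s'\<close>.\<close>

lemma inflate_sym_tuple:
  assumes sym: "sym_tuple s A" and "m > 0"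
  shows "\<exists>B. sym_tuple (s * m) B \<and> (\<forall>w. word_trace (s * m) B w = word_trace s A w)"
proof -
  define infl where "infl M = mat (s * m) (s * m)
    (\<lambda>(i, j). if i mod m = j mod m then M $$ (i div m, j div m) else (0::real))" for M
  have div: "i div m < s" if "i < s * m" for i using that by (simp add: less_mult_imp_div_less)
  have blocks: "(\<Sum>l<s * m. F l) = (\<Sum>q<s. \<Sum>r<m. F (q * m + r))" for F :: "nat \<Rightarrow> real"
  proof -
    have "(\<Sum>l=q * m..<q * m + m. F l) = (\<Sum>r<m. F (q * m + r))" for q
      using sum.shift_bounds_nat_ivl[of F 0 "q * m" m] by (simp add: lessThan_atLeast0 add.commute)
    then show ?thesis using sum.nat_group[of F m s] by simp
  qed
  have infl_mult: "infl M * infl N = infl (M * N)" if "M \<in> carrier_mat s s" "N \<in> carrier_mat s s" for M N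
  proof (rule eq_matI)
    fix i j assume "i < dim_row (infl (M * N))" "j < dim_col (infl (M * N))"
    then have ij: "i < s * m" "j < s * m" by (auto simp: infl_def)
    have c: "infl M \<in> carrier_mat (s * m) (s * m)" "infl N \<in> carrier_mat (s * m) (s * m)"
      by (auto simp: infl_def)
    have "(infl M * infl N) $$ (i, j) = (\<Sum>q<s. \<Sum>r<m. infl M $$ (i, q * m + r) * infl N $$ (q * m + r, j))"
      unfolding index_mult_mat_sum[OF c ij] blocks ..
    also have "\<dots> = (\<Sum>q<s. \<Sum>r<m. if r = i mod m then
        (if i mod m = j mod m then M $$ (i div m, q) * N $$ (q, j div m) else 0) else 0)"
    proof (intro sum.cong refl)
      fix q r assume "q \<in> {..<s}" "r \<in> {..<m}"
      then have qr: "q < s" "r < m" by auto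
      then have "q * m + r < s * m" by (rule block_index_less)
      then show "infl M $$ (i, q * m + r) * infl N $$ (q * m + r, j) = (if r = i mod m then
        (if i mod m = j mod m then M $$ (i div m, q) * N $$ (q, j div m) else 0) else 0)"
        using ij qr by (auto simp: infl_def)
    qed
    also have "\<dots> = (if i mod m = j mod m then (\<Sum>q<s. M $$ (i div m, q) * N $$ (q, j div m)) else 0)"
      using \<open>m > 0\<close> by simp
    also have "\<dots> = infl (M * N) $$ (i, j)"
      using ij div that by (simp add: infl_def index_mult_mat_sum[OF that] del: index_mult_mat)
    finally show "(infl M * infl N) $$ (i, j) = infl (M * N) $$ (i, j)" .
  qed (auto simp: infl_def)
  define B where "B x = infl (A x)" for x
  have "sym_tuple (s * m) B" unfolding sym_tuple_def
  proof (intro allI conjI)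
    show "B x \<in> carrier_mat (s * m) (s * m)" for x by (simp add: B_def infl_def)
    show "transpose_mat (B x) = B x" for x
      by (rule eq_matI) (auto simp: B_def infl_def div letter_symmetric[OF sym])
  qed
  moreover have "eval_word (s * m) B w = infl (eval_word s A w)" for w
  proof (induction w)
    case Nil
    show ?case
    proof (rule eq_matI)
      fix i j assume "i < dim_row (infl (eval_word s A []))" "j < dim_col (infl (eval_word s A []))"
      then have ij: "i < s * m" "j < s * m" by (auto simp: infl_def)
      have "i = j \<longleftrightarrow> i mod m = j mod m \<and> i div m = j div m"
        using div_mult_mod_eq[of i m] div_mult_mod_eq[of j m] by metis
      with ij div show "eval_word (s * m) B [] $$ (i, j) = infl (eval_word s A []) $$ (i, j)"
        by (auto simp: infl_def)
    qed (auto simp: infl_def)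
  next
    case (Cons x w)
    then show ?case by (simp add: B_def infl_mult letter_carrier[OF sym] eval_word_carrier[OF sym])
  qed
  moreover have "normalized_trace (infl M) = normalized_trace M" if "M \<in> carrier_mat s s" for M
  proof -
    have "(\<Sum>i<s * m. infl M $$ (i, i)) = (\<Sum>q<s. \<Sum>r<m. M $$ (q, q))" unfolding blocks
    proof (intro sum.cong refl)
      fix q r assume "q \<in> {..<s}" "r \<in> {..<m}"
      then have qr: "q < s" "r < m" by auto
      then have "q * m + r < s * m" by (rule block_index_less)
      then show "infl M $$ (q * m + r, q * m + r) = M $$ (q, q)" using qr by (auto simp: infl_def)
    qed
    then show ?thesis using that \<open>m > 0\<close>
      by (simp add: normalized_trace_def infl_def flip: sum_distrib_left)
  qed
  ultimately show ?thesis using eval_word_carrier[OF sym] by (auto simp: word_trace_def)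
qed

lemma has_tracial_rep_convex:
  assumes "has_tracial_rep m y" "has_tracial_rep m z" "0 \<le> t" "t \<le> 1"
  shows "has_tracial_rep m (\<lambda>w. (1 - t) * y w + t * z w)"
proof -
  obtain N s l A where 1: "s > 0" "\<forall>i<(N::nat). l i \<ge> 0" "(\<Sum>i<N. l i) = 1" "\<forall>i<N. sym_tuple s (A i)"
    "\<forall>w. length w \<le> m \<longrightarrow> y w = (\<Sum>i<N. l i * word_trace s (A i) w)"
    using assms(1) unfolding has_tracial_rep_alt by (elim exE conjE) (rule that, assumption+)
  obtain N' s' l' A' where 2: "s' > 0" "\<forall>i<(N'::nat). l' i \<ge> 0" "(\<Sum>i<N'. l' i) = 1" "\<forall>i<N'. sym_tuple s' (A' i)"
    "\<forall>w. length w \<le> m \<longrightarrow> z w = (\<Sum>i<N'. l' i * word_trace s' (A' i) w)"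
    using assms(2) unfolding has_tracial_rep_alt by (elim exE conjE) (rule that, assumption+)
  have "\<exists>B. sym_tuple (s * s') B \<and> (\<forall>w. word_trace (s * s') B w = word_trace s (A i) w)" if "i < N" for i
    using inflate_sym_tuple 1 2 that by blast
  then obtain B where B: "\<And>i. i < N \<Longrightarrow> sym_tuple (s * s') (B i)"
    "\<And>i w. i < N \<Longrightarrow> word_trace (s * s') (B i) w = word_trace s (A i) w" by metis
  have "\<exists>B. sym_tuple (s * s') B \<and> (\<forall>w. word_trace (s * s') B w = word_trace s' (A' i) w)" if "i < N'" for i
    using inflate_sym_tuple[of s' "A' i" s] 1 2 that by (simp add: mult.commute[of s' s])
  then obtain B' where B': "\<And>i. i < N' \<Longrightarrow> sym_tuple (s * s') (B' i)"
    "\<And>i w. i < N' \<Longrightarrow> word_trace (s * s') (B' i) w = word_trace s' (A' i) w" by metis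
  define k where "k i = (if i < N then (1 - t) * l i else t * l' (i - N))" for i
  define C where "C i = (if i < N then B i else B' (i - N))" for i
  have split: "(\<Sum>i<N + N'. k i * F (C i)) = (1 - t) * (\<Sum>i<N. l i * F (B i)) + t * (\<Sum>i<N'. l' i * F (B' i))"
    for F :: "('a \<Rightarrow> real mat) \<Rightarrow> real"
  proof -
    have "(\<Sum>i<N + N'. k i * F (C i)) = (\<Sum>i<N. k i * F (C i)) + (\<Sum>i=N..<N + N'. k i * F (C i))"
      unfolding lessThan_atLeast0 by (rule sum.atLeastLessThan_concat[symmetric]) simp_all
    also have "(\<Sum>i=N..<N + N'. k i * F (C i)) = (\<Sum>i<N'. k (i + N) * F (C (i + N)))"
      using sum.shift_bounds_nat_ivl[of "\<lambda>i. k i * F (C i)" 0 N N'] by (simp add: lessThan_atLeast0 add.commute)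
    finally show ?thesis by (simp add: k_def C_def sum_distrib_left mult.assoc)
  qed
  show ?thesis unfolding has_tracial_rep_alt
  proof (intro exI conjI allI impI)
    show "s * s' > 0" using 1 2 by simp
    show "k i \<ge> 0" if "i < N + N'" for i using 1 2 assms that by (auto simp: k_def)
    show "(\<Sum>i<N + N'. k i) = 1" using split[of "\<lambda>_. 1"] 1 2 by simp
    show "sym_tuple (s * s') (C i)" if "i < N + N'" for i using B B' that by (auto simp: C_def)
    show "(1 - t) * y w + t * z w = (\<Sum>i<N + N'. k i * word_trace (s * s') (C i) w)" if "length w \<le> m" for w
      unfolding split[of "\<lambda>X. word_trace (s * s') X w"] using 1 2 B B' that by simp
  qed
qed

text \<open>The compression of the operators \<open>l\<^sub>x + l\<^sub>x\<^sup>*\<close> (creation plus annihilation on full Fock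
  space) to words of length at most \<open>d\<close>: applied to the vacuum, a word \<open>u\<close> gives \<open>u\<close> plus shorter
  words, so no nonzero polynomial of degree at most \<open>d\<close> vanishes there.\<close>

lemma exists_faithful_tuple:
  fixes d :: nat
  shows "\<exists>s (A :: 'n::finite \<Rightarrow> real mat). s > 0 \<and> sym_tuple s A \<and>
    (\<forall>c. (\<exists>u\<in>{u. length u \<le> d}. c u \<noteq> 0) \<longrightarrow>
      0 < (\<Sum>u\<in>{u. length u \<le> d}. \<Sum>v\<in>{u. length u \<le> d}. c u * word_trace s A (rev u @ v) * c v))"
proof -
  let ?I = "{u :: 'n list. length u \<le> d}"
  define s where "s = card ?I"
  obtain h where h: "bij_betw h {..<s} ?I"
    using ex_bij_betw_nat_finite[OF finite_words_le] unfolding s_def lessThan_atLeast0 by blast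
  define g where "g = inv_into {..<s} h"
  have g: "g u < s" "h (g u) = u" if "u \<in> ?I" for u
    using that h bij_betw_inv_into[OF h] bij_betw_inv_into_right[OF h]
    unfolding g_def by (auto simp: bij_betw_def)
  have hI: "h i \<in> ?I" if "i < s" for i using that h by (auto simp: bij_betw_def)
  have hinj: "h i = h j \<longleftrightarrow> i = j" if "i < s" "j < s" for i j
    using that h by (auto simp: bij_betw_def inj_on_def)
  have "s > 0" using g[of "[]"] by simp
  define A where "A x = mat s s (\<lambda>(i, j). if h i = x # h j \<or> h j = x # h i then 1 else (0 :: real))" for x
  have sym: "sym_tuple s A" unfolding sym_tuple_def
  proof (intro allI conjI)
    show "A x \<in> carrier_mat s s" for x by (simp add: A_def)
    show "transpose_mat (A x) = A x" for x by (rule eq_matI) (auto simp: A_def)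
  qed
  \<comment> \<open>\<open>g []\<close> is the index of the vacuum, and the entry is the coefficient
    of \<open>h i\<close> in \<open>u\<close> applied to it. A step of the product from
    \<open>l\<close> to \<open>i\<close> creates or annihilates a letter; after an annihilation
    \<open>h l\<close> is longer than the remaining word, which therefore does not
    contribute.\<close>
  have tri: "eval_word s A u $$ (i, g []) = of_bool (u = h i)" if "length u \<le> length (h i)" "i < s" for u i
    using that
  proof (induction u arbitrary: i)
    case Nil
    have "i = g [] \<longleftrightarrow> [] = h i" using g[of "[]"] Nil hinj[of i "g []"] by auto
    with Nil g[of "[]"] show ?case by simp
  next
    case (Cons x u)
    have "eval_word s A (x # u) $$ (i, g []) = (\<Sum>l<s. A x $$ (i, l) * eval_word s A u $$ (l, g []))"
      using index_mult_mat_sum[OF letter_carrier[OF sym] eval_word_carrier[OF sym] Cons.prems(2)] g[of "[]"]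
      by simp
    also have "\<dots> = (\<Sum>l<s. if h i = x # u \<and> l = g u then 1 else 0)"
    proof (intro sum.cong refl)
      fix l assume "l \<in> {..<s}"
      then have l: "l < s" by simp
      have uI: "u \<in> ?I" using Cons.prems hI[of i] by simp
      show "A x $$ (i, l) * eval_word s A u $$ (l, g []) = (if h i = x # u \<and> l = g u then 1 else 0)"
      proof (cases "h i = x # h l \<or> h l = x # h i")
        case True
        then have "length u \<le> length (h l)" using Cons.prems by auto
        from Cons.IH[OF this l] have "eval_word s A u $$ (l, g []) = of_bool (u = h l)" .
        moreover have "u \<noteq> h l" if "h l = x # h i" using that Cons.prems by auto
        moreover have "u = h l \<longleftrightarrow> l = g u" using hinj[of l "g u"] g[OF uI] l by auto
        ultimately show ?thesis using True Cons.prems l by (auto simp: A_def)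
      next
        case False
        then have "\<not> (h i = x # u \<and> l = g u)" using g[OF uI] by auto
        with False show ?thesis using Cons.prems l by (simp add: A_def)
      qed
    qed
    also have "\<dots> = of_bool (x # u = h i)"
      using g[of u] Cons.prems hI[of i] by (auto simp: sum.delta)
    finally show ?case .
  qed
  have "0 < (\<Sum>u\<in>?I. \<Sum>v\<in>?I. c u * word_trace s A (rev u @ v) * c v)" if c: "\<exists>u\<in>?I. c u \<noteq> 0" for c
  proof -
    define T where "T = {u \<in> ?I. c u \<noteq> 0}"
    have T: "finite T" "T \<noteq> {}" using c finite_words_le[of d] by (auto simp: T_def)
    \<comment> \<open>For a longest word \<open>t\<close> with \<open>c t \<noteq> 0\<close> the
      triangular form applies to every word in the support, so the coefficient of \<open>t\<close>
      in the image of the vacuum is exactly \<open>c t\<close>.\<close>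
    have "Max (length ` T) \<in> length ` T" using T by (intro Max_in) auto
    then obtain t where t: "t \<in> T" "length t = Max (length ` T)" by auto
    have tmax: "length u \<le> length t" if "u \<in> T" for u using T that t by simp
    have tI: "t \<in> ?I" "c t \<noteq> 0" using t by (auto simp: T_def)
    have "(\<Sum>u\<in>?I. c u * eval_word s A u $$ (g t, g [])) = (\<Sum>u\<in>?I. if u = t then c t else 0)"
    proof (intro sum.cong refl)
      fix u assume "u \<in> ?I"
      show "c u * eval_word s A u $$ (g t, g []) = (if u = t then c t else 0)"
      proof (cases "c u = 0")
        case False
        then have "length u \<le> length (h (g t))" using tmax[of u] \<open>u \<in> ?I\<close> g[OF tI(1)] by (simp add: T_def)
        from tri[OF this] show ?thesis using g[OF tI(1)] by simp
      qed (use tI in auto)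
    qed
    then have val: "(\<Sum>u\<in>?I. c u * eval_word s A u $$ (g t, g [])) = c t"
      using tI sum.delta[OF finite_words_le[of d], of t "\<lambda>_. c t"] by simp
    \<comment> \<open>The trace is a sum of squares over all entries; the one in the vacuum column
      and row \<open>t\<close> suffices for positivity.\<close>
    let ?S = "\<lambda>i j. (\<Sum>u\<in>?I. c u * eval_word s A u $$ (j, i))\<^sup>2"
    have "0 < ?S (g []) (g t)" using val tI by simp
    also have "\<dots> \<le> (\<Sum>j<s. ?S (g []) j)" using g[OF tI(1)] by (intro member_le_sum) auto
    also have "\<dots> \<le> (\<Sum>i<s. \<Sum>j<s. ?S i j)"
      using g[of "[]"] by (intro member_le_sum[of _ _ "\<lambda>i. \<Sum>j<s. ?S i j"]) (auto intro: sum_nonneg)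
    finally show ?thesis unfolding word_trace_quadratic[OF sym] using \<open>s > 0\<close> by simp
  qed
  with sym \<open>s > 0\<close> show ?thesis by blast
qed

section \<open>From sums of squares to representations\<close>

lemma member_le_sum_list_nonneg:
  fixes f :: "'a \<Rightarrow> real"
  assumes "\<And>x. x \<in> set xs \<Longrightarrow> 0 \<le> f x" "x \<in> set xs"
  shows "f x \<le> (\<Sum>x\<leftarrow>xs. f x)"
  using assms
proof (induction xs)
  case (Cons a xs)
  have "0 \<le> (\<Sum>x\<leftarrow>xs. f x)" using Cons.prems by (intro sum_list_nonneg) auto
  with Cons show ?case by (cases "x = a") fastforce+
qed simp

lemma riesz_scale: "riesz y (Poly_Mapping.single [] c * f) = c * riesz y f"
proof (cases "c = 0")
  case False
  then show ?thesis unfolding riesz_mult by (simp add: riesz_def sum_distrib_left mult.assoc)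
qed simp

lemma riesz_square_of_nc_degree:
  fixes g :: "'n::finite nc_poly"
  assumes "nc_degree g \<le> k"
  shows "riesz y (nc_star g * g) = (\<Sum>u\<in>{u. length u \<le> k}. \<Sum>v\<in>{u. length u \<le> k}.
    Poly_Mapping.lookup g u * y (rev u @ v) * Poly_Mapping.lookup g v)"
  using riesz_square_superset[OF finite_words_le] assms by (simp add: nc_degree_le_iff)

text \<open>Leading parts of hermitian squares cannot cancel, not even modulo commutators, because a
  faithful trace is positive on each of them.\<close>

lemma square_summands_nc_degree:
  fixes f :: "'n::finite nc_poly"
  assumes "cyc_equiv f (\<Sum>g\<leftarrow>gs. nc_star g * g)" "nc_degree f \<le> 2 * k" "h \<in> set gs"
  shows "nc_degree h \<le> k"
proof (rule ccontr)
  assume "\<not> nc_degree h \<le> k"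
  define d where "d = Max (nc_degree ` set gs)"
  have dmax: "nc_degree g \<le> d" if "g \<in> set gs" for g using that by (simp add: d_def)
  then have "k < d" using assms(3) \<open>\<not> _\<close> by (meson not_le order_less_le_trans)
  have "d \<in> nc_degree ` set gs" unfolding d_def using assms(3) by (intro Max_in) auto
  then obtain g0 where g0: "g0 \<in> set gs" "nc_degree g0 = d" by auto
  have "d \<in> insert 0 (length ` Poly_Mapping.keys g0)"
    unfolding g0(2)[symmetric] nc_degree_def by (intro Max_in) auto
  with \<open>k < d\<close> obtain w where w: "w \<in> Poly_Mapping.keys g0" "length w = d" by auto
  let ?I = "{u :: 'n list. length u \<le> d}"
  obtain s and A :: "'n \<Rightarrow> real mat" where A: "sym_tuple s A"
    "\<And>c. \<exists>u\<in>?I. c u \<noteq> 0 \<Longrightarrow> 0 < (\<Sum>u\<in>?I. \<Sum>v\<in>?I. c u * word_trace s A (rev u @ v) * c v)"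
    using exists_faithful_tuple[of d] by blast
  \<comment> \<open>Keeping only words of length exactly \<open>2 * d\<close> preserves cyclic
    invariance, kills \<open>f\<close>, and sees of each square only the product of the parts of
    degree \<open>d\<close>.\<close>
  define y where "y w = (if length w = 2 * d then word_trace s A w else 0)" for w
  have "tracial y" unfolding tracial_def
  proof (intro allI)
    show "y (u @ v) = y (v @ u)" for u v
      using tracial_word_trace[OF A(1)] by (simp add: y_def tracial_def add.commute)
  qed
  have "riesz y f = 0" unfolding riesz_def
    using assms(2) \<open>k < d\<close> by (intro sum.neutral) (auto simp: y_def nc_degree_le_iff)
  define top where "top g u = (if length u = d then Poly_Mapping.lookup g u else 0)" for g :: "'n nc_poly" and u
  have sq: "riesz y (nc_star g * g) = (\<Sum>u\<in>?I. \<Sum>v\<in>?I. top g u * word_trace s A (rev u @ v) * top g v)"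
    if "g \<in> set gs" for g
    unfolding riesz_square_of_nc_degree[OF dmax[OF that]]
    by (intro sum.cong refl) (auto simp: y_def top_def)
  have nonneg: "0 \<le> riesz y (nc_star g * g)" if "g \<in> set gs" for g
    unfolding sq[OF that] word_trace_quadratic[OF A(1)] by (simp add: sum_nonneg)
  have "0 < riesz y (nc_star g0 * g0)" unfolding sq[OF g0(1)]
    by (rule A(2), rule bexI[of _ w]) (use w in \<open>auto simp: top_def in_keys_iff\<close>)
  also have "\<dots> \<le> (\<Sum>g\<leftarrow>gs. riesz y (nc_star g * g))"
    by (rule member_le_sum_list_nonneg[OF nonneg g0(1)])
  also have "\<dots> = riesz y f"
    using riesz_cyc_equiv[OF \<open>tracial y\<close> assms(1)] by (simp add: riesz_sum_list)
  finally show False using \<open>riesz y f = 0\<close> by simp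
qed

lemma has_tracial_rep_cong:
  "has_tracial_rep m z \<Longrightarrow> (\<And>w. length w \<le> m \<Longrightarrow> y w = z w) \<Longrightarrow> has_tracial_rep m y"
  unfolding has_tracial_rep_def by simp

lemma has_tracial_rep_Nil: "has_tracial_rep m y \<Longrightarrow> y [] = 1"
  unfolding has_tracial_rep_alt by (auto simp: word_trace_Nil)

lemma trace_positive_squares_imp_tracial_rep:
  fixes y :: "'n::finite list \<Rightarrow> real"
  assumes squares: "\<And>f :: 'n nc_poly. trace_positive f \<Longrightarrow> nc_degree f \<le> 2 * k \<Longrightarrow> f \<in> Theta_sq"
    and seq: "tracial_seq (2 * k) y"
    and pd: "pos_def_on {w. length w \<le> k} (moment_matrix y)"
  shows "has_tracial_rep (2 * k) y"
proof (rule ccontr)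
  assume norep: "\<not> ?thesis"
  let ?W = "{w :: 'n list. length w \<le> 2 * k}" and ?V = "{w :: 'n list. length w \<le> k}"
  note finW = finite_words_le[where 'n = 'n, of "2 * k"]
  \<comment> \<open>The representable sequences translated by \<open>y\<close>. A member that
    vanishes on all words of length at most \<open>2 * k\<close> would make \<open>y\<close>
    representable.\<close>
  define C where "C = {(\<lambda>w. z w - y w) | z. has_tracial_rep (2 * k) z}"
  have "\<exists>a. (\<forall>c\<in>C. 0 \<le> (\<Sum>w\<in>?W. a w * c w)) \<and> (\<exists>c\<in>C. 0 < (\<Sum>w\<in>?W. a w * c w))"
  proof (rule proper_separation[OF finW])
    obtain s and A :: "'n \<Rightarrow> real mat" where "s > 0" "sym_tuple s A"
      using exists_faithful_tuple[of 0] by blast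
    then show "C \<noteq> {}" unfolding C_def using has_tracial_rep_word_trace[of s A "2 * k"] by blast
    show "(\<lambda>w. (1 - t) * c w + t * c' w) \<in> C" if c: "c \<in> C" "c' \<in> C" and t: "0 \<le> t" "t \<le> 1" for c c' t
    proof -
      obtain z z' where z: "has_tracial_rep (2 * k) z" "has_tracial_rep (2 * k) z'"
        "c = (\<lambda>w. z w - y w)" "c' = (\<lambda>w. z' w - y w)" using c unfolding C_def by blast
      have "(\<lambda>w. (1 - t) * c w + t * c' w) = (\<lambda>w. ((1 - t) * z w + t * z' w) - y w)"
        by (simp add: z algebra_simps)
      with has_tracial_rep_convex[OF z(1,2) t] show ?thesis
        unfolding C_def by (intro CollectI exI[of _ "\<lambda>w. (1 - t) * z w + t * z' w"] conjI)
    qed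
    show "\<exists>w\<in>?W. c w \<noteq> 0" if "c \<in> C" for c
    proof (rule ccontr)
      obtain z where z: "has_tracial_rep (2 * k) z" "c = (\<lambda>w. z w - y w)" using \<open>c \<in> C\<close> unfolding C_def by blast
      assume "\<not> ?thesis"
      then have "has_tracial_rep (2 * k) y" by (intro has_tracial_rep_cong[OF z(1)]) (simp add: z(2))
      with norep show False ..
    qed
  qed
  then obtain a c0 where a: "\<And>c. c \<in> C \<Longrightarrow> 0 \<le> (\<Sum>w\<in>?W. a w * c w)"
    and c0: "c0 \<in> C" "0 < (\<Sum>w\<in>?W. a w * c0 w)" by blast
  obtain z0 where z0: "has_tracial_rep (2 * k) z0" "c0 = (\<lambda>w. z0 w - y w)"
    using c0(1) unfolding C_def by blast
  have a_rep: "0 \<le> (\<Sum>w\<in>?W. a w * (z w - y w))" if "has_tracial_rep (2 * k) z" for z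
  proof -
    have "(\<lambda>w. z w - y w) \<in> C" unfolding C_def using that by blast
    from a[OF this] show ?thesis .
  qed
  \<comment> \<open>The constant turns the affine inequality into a linear one: for
    \<open>z [] = 1\<close> the value at \<open>f\<close> is the separating functional at
    \<open>z - y\<close>. Hence \<open>f\<close> is nonnegative on representable sequences and 0 at
    \<open>y\<close>.\<close>
  define f where "f = poly_of_fun ?W a - Poly_Mapping.single [] (\<Sum>w\<in>?W. a w * y w)"
  have rf: "riesz z f = (\<Sum>w\<in>?W. a w * (z w - y w))" if "z [] = 1" for z
    by (simp add: f_def riesz_diff riesz_poly_of_fun that right_diff_distrib sum_subtractf)
  have deg: "nc_degree f \<le> 2 * k"
    unfolding nc_degree_le_iff
    by (auto simp: f_def in_keys_iff lookup_minus lookup_poly_of_fun[OF finW] lookup_single when_def split: if_splits)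
  have "trace_positive f"
    by (rule trace_positiveI) (simp add: rf word_trace_Nil a_rep has_tracial_rep_word_trace)
  from squares[OF this deg] obtain gs where gs: "cyc_equiv f (\<Sum>g\<leftarrow>gs. nc_star g * g)"
    by (auto simp: Theta_sq_def)
  let ?y = "truncate (2 * k) y"
  have sq: "riesz ?y (nc_star g * g)
      = (\<Sum>u\<in>?V. \<Sum>v\<in>?V. Poly_Mapping.lookup g u * moment_matrix y u v * Poly_Mapping.lookup g v)"
    if "g \<in> set gs" for g
    unfolding riesz_square_of_nc_degree[OF square_summands_nc_degree[OF gs deg that]]
    by (intro sum.cong refl) (auto simp: truncate_def moment_matrix_def)
  have pos: "0 < riesz ?y (nc_star g * g)" if g: "g \<in> set gs" "g \<noteq> 0" for g
  proof -
    obtain w where "w \<in> Poly_Mapping.keys g" using g by (metis ex_in_conv keys_eq_empty)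
    moreover from this have "w \<in> ?V"
      using square_summands_nc_degree[OF gs deg g(1)] by (auto simp: nc_degree_le_iff)
    ultimately have "\<exists>u\<in>?V. Poly_Mapping.lookup g u \<noteq> 0" by (auto simp: in_keys_iff)
    then show ?thesis unfolding sq[OF g(1)] using pd unfolding pos_def_on_def by blast
  qed
  have nonneg: "0 \<le> riesz ?y (nc_star g * g)" if "g \<in> set gs" for g
    using pos[OF that] by (cases "g = 0") auto
  have "riesz ?y f = riesz y f"
    using deg by (intro riesz_cong) (auto simp: truncate_def nc_degree_le_iff)
  also have "\<dots> = 0" using rf[of y] seq by (simp add: tracial_seq_def)
  finally have sum0: "(\<Sum>g\<leftarrow>gs. riesz ?y (nc_star g * g)) = 0"
    using riesz_cyc_equiv[OF tracial_truncate[OF seq] gs] by (simp add: riesz_sum_list)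
  \<comment> \<open>The values of the squares at \<open>y\<close> are nonnegative with sum 0, and a
    nonzero \<open>g\<close> would contribute a positive one.\<close>
  have zero: "g = 0" if "g \<in> set gs" for g
    using member_le_sum_list_nonneg[of gs "\<lambda>g. riesz ?y (nc_star g * g)", OF nonneg that] pos[OF that] sum0
    by force
  have "map (\<lambda>g. nc_star g * g) gs = map (\<lambda>g. 0) gs"
    by (rule map_cong) (use zero in force)+
  then have "(\<Sum>g\<leftarrow>gs. nc_star g * g) = (\<Sum>g\<leftarrow>gs. 0)" by (rule arg_cong)
  also have "\<dots> = 0" by (induction gs) auto
  finally have "(\<Sum>g\<leftarrow>gs. nc_star g * g) = 0" .
  \<comment> \<open>Now \<open>f\<close> vanishes on every representable sequence, against the
    positive value at \<open>z0\<close>.\<close>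
  with gs have "cyc_equiv f 0" by simp
  with has_tracial_rep_cyc_equiv[OF z0(1) deg] rf[of z0, OF has_tracial_rep_Nil[OF z0(1)]] c0(2) z0(2) show False by simp
qed

section \<open>From representations to sums of squares\<close>

text \<open>The squares enter only through the Gram matrix of their coefficients, whose size depends
  on \<open>k\<close> but not on the length of \<open>gs\<close>. Limits are taken of these
  matrices.\<close>

lemma riesz_sum_squares_gram:
  fixes gs :: "'n::finite nc_poly list"
  assumes "\<And>g. g \<in> set gs \<Longrightarrow> nc_degree g \<le> k"
  shows "riesz y (\<Sum>g\<leftarrow>gs. nc_star g * g) = (\<Sum>u\<in>{u. length u \<le> k}. \<Sum>v\<in>{u. length u \<le> k}.
    y (rev u @ v) * (\<Sum>g\<leftarrow>gs. Poly_Mapping.lookup g u * Poly_Mapping.lookup g v))"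
  using assms
proof (induction gs)
  case (Cons g gs)
  then have "riesz y (nc_star g * g) = (\<Sum>u\<in>{u. length u \<le> k}. \<Sum>v\<in>{u. length u \<le> k}.
    Poly_Mapping.lookup g u * y (rev u @ v) * Poly_Mapping.lookup g v)"
    by (intro riesz_square_of_nc_degree) simp
  with Cons show ?case by (simp add: riesz_add ring_distribs sum.distrib mult_ac)
qed simp

lemma Gram_entry_bound:
  fixes f :: "'a \<Rightarrow> 'b \<Rightarrow> real"
  shows "\<bar>\<Sum>g\<leftarrow>gs. f g u * f g v\<bar> \<le> ((\<Sum>g\<leftarrow>gs. (f g u)\<^sup>2) + (\<Sum>g\<leftarrow>gs. (f g v)\<^sup>2)) / 2"
proof (induction gs)
  case (Cons g gs)
  have "\<bar>f g u * f g v\<bar> \<le> ((f g u)\<^sup>2 + (f g v)\<^sup>2) / 2"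
    using sum_squares_bound[of "\<bar>f g u\<bar>" "\<bar>f g v\<bar>"] by (simp add: abs_mult)
  with Cons show ?case by (simp add: add_divide_distrib)
qed simp

lemma Gram_quadratic:
  fixes f :: "'a \<Rightarrow> 'b \<Rightarrow> real"
  shows "(\<Sum>u\<in>I. \<Sum>v\<in>I. c u * (\<Sum>g\<leftarrow>gs. f g u * f g v) * c v) = (\<Sum>g\<leftarrow>gs. (\<Sum>u\<in>I. c u * f g u)\<^sup>2)"
proof (induction gs)
  case (Cons g gs)
  have "(\<Sum>u\<in>I. c u * f g u)\<^sup>2 = (\<Sum>u\<in>I. \<Sum>v\<in>I. c u * (f g u * f g v) * c v)"
    by (simp add: power2_eq_square sum_product mult_ac)
  with Cons show ?case by (simp add: ring_distribs sum.distrib)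
qed simp

text \<open>A faithful trace controls the diagonals of the Gram matrices, the diagonals control all
  entries, and a limit matrix is again positive semidefinite, hence a Gram matrix of finitely many
  polynomials.\<close>

lemma sum_of_squares_cone_closed:
  fixes f :: "'n::finite nc_poly"
  assumes approx: "\<And>n. \<exists>gs. (\<forall>g\<in>set gs. nc_degree g \<le> k) \<and>
    cyc_equiv (f + Poly_Mapping.single [] (1 / real (Suc n)) * e) (\<Sum>g\<leftarrow>gs. nc_star g * g)"
  shows "\<exists>gs. cyc_equiv f (\<Sum>g\<leftarrow>gs. nc_star g * g)"
proof -
  let ?V = "{u :: 'n list. length u \<le> k}"
  note finV = finite_words_le[where 'n = 'n, of k]
  have scale: "riesz y (f + Poly_Mapping.single [] c * e) = riesz y f + c * riesz y e" for y c
    by (simp add: riesz_add riesz_scale)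
  obtain gs where *: "\<forall>n. (\<forall>g\<in>set (gs n). nc_degree g \<le> k) \<and>
    cyc_equiv (f + Poly_Mapping.single [] (1 / real (Suc n)) * e) (\<Sum>g\<leftarrow>gs n. nc_star g * g)"
    by (rule exE[OF choice[OF allI[OF approx]]])
  note deg = *[rule_format, THEN conjunct1, THEN bspec]
  note gs = *[rule_format, THEN conjunct2]
  define G where "G n u v = (\<Sum>g\<leftarrow>gs n. Poly_Mapping.lookup g u * Poly_Mapping.lookup g v)" for n u v
  have eq: "riesz y f + 1 / real (Suc n) * riesz y e = (\<Sum>u\<in>?V. \<Sum>v\<in>?V. y (rev u @ v) * G n u v)"
    if "tracial y" for y n
    using riesz_cyc_equiv[OF that gs] riesz_sum_squares_gram[of "gs n" k y, OF deg] unfolding scale G_def by simp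
  obtain s and A :: "'n \<Rightarrow> real mat" where A: "sym_tuple s A"
    "\<And>c. \<exists>u\<in>?V. c u \<noteq> 0 \<Longrightarrow> 0 < (\<Sum>u\<in>?V. \<Sum>v\<in>?V. c u * word_trace s A (rev u @ v) * c v)"
    using exists_faithful_tuple[of k] by blast
  let ?t = "word_trace s A"
  obtain \<kappa> where \<kappa>: "\<kappa> > 0"
    "\<And>c. \<kappa> * (\<Sum>u\<in>?V. (c u)\<^sup>2) \<le> (\<Sum>u\<in>?V. \<Sum>v\<in>?V. c u * ?t (rev u @ v) * c v)"
    using pos_def_lower_bound[OF finV, of "\<lambda>u v. ?t (rev u @ v)"] A(2) by blast
  \<comment> \<open>The factor \<open>1 / real (Suc n)\<close> in front of \<open>e\<close> is at
    most 1, so this bound holds for all \<open>n\<close>.\<close>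
  define B where "B = (\<bar>riesz ?t f\<bar> + \<bar>riesz ?t e\<bar>) / \<kappa>"
  have diag: "G n w w \<le> B" if w: "w \<in> ?V" for n w
  proof -
    have "\<kappa> * G n w w = (\<Sum>g\<leftarrow>gs n. \<kappa> * (Poly_Mapping.lookup g w)\<^sup>2)"
      by (simp add: G_def power2_eq_square sum_list_const_mult)
    also have "\<dots> \<le> (\<Sum>g\<leftarrow>gs n. riesz ?t (nc_star g * g))"
    proof (rule sum_list_mono)
      fix g assume g: "g \<in> set (gs n)"
      have "(Poly_Mapping.lookup g w)\<^sup>2 \<le> (\<Sum>u\<in>?V. (Poly_Mapping.lookup g u)\<^sup>2)"
        using w finV by (intro member_le_sum) auto
      then have "\<kappa> * (Poly_Mapping.lookup g w)\<^sup>2 \<le> \<kappa> * (\<Sum>u\<in>?V. (Poly_Mapping.lookup g u)\<^sup>2)"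
        using \<kappa>(1) by simp
      also have "\<dots> \<le> riesz ?t (nc_star g * g)"
        unfolding riesz_square_of_nc_degree[OF deg[OF g]] by (rule \<kappa>(2))
      finally show "\<kappa> * (Poly_Mapping.lookup g w)\<^sup>2 \<le> riesz ?t (nc_star g * g)" .
    qed
    also have "\<dots> = riesz ?t f + 1 / real (Suc n) * riesz ?t e"
      using riesz_cyc_equiv[OF tracial_word_trace[OF A(1)] gs] by (simp add: scale riesz_sum_list)
    also have "1 / real (Suc n) * riesz ?t e \<le> 1 / real (Suc n) * \<bar>riesz ?t e\<bar>"
      by (intro mult_left_mono) auto
    also have "1 / real (Suc n) * \<bar>riesz ?t e\<bar> \<le> 1 * \<bar>riesz ?t e\<bar>"
      by (intro mult_right_mono) auto
    finally have "\<kappa> * G n w w \<le> \<kappa> * B" using \<kappa>(1) by (simp add: B_def)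
    then show ?thesis using \<kappa>(1) by simp
  qed
  have bound: "\<bar>G n (fst p) (snd p)\<bar> \<le> B" if "p \<in> ?V \<times> ?V" for n p
  proof -
    have "\<bar>G n (fst p) (snd p)\<bar> \<le> (G n (fst p) (fst p) + G n (snd p) (snd p)) / 2"
      unfolding G_def
      by (rule Gram_entry_bound[where f = Poly_Mapping.lookup and gs = "gs n", unfolded power2_eq_square])
    with diag[of "fst p" n] diag[of "snd p" n] that show ?thesis by auto
  qed
  obtain l r where r: "strict_mono r"
    and l: "\<forall>p\<in>?V \<times> ?V. (\<lambda>n. G (r n) (fst p) (snd p)) \<longlonglongrightarrow> l p"
    using bounded_seq_convergent_subseq[where X = "\<lambda>n p. G n (fst p) (snd p)",
      OF finite_cartesian_product[OF finV finV] bound] by blast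
  define L where "L u v = l (u, v)" for u v
  have lim: "(\<lambda>n. G (r n) u v) \<longlonglongrightarrow> L u v" if "u \<in> ?V" "v \<in> ?V" for u v
    using l that unfolding L_def by force
  have "\<exists>hs. \<forall>u\<in>?V. \<forall>v\<in>?V. L u v = (\<Sum>h\<leftarrow>hs. h u * h v)"
  proof (rule psd_sum_of_squares[OF finV])
    show "L u v = L v u" if "u \<in> ?V" "v \<in> ?V" for u v
    proof -
      have "G (r n) u v = G (r n) v u" for n by (simp add: G_def mult.commute)
      with lim[of u v] lim[of v u] that show ?thesis using LIMSEQ_unique by fastforce
    qed
    fix c :: "'n list \<Rightarrow> real"
    have "0 \<le> (\<Sum>u\<in>?V. \<Sum>v\<in>?V. c u * G n u v * c v)" for n
    proof -
      have "(\<Sum>u\<in>?V. \<Sum>v\<in>?V. c u * G n u v * c v) = (\<Sum>g\<leftarrow>gs n. (\<Sum>u\<in>?V. c u * Poly_Mapping.lookup g u)\<^sup>2)"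
        unfolding G_def by (rule Gram_quadratic)
      also have "\<dots> \<ge> 0" by (intro sum_list_nonneg) auto
      finally show ?thesis .
    qed
    moreover have "(\<lambda>n. \<Sum>u\<in>?V. \<Sum>v\<in>?V. c u * G (r n) u v * c v) \<longlonglongrightarrow> (\<Sum>u\<in>?V. \<Sum>v\<in>?V. c u * L u v * c v)"
      by (intro tendsto_intros lim)
    ultimately show "0 \<le> (\<Sum>u\<in>?V. \<Sum>v\<in>?V. c u * L u v * c v)"
      by (intro LIMSEQ_le_const) auto
  qed
  then obtain hs where hs: "\<And>u v. u \<in> ?V \<Longrightarrow> v \<in> ?V \<Longrightarrow> L u v = (\<Sum>h\<leftarrow>hs. h u * h v)" by blast
  have "cyc_equiv f (\<Sum>g\<leftarrow>map (poly_of_fun ?V) hs. nc_star g * g)"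
    unfolding cyc_equiv_iff_riesz
  proof (intro allI impI)
    fix y :: "'n list \<Rightarrow> real" assume y: "tracial y"
    have "riesz y (\<Sum>g\<leftarrow>map (poly_of_fun ?V) hs. nc_star g * g) = (\<Sum>u\<in>?V. \<Sum>v\<in>?V. y (rev u @ v) *
        (\<Sum>g\<leftarrow>map (poly_of_fun ?V) hs. Poly_Mapping.lookup g u * Poly_Mapping.lookup g v))"
      by (rule riesz_sum_squares_gram) (use keys_poly_of_fun[OF finV] in \<open>auto simp: nc_degree_le_iff\<close>)
    also have "\<dots> = (\<Sum>u\<in>?V. \<Sum>v\<in>?V. y (rev u @ v) * L u v)"
      by (intro sum.cong refl) (simp add: hs lookup_poly_of_fun[OF finV] o_def)
    finally have val: "riesz y (\<Sum>g\<leftarrow>map (poly_of_fun ?V) hs. nc_star g * g) = (\<Sum>u\<in>?V. \<Sum>v\<in>?V. y (rev u @ v) * L u v)" .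
    have "(\<lambda>n. \<Sum>u\<in>?V. \<Sum>v\<in>?V. y (rev u @ v) * G (r n) u v) \<longlonglongrightarrow> (\<Sum>u\<in>?V. \<Sum>v\<in>?V. y (rev u @ v) * L u v)"
      by (intro tendsto_intros lim)
    then have 1: "(\<lambda>n. riesz y f + 1 / real (Suc (r n)) * riesz y e) \<longlonglongrightarrow> (\<Sum>u\<in>?V. \<Sum>v\<in>?V. y (rev u @ v) * L u v)"
      unfolding eq[OF y] .
    have "(\<lambda>n. 1 / real (Suc (r n))) \<longlonglongrightarrow> 0"
      using LIMSEQ_subseq_LIMSEQ[OF lim_inverse_n' [THEN LIMSEQ_Suc] r] by (simp add: o_def)
    then have "(\<lambda>n. riesz y f + 1 / real (Suc (r n)) * riesz y e) \<longlonglongrightarrow> riesz y f + 0 * riesz y e"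
      by (intro tendsto_intros)
    from LIMSEQ_unique[OF this 1] show "riesz y f = riesz y (\<Sum>g\<leftarrow>map (poly_of_fun ?V) hs. nc_star g * g)"
      unfolding val by simp
  qed
  then show ?thesis by blast
qed

section \<open>Separation from the cone of sums of squares\<close>

lemma riesz_indicator: "riesz (\<lambda>u. of_bool (u = w)) f = Poly_Mapping.lookup f w"
proof -
  have "Poly_Mapping.lookup f u * of_bool (u = w) = (if u = w then Poly_Mapping.lookup f w else 0)" for u
    by simp
  then show ?thesis by (simp add: riesz_def in_keys_iff)
qed

text \<open>The hypothesis \<open>rep\<close> speaks of normalized, positive definite sequences,
  whereas \<open>y\<close> is only positive semidefinite and may vanish at the empty word. A small
  multiple of a faithful trace repairs both and keeps a negative value at \<open>f\<close>
  negative.\<close>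

lemma psd_functional_nonneg_on_trace_positive:
  fixes f :: "'n::finite nc_poly"
  assumes rep: "\<And>y :: 'n list \<Rightarrow> real. tracial_seq (2 * k) y \<Longrightarrow>
      pos_def_on {w. length w \<le> k} (moment_matrix y) \<Longrightarrow> has_tracial_rep (2 * k) y"
    and f: "trace_positive f" "nc_degree f \<le> 2 * k"
    and y: "tracial y" "\<And>w. y (rev w) = y w"
    and psd: "\<And>g. nc_degree g \<le> k \<Longrightarrow> 0 \<le> riesz y (nc_star g * g)"
  shows "0 \<le> riesz y f"
proof (rule ccontr)
  assume "\<not> ?thesis"
  then have neg: "riesz y f < 0" by simp
  let ?V = "{u :: 'n list. length u \<le> k}"
  note finV = finite_words_le[where 'n = 'n, of k]
  obtain s and A :: "'n \<Rightarrow> real mat" where A: "s > 0" "sym_tuple s A"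
    "\<And>c. \<exists>u\<in>?V. c u \<noteq> 0 \<Longrightarrow> 0 < (\<Sum>u\<in>?V. \<Sum>v\<in>?V. c u * word_trace s A (rev u @ v) * c v)"
    using exists_faithful_tuple[of k] by blast
  let ?t = "word_trace s A"
  have psd': "0 \<le> (\<Sum>u\<in>?V. \<Sum>v\<in>?V. c u * y (rev u @ v) * c v)" for c
  proof -
    have deg: "nc_degree (poly_of_fun ?V c) \<le> k"
      using keys_poly_of_fun[OF finV] by (simp add: nc_degree_le_iff)
    have "riesz y (nc_star (poly_of_fun ?V c) * poly_of_fun ?V c)
        = (\<Sum>u\<in>?V. \<Sum>v\<in>?V. c u * y (rev u @ v) * c v)"
      unfolding riesz_square_of_nc_degree[OF deg]
      by (intro sum.cong refl) (simp add: lookup_poly_of_fun[OF finV])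
    with psd[OF deg] show ?thesis by simp
  qed
  have y0: "0 \<le> y []"
    using psd[of "word_poly []"] by (simp add: nc_degree_le_iff riesz_square)
  \<comment> \<open>The perturbation may use up half of the margin \<open>- riesz y f\<close>; the
    summand 1 keeps the denominator positive when the trace of \<open>f\<close> is 0.\<close>
  define \<delta> where "\<delta> = - riesz y f / (2 * (\<bar>riesz ?t f\<bar> + 1))"
  have \<delta>: "0 < \<delta>" using neg by (simp add: \<delta>_def divide_neg_pos)
  define c where "c = 1 / (y [] + \<delta>)"
  have c: "0 < c" using y0 \<delta> by (simp add: c_def)
  define z where "z w = c * y w + c * \<delta> * ?t w" for w
  have "tracial_seq (2 * k) z"
  proof (rule tracial_seqI)
    show "tracial z" unfolding tracial_def
    proof (intro allI)
      show "z (u @ v) = z (v @ u)" for u v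
        using y(1) tracial_word_trace[OF A(2)] unfolding tracial_def z_def by metis
    qed
    show "z (rev w) = z w" for w by (simp add: z_def y(2) word_trace_rev[OF A(2)])
    have "c * (y [] + \<delta>) = 1" using y0 \<delta> by (simp add: c_def)
    then show "z [] = 1" by (simp add: z_def word_trace_Nil[OF A(2,1)] distrib_left)
  qed
  moreover have "pos_def_on ?V (moment_matrix z)" unfolding pos_def_on_def
  proof (intro conjI ballI allI impI)
    fix u v
    have "z (rev (rev u @ v)) = z (rev u @ v)" unfolding z_def y(2) word_trace_rev[OF A(2)] ..
    then show "moment_matrix z u v = moment_matrix z v u" by (simp add: moment_matrix_def)
  next
    fix b :: "'n list \<Rightarrow> real" assume b: "\<exists>u\<in>?V. b u \<noteq> 0"
    have "(\<Sum>u\<in>?V. \<Sum>v\<in>?V. b u * moment_matrix z u v * b v)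
        = c * (\<Sum>u\<in>?V. \<Sum>v\<in>?V. b u * y (rev u @ v) * b v)
          + c * \<delta> * (\<Sum>u\<in>?V. \<Sum>v\<in>?V. b u * ?t (rev u @ v) * b v)"
      by (simp add: moment_matrix_def z_def sum_distrib_left ring_distribs sum.distrib mult_ac)
    moreover have "0 < c * \<delta> * (\<Sum>u\<in>?V. \<Sum>v\<in>?V. b u * ?t (rev u @ v) * b v)"
      using A(3)[OF b] c \<delta> by simp
    moreover have "0 \<le> c * (\<Sum>u\<in>?V. \<Sum>v\<in>?V. b u * y (rev u @ v) * b v)"
      using psd'[of b] c by simp
    ultimately show "0 < (\<Sum>u\<in>?V. \<Sum>v\<in>?V. b u * moment_matrix z u v * b v)" by linarith
  qed
  ultimately have "0 \<le> riesz z f"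
    using rep has_tracial_rep_trace_positive[OF _ f(2,1)] by blast
  also have "riesz z f = c * (riesz y f + \<delta> * riesz ?t f)"
    unfolding z_def riesz_lincomb by (simp add: algebra_simps)
  finally have "0 \<le> riesz y f + \<delta> * riesz ?t f" using c by (simp add: zero_le_mult_iff)
  moreover have "\<delta> * riesz ?t f \<le> - riesz y f / 2"
  proof -
    have "\<delta> * riesz ?t f \<le> \<delta> * (\<bar>riesz ?t f\<bar> + 1)" using \<delta> by (intro mult_left_mono) auto
    also have "\<dots> = - riesz y f / 2"
    proof -
      have "\<bar>riesz ?t f\<bar> + 1 \<noteq> 0" by (simp add: add_nonneg_eq_0_iff)
      then show ?thesis unfolding \<delta>_def by (simp del: abs_ge_zero add: divide_simps)
    qed
    finally show ?thesis .
  qed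
  ultimately show False using neg by simp
qed

text \<open>A positive semidefinite matrix with zero diagonal is zero: on the square of
  \<open>u + t v\<close> the functional equals \<open>2 * (t * y w)\<close> for both signs of
  \<open>t\<close>. Every word of length at most \<open>2 * k\<close> is an entry of that
  matrix.\<close>

lemma psd_functional_eq_0:
  fixes y :: "'n::finite list \<Rightarrow> real"
  assumes y: "\<And>w. y (rev w) = y w"
    and psd: "\<And>g. nc_degree g \<le> k \<Longrightarrow> 0 \<le> riesz y (nc_star g * g)"
    and diag: "\<And>v. length v \<le> k \<Longrightarrow> y (rev v @ v) = 0"
    and "length w \<le> 2 * k"
  shows "y w = 0"
proof -
  let ?V = "{u :: 'n list. length u \<le> k}"
  \<comment> \<open>Subtraction is truncated: a word of length at most \<open>k\<close> stays whole
    in \<open>v\<close>, with \<open>u\<close> empty.\<close>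
  define u v where "u = rev (take (length w - k) w)" and "v = drop (length w - k) w"
  have uv: "u \<in> ?V" "v \<in> ?V" "w = rev u @ v" using assms(4) by (auto simp: u_def v_def)
  have yvu: "y (rev v @ u) = y w"
  proof -
    have "rev v @ u = rev w" by (simp add: uv(3))
    then show ?thesis using y[of w] by simp
  qed
  have *: "0 \<le> t * y w" for t
  proof (cases "u = v")
    case True
    then show ?thesis using diag[of v] uv by simp
  next
    case False
    define g where "g = word_poly u + Poly_Mapping.single v t"
    have lk: "Poly_Mapping.lookup g x = (if x = u then 1 else if x = v then t else 0)" for x
      using False by (simp add: g_def lookup_add lookup_single when_def)
    have keys: "Poly_Mapping.keys g \<subseteq> {u, v}" by (auto simp: in_keys_iff lk split: if_splits)
    have "riesz y (nc_star g * g) = 2 * (t * y w)"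
      using riesz_square_superset[OF _ keys, of y] False diag[of u] diag[of v] uv yvu by (simp add: lk)
    moreover have "nc_degree g \<le> k" using keys uv by (auto simp: nc_degree_le_iff)
    ultimately show ?thesis using psd[of g] by simp
  qed
  show ?thesis using *[of 1] *[of "-1"] by simp
qed

lemma riesz_square_scaled:
  fixes g :: "'n::finite nc_poly"
  shows "riesz y (nc_star (Poly_Mapping.single [] t * g) * (Poly_Mapping.single [] t * g))
    = t\<^sup>2 * riesz y (nc_star g * g)"
proof -
  have lk: "Poly_Mapping.lookup (Poly_Mapping.single [] t * g) w = t * Poly_Mapping.lookup g w" for w
    using riesz_scale[of "\<lambda>u. of_bool (u = w)" t g] by (simp add: riesz_indicator)
  have keys: "Poly_Mapping.keys (Poly_Mapping.single [] t * g) \<subseteq> Poly_Mapping.keys g"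
    by (auto simp: in_keys_iff lk)
  show ?thesis
    unfolding riesz_square_superset[OF finite_keys keys]
      riesz_square_superset[OF finite_keys order_refl[of "Poly_Mapping.keys g"]]
    by (simp add: lk sum_distrib_left power2_eq_square mult_ac)
qed

lemma nc_degree_scale: "nc_degree g \<le> k \<Longrightarrow> nc_degree (Poly_Mapping.single [] t * g) \<le> k"
  using keys_mult[of "Poly_Mapping.single [] t" g]
  by (fastforce simp: nc_degree_le_iff plus_list_def split: if_splits)

text \<open>Indicators of classes that contain no word of length at most \<open>2 * k\<close> vanish
  on both sides. The finitely many remaining ones are the coordinates for the separation.\<close>

lemma cyc_equiv_squaresI:
  assumes "\<And>c. c \<in> cyc_rep ` {w. length w \<le> 2 * k} \<Longrightarrow>
      riesz (\<lambda>w. of_bool (cyc_rep w = c)) F = riesz (\<lambda>w. of_bool (cyc_rep w = c)) (\<Sum>g\<leftarrow>gs. nc_star g * g)"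
    and "nc_degree F \<le> 2 * k" "\<And>g. g \<in> set gs \<Longrightarrow> nc_degree (g :: 'n::finite nc_poly) \<le> k"
  shows "cyc_equiv F (\<Sum>g\<leftarrow>gs. nc_star g * g)"
proof (rule cyc_equivI)
  fix c
  show "riesz (\<lambda>w. of_bool (cyc_rep w = c)) F = riesz (\<lambda>w. of_bool (cyc_rep w = c)) (\<Sum>g\<leftarrow>gs. nc_star g * g)"
  proof (cases "c \<in> cyc_rep ` {w. length w \<le> 2 * k}")
    case False
    then have out: "cyc_rep w \<noteq> c" if "length w \<le> 2 * k" for w using that by auto
    have "riesz (\<lambda>w. of_bool (cyc_rep w = c)) F = 0"
      unfolding riesz_def using assms(2) out by (intro sum.neutral) (auto simp: nc_degree_le_iff)
    moreover have "riesz (\<lambda>w. of_bool (cyc_rep w = c)) (\<Sum>g\<leftarrow>gs. nc_star g * g) = 0"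
      by (subst riesz_sum_squares_gram[of gs k]) (use assms(3) out in \<open>auto intro!: sum.neutral\<close>)
    ultimately show ?thesis by simp
  qed (rule assms(1))
qed

text \<open>Separating \<open>f\<close> itself would yield a functional whose value at
  \<open>f\<close> is merely not positive. The separating functional is positive on
  \<open>e\<close>, so a multiple of \<open>e\<close> added to \<open>f\<close> forces a negative
  value at \<open>f\<close>.\<close>

lemma approx_sum_of_squares:
  fixes f :: "'n::finite nc_poly" and k :: nat
  defines "e \<equiv> \<Sum>v\<in>{v. length v \<le> k}. word_poly (rev v @ v)"
  assumes rep: "\<And>y :: 'n list \<Rightarrow> real. tracial_seq (2 * k) y \<Longrightarrow>
      pos_def_on {w. length w \<le> k} (moment_matrix y) \<Longrightarrow> has_tracial_rep (2 * k) y"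
    and f: "trace_positive f" "nc_degree f \<le> 2 * k" "cyc_equiv f (nc_star f)"
    and "0 < \<epsilon>"
  shows "\<exists>gs. (\<forall>g\<in>set gs. nc_degree g \<le> k) \<and>
    cyc_equiv (f + Poly_Mapping.single [] \<epsilon> * e) (\<Sum>g\<leftarrow>gs. nc_star g * g)"
proof (rule ccontr)
  assume none: "\<not> ?thesis"
  let ?F = "f + Poly_Mapping.single [] \<epsilon> * e"
  let ?V = "{u :: 'n list. length u \<le> k}" and ?W = "{u :: 'n list. length u \<le> 2 * k}"
  note finV = finite_words_le[where 'n = 'n, of k]
  have rF: "riesz y ?F = riesz y f + \<epsilon> * riesz y e" for y
    by (simp add: riesz_add riesz_scale)
  have re: "riesz y e = (\<Sum>v\<in>?V. y (rev v @ v))" for y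
    by (simp add: e_def riesz_sum)
  have degF: "nc_degree ?F \<le> 2 * k"
    unfolding nc_degree_le_iff
  proof
    fix w assume "w \<in> Poly_Mapping.keys ?F"
    then have "riesz (\<lambda>u. of_bool (u = w)) ?F \<noteq> 0" by (simp add: riesz_indicator in_keys_iff)
    then have "riesz (\<lambda>u. of_bool (u = w)) f \<noteq> 0 \<or> (\<Sum>v\<in>?V. of_bool (rev v @ v = w) :: real) \<noteq> 0"
      unfolding rF re by auto
    then show "w \<in> ?W"
    proof
      assume "riesz (\<lambda>u. of_bool (u = w)) f \<noteq> 0"
      then show ?thesis using f(2) by (auto simp: riesz_indicator nc_degree_le_iff in_keys_iff)
    next
      assume "(\<Sum>v\<in>?V. of_bool (rev v @ v = w) :: real) \<noteq> 0"
      then obtain v where "v \<in> ?V" "of_bool (rev v @ v = w) \<noteq> (0 :: real)"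
        by (rule sum.not_neutral_contains_not_neutral)
      then have "rev v @ v = w" "length v \<le> k" by (auto split: if_splits)
      then show ?thesis by auto
    qed
  qed
  define q where "q h c = riesz (\<lambda>w. of_bool (cyc_rep w = c)) h" for h :: "'n nc_poly" and c
  define \<Gamma> where "\<Gamma> = {gs :: 'n nc_poly list. \<forall>g\<in>set gs. nc_degree g \<le> k}"
  define SQ where "SQ gs = (\<Sum>g\<leftarrow>gs. nc_star g * g)" for gs :: "'n nc_poly list"
  let ?R = "cyc_rep ` ?W"
  define C where "C = {(\<lambda>c. q (SQ gs) c - q ?F c) | gs. gs \<in> \<Gamma>}"
  have C_E: "\<exists>gs\<in>\<Gamma>. c = (\<lambda>c. q (SQ gs) c - q ?F c)" if "c \<in> C" for c
    using that by (auto simp: C_def)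
  have C_I: "(\<lambda>c. q (SQ gs) c - q ?F c) \<in> C" if "gs \<in> \<Gamma>" for gs
    using that by (auto simp: C_def)
  have "\<exists>a. (\<forall>c\<in>C. 0 \<le> (\<Sum>i\<in>?R. a i * c i)) \<and> (\<exists>c\<in>C. 0 < (\<Sum>i\<in>?R. a i * c i))"
  proof (rule proper_separation)
    show "finite ?R" using finite_words_le by (rule finite_imageI)
    have "[] \<in> \<Gamma>" by (simp add: \<Gamma>_def)
    then show "C \<noteq> {}" using C_I by blast
    show "\<exists>i\<in>?R. c i \<noteq> 0" if "c \<in> C" for c
    proof (rule ccontr)
      from C_E[OF that] obtain gs where gs: "gs \<in> \<Gamma>" "c = (\<lambda>c. q (SQ gs) c - q ?F c)" by (rule bexE)
      assume "\<not> ?thesis"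
      then have "cyc_equiv ?F (\<Sum>g\<leftarrow>gs. nc_star g * g)"
        using gs degF by (intro cyc_equiv_squaresI[of k]) (auto simp: \<Gamma>_def q_def SQ_def)
      with none gs(1) show False unfolding \<Gamma>_def by blast
    qed
    show "(\<lambda>i. (1 - t) * c i + t * d i) \<in> C" if cd: "c \<in> C" "d \<in> C" and t: "0 \<le> t" "t \<le> 1" for c d t
    proof -
      obtain gs where gs: "gs \<in> \<Gamma>" "c = (\<lambda>c. q (SQ gs) c - q ?F c)" by (rule bexE[OF C_E[OF cd(1)]])
      obtain hs where hs: "hs \<in> \<Gamma>" "d = (\<lambda>c. q (SQ hs) c - q ?F c)" by (rule bexE[OF C_E[OF cd(2)]])
      \<comment> \<open>A nonnegative factor \<open>r\<close> is absorbed into a square by scaling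
        its base with \<open>sqrt r\<close>; so sums of squares are closed under convex
        combinations.\<close>
      define sc where "sc r = map (\<lambda>g :: 'n nc_poly. Poly_Mapping.single [] (sqrt r) * g)" for r
      have sc: "riesz y (SQ (sc r gs)) = r * riesz y (SQ gs)" if "0 \<le> r" for y r gs
        using that by (simp add: SQ_def sc_def riesz_sum_list riesz_square_scaled o_def sum_list_const_mult)
      have "sc (1 - t) gs @ sc t hs \<in> \<Gamma>"
        using gs(1) hs(1) by (auto simp: \<Gamma>_def sc_def intro: nc_degree_scale)
      moreover have comb: "riesz y (SQ (sc (1 - t) gs @ sc t hs)) = (1 - t) * riesz y (SQ gs) + t * riesz y (SQ hs)" for y
        using sc[of "1 - t" y gs] sc[of t y hs] t by (simp add: SQ_def riesz_add)
      then have "(\<lambda>i. (1 - t) * c i + t * d i) = (\<lambda>c. q (SQ (sc (1 - t) gs @ sc t hs)) c - q ?F c)"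
        unfolding gs(2) hs(2) q_def comb by (simp add: algebra_simps)
      ultimately show ?thesis using C_I[of "sc (1 - t) gs @ sc t hs"] by simp
    qed
  qed
  then obtain a c0 where a: "\<And>c. c \<in> C \<Longrightarrow> 0 \<le> (\<Sum>i\<in>?R. a i * c i)"
    and c0: "c0 \<in> C" "0 < (\<Sum>i\<in>?R. a i * c0 i)" by blast
  obtain gs0 where gs0: "gs0 \<in> \<Gamma>" "c0 = (\<lambda>c. q (SQ gs0) c - q ?F c)" by (rule bexE[OF C_E[OF c0(1)]])
  define z where "z w = (\<Sum>c\<in>?R. a c * of_bool (cyc_rep w = c))" for w
  have z: "tracial z" unfolding z_def
    by (rule tracial_cyc_rep[where a = "\<lambda>u. \<Sum>c\<in>?R. a c * of_bool (u = c)"])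
  have rz: "riesz z h = (\<Sum>c\<in>?R. a c * q h c)" for h
    unfolding z_def q_def by (rule riesz_sum_functional)
  have ge: "riesz z ?F \<le> riesz z (SQ gs)" if "gs \<in> \<Gamma>" for gs
    using a[OF C_I[OF that]] by (simp add: rz right_diff_distrib sum_subtractf)
  have gt: "riesz z ?F < riesz z (SQ gs0)"
    using c0(2) unfolding gs0(2) by (simp add: rz right_diff_distrib sum_subtractf)
  \<comment> \<open>Symmetrization changes no value that matters: squares and \<open>e\<close> are
    fixed by the involution, and \<open>f\<close> is so up to cyclic equivalence.\<close>
  define y where "y w = 1 / 2 * z w + 1 / 2 * z (rev w)" for w
  have yrev: "y (rev w) = y w" for w by (simp add: y_def)
  have ytr: "tracial y" unfolding tracial_def
  proof (intro allI)
    fix u v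
    have "z (u @ v) = z (v @ u)" "z (rev v @ rev u) = z (rev u @ rev v)" using z by (simp_all add: tracial_def)
    then show "y (u @ v) = y (v @ u)" by (simp add: y_def)
  qed
  have ySQ: "riesz y (nc_star g * g) = riesz z (nc_star g * g)" for g
    unfolding y_def riesz_lincomb riesz_square_rev by simp
  have ySQs: "riesz y (SQ gs) = riesz z (SQ gs)" for gs
    unfolding SQ_def riesz_sum_list ySQ ..
  have "riesz (\<lambda>w. z (rev w)) f = riesz z f"
    using riesz_cyc_equiv[OF z f(3)] by (simp add: riesz_nc_star)
  then have yf: "riesz y f = riesz z f" unfolding y_def riesz_lincomb by simp
  have ye: "riesz y e = riesz z e" unfolding re by (simp add: y_def)
  have yF: "riesz y ?F = riesz z ?F" by (simp only: rF yf ye)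
  have F0: "riesz y ?F \<le> 0" using ge[of "[]"] by (simp add: yF \<Gamma>_def SQ_def)
  have psd: "0 \<le> riesz y (nc_star g * g)" if g: "nc_degree g \<le> k" for g
  proof (rule ccontr)
    let ?q = "riesz y (nc_star g * g)"
    assume "\<not> 0 \<le> ?q"
    then have q: "?q < 0" by simp
    \<comment> \<open>Scaling the square with this \<open>t\<close> gives a value one below that of
      \<open>?F\<close>, against \<open>ge\<close>.\<close>
    define t where "t = sqrt ((riesz y ?F - 1) / ?q)"
    have "0 \<le> (riesz y ?F - 1) / ?q" using q F0 by (intro divide_nonpos_neg) auto
    then have "t\<^sup>2 * ?q = riesz y ?F - 1" using q by (simp add: t_def)
    moreover have "[Poly_Mapping.single [] t * g] \<in> \<Gamma>" using g by (simp add: \<Gamma>_def nc_degree_scale)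
    from ge[OF this] have "riesz y ?F \<le> t\<^sup>2 * ?q"
      by (simp add: yF SQ_def riesz_square_scaled ySQ)
    ultimately show False by simp
  qed
  have diag: "0 \<le> y (rev v @ v)" if "length v \<le> k" for v
    using psd[of "word_poly v"] that by (simp add: nc_degree_le_iff riesz_square)
  \<comment> \<open>If \<open>y\<close> kills \<open>e\<close>, its diagonal is zero, hence
    \<open>y\<close> is zero on all words of length at most \<open>2 * k\<close>. Then both sides of
    \<open>gt\<close> are 0; only the strict part of the separation excludes this.\<close>
  have "0 < riesz y e"
  proof (rule ccontr)
    assume "\<not> ?thesis"
    moreover have "0 \<le> riesz y e" unfolding re using diag by (intro sum_nonneg) auto
    ultimately have "(\<Sum>v\<in>?V. y (rev v @ v)) = 0" by (simp add: re)
    then have "y (rev v @ v) = 0" if "length v \<le> k" for v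
      using sum_nonneg_eq_0_iff[OF finV, of "\<lambda>v. y (rev v @ v)"] diag that by auto
    then have y0: "y w = 0" if "length w \<le> 2 * k" for w
      using psd_functional_eq_0[OF yrev psd] that by blast
    have "riesz y (SQ gs0) = 0"
      unfolding SQ_def using gs0(1) y0
      by (subst riesz_sum_squares_gram[of gs0 k]) (auto simp: \<Gamma>_def intro!: sum.neutral)
    moreover have "riesz y ?F = 0"
      unfolding riesz_def using degF y0 by (intro sum.neutral) (auto simp: nc_degree_le_iff)
    ultimately show False using gt by (simp add: ySQs flip: yF)
  qed
  with \<open>0 < \<epsilon>\<close> have "0 < \<epsilon> * riesz y e" by simp
  then have "riesz y f < 0" using F0 unfolding rF by linarith
  moreover have "0 \<le> riesz y f"
    by (rule psd_functional_nonneg_on_trace_positive[OF rep f(1,2) ytr yrev psd])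
  ultimately show False by simp
qed

lemma symmetric_trace_positive_in_Theta_sq:
  fixes f :: "'n::finite nc_poly"
  assumes rep: "\<And>y :: 'n list \<Rightarrow> real. tracial_seq (2 * k) y \<Longrightarrow>
      pos_def_on {w. length w \<le> k} (moment_matrix y) \<Longrightarrow> has_tracial_rep (2 * k) y"
    and f: "trace_positive f" "nc_degree f \<le> 2 * k" "cyc_equiv f (nc_star f)"
  shows "f \<in> Theta_sq"
proof -
  have "\<exists>gs. cyc_equiv f (\<Sum>g\<leftarrow>gs. nc_star g * g)"
    by (rule sum_of_squares_cone_closed[OF approx_sum_of_squares[OF rep f]]) simp_all
  then show ?thesis by (simp add: Theta_sq_def)
qed

section \<open>Diagonalization of a symmetric matrix\<close>

text \<open>\<tau> is the tangent of the rotation angle, a root of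
  \<open>b * \<tau>\<^sup>2 - e * \<tau> - b = 0\<close>, whose discriminant is
  \<open>e\<^sup>2 + 4 * b\<^sup>2\<close>.\<close>

lemma exists_annihilating_rotation:
  fixes b e :: real
  assumes "b \<noteq> 0"
  shows "\<exists>c \<sigma>. c\<^sup>2 + \<sigma>\<^sup>2 = 1 \<and> (c\<^sup>2 - \<sigma>\<^sup>2) * b + c * \<sigma> * e = 0"
proof -
  define \<rho> where "\<rho> = sqrt (e\<^sup>2 + 4 * b\<^sup>2)"
  have \<rho>: "\<rho>\<^sup>2 = e\<^sup>2 + 4 * b\<^sup>2" by (simp add: \<rho>_def)
  define \<tau> where "\<tau> = (e + \<rho>) / (2 * b)"
  have \<tau>: "(1 - \<tau>\<^sup>2) * b + \<tau> * e = 0"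
  proof -
    have "\<tau> * (2 * b) = e + \<rho>" using assms by (simp add: \<tau>_def)
    then have "(2 * b * \<tau> - e)\<^sup>2 = e\<^sup>2 + 4 * b\<^sup>2" using \<rho> by (simp add: mult.commute mult.left_commute)
    then have "4 * b * ((1 - \<tau>\<^sup>2) * b + \<tau> * e) = 0" by (simp add: power2_eq_square algebra_simps)
    then show ?thesis using assms by simp
  qed
  define c where "c = 1 / sqrt (1 + \<tau>\<^sup>2)"
  have "1 + \<tau>\<^sup>2 > 0" by (simp add: add_pos_nonneg)
  then have c2: "c\<^sup>2 * (1 + \<tau>\<^sup>2) = 1" by (simp add: c_def power_divide)
  have "c\<^sup>2 + (c * \<tau>)\<^sup>2 = 1" using c2 by (simp add: power_mult_distrib algebra_simps)
  moreover have "(c\<^sup>2 - (c * \<tau>)\<^sup>2) * b + c * (c * \<tau>) * e = c\<^sup>2 * ((1 - \<tau>\<^sup>2) * b + \<tau> * e)"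
    by (simp add: power2_eq_square algebra_simps)
  ultimately show ?thesis using \<tau> by (intro exI[of _ c] exI[of _ "c * \<tau>"]) simp
qed

text \<open>Rotating the symmetric matrix with diagonal \<open>a\<close>, \<open>d\<close> and
  off-diagonal entry \<open>b\<close> preserves trace and determinant. Once the off-diagonal entry
  is 0, the squares of the diagonal sum to the squared trace minus twice the determinant.\<close>

lemma rotation_sum_of_squares:
  fixes a b d c \<sigma> :: real
  assumes "c\<^sup>2 + \<sigma>\<^sup>2 = 1" "(c\<^sup>2 - \<sigma>\<^sup>2) * b + c * \<sigma> * (d - a) = 0"
  shows "(c\<^sup>2 * a + 2 * (c * \<sigma> * b) + \<sigma>\<^sup>2 * d)\<^sup>2 + (\<sigma>\<^sup>2 * a - 2 * (c * \<sigma> * b) + c\<^sup>2 * d)\<^sup>2 = a\<^sup>2 + d\<^sup>2 + 2 * b\<^sup>2"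
proof -
  let ?a = "c\<^sup>2 * a + 2 * (c * \<sigma> * b) + \<sigma>\<^sup>2 * d" and ?d = "\<sigma>\<^sup>2 * a - 2 * (c * \<sigma> * b) + c\<^sup>2 * d"
  let ?b = "(c\<^sup>2 - \<sigma>\<^sup>2) * b + c * \<sigma> * (d - a)"
  have "?a + ?d = (c\<^sup>2 + \<sigma>\<^sup>2) * (a + d)" by (simp add: algebra_simps)
  then have tr: "?a + ?d = a + d" by (simp add: assms)
  have "?a * ?d - ?b\<^sup>2 = (c\<^sup>2 + \<sigma>\<^sup>2)\<^sup>2 * (a * d - b\<^sup>2)"
    by (simp add: power2_eq_square algebra_simps)
  then have det: "?a * ?d = a * d - b\<^sup>2" by (simp only: assms) simp
  have newton: "p\<^sup>2 + q\<^sup>2 = (p + q)\<^sup>2 - 2 * (p * q)" for p q :: real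
    by (simp add: power2_eq_square algebra_simps)
  show ?thesis unfolding newton[of ?a ?d] tr det by (simp add: power2_sum)
qed

definition orthonormal :: "nat \<Rightarrow> (nat \<Rightarrow> nat \<Rightarrow> real) \<Rightarrow> bool" where
  "orthonormal s b \<longleftrightarrow> (\<forall>p<s. \<forall>q<s. (\<Sum>i<s. b p i * b q i) = of_bool (p = q))"

definition bilin :: "nat \<Rightarrow> (nat \<Rightarrow> nat \<Rightarrow> real) \<Rightarrow> (nat \<Rightarrow> real) \<Rightarrow> (nat \<Rightarrow> real) \<Rightarrow> real" where
  "bilin s Z u v = (\<Sum>i<s. \<Sum>j<s. u i * Z i j * v j)"

lemma bilin_add_left: "bilin s Z (\<lambda>i. a * u i + b * v i) w = a * bilin s Z u w + b * bilin s Z v w"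
  by (simp add: bilin_def ring_distribs sum.distrib sum_distrib_left mult.assoc)

lemma bilin_add_right: "bilin s Z w (\<lambda>i. a * u i + b * v i) = a * bilin s Z w u + b * bilin s Z w v"
  by (simp add: bilin_def ring_distribs sum.distrib sum_distrib_left mult_ac)

lemma bilin_commute: "(\<And>i j. i < s \<Longrightarrow> j < s \<Longrightarrow> Z i j = Z j i) \<Longrightarrow> bilin s Z u v = bilin s Z v u"
  unfolding bilin_def by (subst sum.swap) (auto intro!: sum.cong)

lemma orthonormal_entry_bound:
  assumes "orthonormal s b" "p < s" "i < s"
  shows "\<bar>b p i\<bar> \<le> 1"
proof -
  have "b p i * b p i \<le> (\<Sum>i<s. b p i * b p i)"
    using assms(3) by (intro member_le_sum) auto
  also have "\<dots> = 1" using assms by (simp add: orthonormal_def)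
  finally show ?thesis using abs_square_le_1[of "b p i"] by (simp add: power2_eq_square)
qed

definition diag_energy :: "nat \<Rightarrow> (nat \<Rightarrow> nat \<Rightarrow> real) \<Rightarrow> (nat \<Rightarrow> nat \<Rightarrow> real) \<Rightarrow> real" where
  "diag_energy s Z b = (\<Sum>p<s. (bilin s Z (b p) (b p))\<^sup>2)"

lemma diag_energy_bound:
  assumes "orthonormal s b"
  shows "diag_energy s Z b \<le> (\<Sum>p<s. (\<Sum>i<s. \<Sum>j<s. \<bar>Z i j\<bar>)\<^sup>2)"
  unfolding diag_energy_def
proof (rule sum_mono)
  fix p assume "p \<in> {..<s}"
  then have bd: "\<bar>b p i\<bar> \<le> 1" if "i < s" for i using orthonormal_entry_bound[OF assms] that by simp
  have "\<bar>bilin s Z (b p) (b p)\<bar> \<le> (\<Sum>i<s. \<Sum>j<s. \<bar>b p i * Z i j * b p j\<bar>)"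
    unfolding bilin_def by (intro order_trans[OF sum_abs] sum_mono sum_abs)
  also have "\<dots> \<le> (\<Sum>i<s. \<Sum>j<s. \<bar>Z i j\<bar>)"
  proof (intro sum_mono)
    fix i j assume ij: "i \<in> {..<s}" "j \<in> {..<s}"
    have "\<bar>b p i * Z i j * b p j\<bar> = \<bar>Z i j\<bar> * (\<bar>b p i\<bar> * \<bar>b p j\<bar>)" by (simp add: abs_mult)
    also have "\<dots> \<le> \<bar>Z i j\<bar> * 1" using bd ij by (intro mult_left_mono mult_le_one) auto
    finally show "\<bar>b p i * Z i j * b p j\<bar> \<le> \<bar>Z i j\<bar>" by simp
  qed
  finally show "(bilin s Z (b p) (b p))\<^sup>2 \<le> (\<Sum>i<s. \<Sum>j<s. \<bar>Z i j\<bar>)\<^sup>2"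
    using power_mono[of "\<bar>bilin s Z (b p) (b p)\<bar>" _ 2] by simp
qed

text \<open>Orthonormal systems have entries bounded by 1 and are stable under entrywise limits, so
  a maximizing sequence has a limit that attains the supremum.\<close>

lemma diag_energy_maximizer:
  "\<exists>b. orthonormal s b \<and> (\<forall>b'. orthonormal s b' \<longrightarrow> diag_energy s Z b' \<le> diag_energy s Z b)"
proof -
  define E where "E = diag_energy s Z ` {b. orthonormal s b}"
  have "orthonormal s (\<lambda>p i. of_bool (p = i))"
  proof -
    have "(\<Sum>i<s. of_bool (p = i) * of_bool (q = i)) = (of_bool (p = q) :: real)" if "p < s" for p q
    proof -
      have "of_bool (p = i) * of_bool (q = i) = (if i = p then of_bool (p = q) else (0::real))" for i by auto
      then show ?thesis using that by simp
    qed
    then show ?thesis by (simp add: orthonormal_def)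
  qed
  then have ne: "E \<noteq> {}" unfolding E_def by blast
  have bdd: "bdd_above E" unfolding E_def using diag_energy_bound by (force intro: bdd_aboveI)
  have "\<exists>b. orthonormal s b \<and> Sup E - 1 / real (Suc n) < diag_energy s Z b" for n
    using less_cSup_iff[OF ne bdd, of "Sup E - 1 / real (Suc n)"] by (auto simp: E_def)
  then obtain b where b: "\<And>n. orthonormal s (b n)" "\<And>n. Sup E - 1 / real (Suc n) < diag_energy s Z (b n)"
    by metis
  have "\<bar>(\<lambda>(p, i). b n p i) x\<bar> \<le> 1" if "x \<in> {..<s} \<times> {..<s}" for n x
    using that orthonormal_entry_bound[OF b(1)] by auto
  from bounded_seq_convergent_subseq[of "{..<s} \<times> {..<s}" "\<lambda>n (p, i). b n p i" 1, OF _ this]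
  obtain l r where r: "strict_mono r"
    and l: "\<forall>x\<in>{..<s} \<times> {..<s}. (\<lambda>n. (\<lambda>(p, i). b (r n) p i) x) \<longlonglongrightarrow> l x" by auto
  define b0 where "b0 p i = l (p, i)" for p i
  have lim: "(\<lambda>n. b (r n) p i) \<longlonglongrightarrow> b0 p i" if "p < s" "i < s" for p i
    using l[rule_format, of "(p, i)"] that by (simp add: b0_def)
  have "orthonormal s b0" unfolding orthonormal_def
  proof (intro allI impI)
    fix p q assume pq: "p < s" "q < s"
    have "(\<lambda>n. \<Sum>i<s. b (r n) p i * b (r n) q i) \<longlonglongrightarrow> (\<Sum>i<s. b0 p i * b0 q i)"
      by (intro tendsto_intros lim) (use pq in auto)
    moreover have "(\<lambda>n. \<Sum>i<s. b (r n) p i * b (r n) q i) = (\<lambda>n. of_bool (p = q))"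
      using b(1) pq by (simp add: orthonormal_def)
    ultimately show "(\<Sum>i<s. b0 p i * b0 q i) = of_bool (p = q)" by (simp add: LIMSEQ_const_iff)
  qed
  moreover have "Sup E \<le> diag_energy s Z b0"
  proof -
    have 1: "(\<lambda>n. diag_energy s Z (b (r n))) \<longlonglongrightarrow> diag_energy s Z b0"
      unfolding diag_energy_def bilin_def by (intro tendsto_intros lim) auto
    have "(\<lambda>n. 1 / real (Suc (r n))) \<longlonglongrightarrow> 0"
      using LIMSEQ_subseq_LIMSEQ[OF lim_inverse_n' [THEN LIMSEQ_Suc] r] by (simp add: o_def)
    then have 2: "(\<lambda>n. Sup E - 1 / real (Suc (r n))) \<longlonglongrightarrow> Sup E - 0" by (intro tendsto_intros)
    from LIMSEQ_le[OF 2 1] b(2) show ?thesis by (force intro: less_imp_le)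
  qed
  moreover have "diag_energy s Z b' \<le> Sup E" if "orthonormal s b'" for b'
    using that by (intro cSup_upper[OF _ bdd]) (auto simp: E_def)
  ultimately show ?thesis by (meson order_trans)
qed

text \<open>Jacobi's argument: a plane rotation that annihilates an off-diagonal entry strictly increases
  the sum of the squares of the diagonal entries, so at a maximum the matrix is diagonal.\<close>

lemma exists_orthonormal_diagonalizing:
  fixes Z :: "nat \<Rightarrow> nat \<Rightarrow> real"
  assumes sym: "\<And>i j. i < s \<Longrightarrow> j < s \<Longrightarrow> Z i j = Z j i"
  shows "\<exists>b. orthonormal s b \<and> (\<forall>p<s. \<forall>q<s. p \<noteq> q \<longrightarrow> bilin s Z (b p) (b q) = 0)"
proof -
  obtain b where b: "orthonormal s b" "\<And>b'. orthonormal s b' \<Longrightarrow> diag_energy s Z b' \<le> diag_energy s Z b"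
    using diag_energy_maximizer by metis
  let ?Q = "bilin s Z"
  have "?Q (b p) (b q) = 0" if pq: "p < s" "q < s" "p \<noteq> q" for p q
  proof (rule ccontr)
    assume nz: "?Q (b p) (b q) \<noteq> 0"
    define a d \<beta> where "a = ?Q (b p) (b p)" and "d = ?Q (b q) (b q)" and "\<beta> = ?Q (b p) (b q)"
    have \<beta>': "?Q (b q) (b p) = \<beta>" unfolding \<beta>_def by (rule bilin_commute[OF sym])
    \<comment> \<open>The rotation in the plane of \<open>b p\<close> and \<open>b q\<close> that
      removes the entry \<beta>; it raises the energy by \<open>2 * \<beta>\<^sup>2\<close>.\<close>
    obtain c \<sigma> where rot: "c\<^sup>2 + \<sigma>\<^sup>2 = 1" "(c\<^sup>2 - \<sigma>\<^sup>2) * \<beta> + c * \<sigma> * (d - a) = 0"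
      using exists_annihilating_rotation[of \<beta> "d - a"] nz by (auto simp: \<beta>_def)
    define u where "u = (\<lambda>i. c * b p i + \<sigma> * b q i)"
    define v where "v = (\<lambda>i. - \<sigma> * b p i + c * b q i)"
    define b' where "b' = b(p := u, q := v)"
    have b'p: "b' p = u" "b' q = v" and b'r: "\<And>r. r \<noteq> p \<Longrightarrow> r \<noteq> q \<Longrightarrow> b' r = b r"
      using pq by (auto simp: b'_def)
    define ip where "ip f g = (\<Sum>i<s. f i * g i)" for f g :: "nat \<Rightarrow> real"
    have ip_add: "ip (\<lambda>i. x * f i + y * g i) h = x * ip f h + y * ip g h" for x y f g h
      by (simp add: ip_def ring_distribs sum.distrib sum_distrib_left mult.assoc)
    have ip_comm: "ip f g = ip g f" for f g by (simp add: ip_def mult.commute)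
    have ipb: "ip (b r) (b t) = of_bool (r = t)" if "r < s" "t < s" for r t
      using b(1) that by (simp add: orthonormal_def ip_def)
    have ipu: "ip u f = c * ip (b p) f + \<sigma> * ip (b q) f" for f unfolding u_def by (rule ip_add)
    have ipv: "ip v f = - \<sigma> * ip (b p) f + c * ip (b q) f" for f unfolding v_def by (rule ip_add)
    have uv: "ip u u = 1" "ip v v = 1" "ip u v = 0"
      using rot(1) pq ip_comm[of "b p" u] ip_comm[of "b q" u] ip_comm[of "b p" v] ip_comm[of "b q" v]
      by (simp_all add: ipu ipv ipb power2_eq_square)
    have uvr: "ip u (b r) = 0" "ip v (b r) = 0" if "r < s" "r \<noteq> p" "r \<noteq> q" for r
      using that pq by (simp_all add: ipu ipv ipb)
    have "orthonormal s b'" unfolding orthonormal_def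
    proof (intro allI impI)
      fix r t assume rt: "r < s" "t < s"
      have "ip (b' r) (b' t) = of_bool (r = t)"
      proof (cases "r = p \<or> r = q"; cases "t = p \<or> t = q")
        assume "r = p \<or> r = q" "t = p \<or> t = q"
        then show ?thesis using b'p uv pq ip_comm[of v u] by auto
      next
        assume "r = p \<or> r = q" "\<not> (t = p \<or> t = q)"
        then show ?thesis using b'p b'r uvr rt by auto
      next
        assume "\<not> (r = p \<or> r = q)" "t = p \<or> t = q"
        then show ?thesis using b'p b'r uvr[of r] rt ip_comm[of "b r" u] ip_comm[of "b r" v] by auto
      next
        assume "\<not> (r = p \<or> r = q)" "\<not> (t = p \<or> t = q)"
        then show ?thesis using b'r ipb rt by auto
      qed
      then show "(\<Sum>i<s. b' r i * b' t i) = of_bool (r = t)" by (simp add: ip_def)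
    qed
    from b(2)[OF this] have le: "diag_energy s Z b' \<le> diag_energy s Z b" .
    have Qu: "?Q u u = c\<^sup>2 * a + 2 * (c * \<sigma> * \<beta>) + \<sigma>\<^sup>2 * d"
      unfolding u_def bilin_add_left bilin_add_right a_def[symmetric] d_def[symmetric] \<beta>_def[symmetric] \<beta>'
      by (simp add: power2_eq_square algebra_simps)
    have Qv: "?Q v v = \<sigma>\<^sup>2 * a - 2 * (c * \<sigma> * \<beta>) + c\<^sup>2 * d"
      unfolding v_def bilin_add_left bilin_add_right a_def[symmetric] d_def[symmetric] \<beta>_def[symmetric] \<beta>'
      by (simp add: power2_eq_square algebra_simps)
    have split: "(\<Sum>r<s. h r) = h p + h q + (\<Sum>r\<in>{..<s} - {p, q}. h r)" for h :: "nat \<Rightarrow> real"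
    proof -
      have "{..<s} = insert p (insert q ({..<s} - {p, q}))" using pq by auto
      then have "(\<Sum>r<s. h r) = (\<Sum>r\<in>insert p (insert q ({..<s} - {p, q})). h r)" by (rule arg_cong)
      also have "\<dots> = h p + (h q + (\<Sum>r\<in>{..<s} - {p, q}. h r))"
        using pq(3) by (subst sum.insert, simp, simp, subst sum.insert) simp_all
      finally show ?thesis by simp
    qed
    have rest: "(\<Sum>r\<in>{..<s} - {p, q}. (?Q (b' r) (b' r))\<^sup>2) = (\<Sum>r\<in>{..<s} - {p, q}. (?Q (b r) (b r))\<^sup>2)"
      by (intro sum.cong refl) (simp add: b'r)
    have "(?Q u u)\<^sup>2 + (?Q v v)\<^sup>2 \<le> a\<^sup>2 + d\<^sup>2"
      using le unfolding diag_energy_def split[of "\<lambda>r. (?Q (b' r) (b' r))\<^sup>2"]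
        split[of "\<lambda>r. (?Q (b r) (b r))\<^sup>2"] rest b'p a_def d_def by simp
    moreover have "(?Q u u)\<^sup>2 + (?Q v v)\<^sup>2 = a\<^sup>2 + d\<^sup>2 + 2 * \<beta>\<^sup>2"
      unfolding Qu Qv by (rule rotation_sum_of_squares[OF rot])
    ultimately have "\<beta>\<^sup>2 \<le> 0" by simp
    then show False using nz by (simp add: \<beta>_def)
  qed
  with b(1) show ?thesis by blast
qed

text \<open>Conjugating all letters by one orthogonal matrix keeps every word trace. Any single
  letter can thus be made diagonal, and it then factors out of the diagonal entries of words that
  begin with it.\<close>

lemma diagonalize_letter:
  assumes sym: "sym_tuple s A"
  shows "\<exists>B. sym_tuple s B \<and> (\<forall>w. word_trace s B w = word_trace s A w) \<and>
    (\<forall>i<s. \<forall>j<s. i \<noteq> j \<longrightarrow> B x $$ (i, j) = 0)"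
proof -
  obtain b where b: "orthonormal s b"
    and diag: "\<And>p q. p < s \<Longrightarrow> q < s \<Longrightarrow> p \<noteq> q \<Longrightarrow> bilin s (\<lambda>i j. A x $$ (i, j)) (b p) (b q) = 0"
    using exists_orthonormal_diagonalizing[of s "\<lambda>i j. A x $$ (i, j)"] letter_symmetric[OF sym] by blast
  define U where "U = mat s s (\<lambda>(i, p). b p i)"
  let ?T = "transpose_mat U"
  have U: "U \<in> carrier_mat s s" "?T \<in> carrier_mat s s" by (simp_all add: U_def)
  have TU: "?T * U = 1\<^sub>m s"
  proof (rule eq_matI)
    fix p q assume "p < dim_row (1\<^sub>m s :: real mat)" "q < dim_col (1\<^sub>m s :: real mat)"
    then have pq: "p < s" "q < s" by auto
    have "(?T * U) $$ (p, q) = (\<Sum>i<s. b p i * b q i)"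
      unfolding index_mult_mat_sum[OF U(2,1) pq] using pq by (intro sum.cong) (auto simp: U_def)
    then show "(?T * U) $$ (p, q) = 1\<^sub>m s $$ (p, q)" using b pq by (simp add: orthonormal_def)
  qed (simp_all add: U_def)
  have UT: "U * ?T = 1\<^sub>m s" by (rule mat_mult_left_right_inverse[OF U(2,1) TU])
  define B where "B y = ?T * A y * U" for y
  have Bc: "B y \<in> carrier_mat s s" for y
    unfolding B_def using U letter_carrier[OF sym] by (intro mult_carrier_mat) auto
  have symB: "sym_tuple s B" unfolding sym_tuple_def
  proof (intro allI conjI Bc)
    fix y
    have c: "?T * A y \<in> carrier_mat s s" using U letter_carrier[OF sym] by (intro mult_carrier_mat) auto
    have "transpose_mat (B y) = ?T * transpose_mat (?T * A y)"
      unfolding B_def by (rule transpose_mult[OF c U(1)])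
    also have "transpose_mat (?T * A y) = A y * U"
      using transpose_mult[OF U(2) letter_carrier[OF sym, of y]] sym by (simp add: sym_tuple_def)
    also have "?T * (A y * U) = B y"
      unfolding B_def using assoc_mult_mat[OF U(2) letter_carrier[OF sym, of y] U(1)] by simp
    finally show "transpose_mat (B y) = B y" .
  qed
  have ev: "eval_word s B w = ?T * eval_word s A w * U" for w
  proof (induction w)
    case Nil
    show ?case using U TU by simp
  next
    case (Cons y w)
    let ?M = "A y" and ?N = "eval_word s A w"
    have c: "?M \<in> carrier_mat s s" "?N \<in> carrier_mat s s"
      using letter_carrier[OF sym] eval_word_carrier[OF sym] by auto
    have c': "?T * ?M \<in> carrier_mat s s" "?N * U \<in> carrier_mat s s" "?T * (?N * U) \<in> carrier_mat s s"
      using c U by (auto intro!: mult_carrier_mat)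
    have "eval_word s B (y # w) = ?T * ?M * U * (?T * ?N * U)" by (simp add: Cons B_def)
    also have "?T * ?N * U = ?T * (?N * U)" by (rule assoc_mult_mat[OF U(2) c(2) U(1)])
    also have "?T * ?M * U * (?T * (?N * U)) = ?T * ?M * (U * (?T * (?N * U)))"
      by (rule assoc_mult_mat[OF c'(1) U(1) c'(3)])
    also have "U * (?T * (?N * U)) = U * ?T * (?N * U)" by (rule assoc_mult_mat[OF U c'(2), symmetric])
    also have "\<dots> = ?N * U" unfolding UT by (rule left_mult_one_mat[OF c'(2)])
    also have "?T * ?M * (?N * U) = ?T * ?M * ?N * U" by (rule assoc_mult_mat[OF c'(1) c(2) U(1), symmetric])
    also have "?T * ?M * ?N = ?T * (?M * ?N)" by (rule assoc_mult_mat[OF U(2) c])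
    finally show ?case by simp
  qed
  have "word_trace s B w = word_trace s A w" for w
  proof -
    let ?N = "eval_word s A w"
    have c: "?N \<in> carrier_mat s s" "?N * U \<in> carrier_mat s s"
      using U eval_word_carrier[OF sym] by (auto intro!: mult_carrier_mat)
    have "?T * ?N * U = ?T * (?N * U)" by (rule assoc_mult_mat[OF U(2) c(1) U(1)])
    then have "word_trace s B w = normalized_trace (?N * U * ?T)"
      unfolding word_trace_def ev by (simp only: normalized_trace_mult_commute[OF U(2) c(2)])
    also have "?N * U * ?T = ?N * (U * ?T)" by (rule assoc_mult_mat[OF c(1) U])
    also have "\<dots> = ?N" unfolding UT by (rule right_mult_one_mat[OF c(1)])
    finally show ?thesis by (simp add: word_trace_def)
  qed
  moreover have "B x $$ (p, q) = 0" if pq: "p < s" "q < s" "p \<noteq> q" for p q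
  proof -
    have c: "?T * A x \<in> carrier_mat s s" using U letter_carrier[OF sym] by (intro mult_carrier_mat) auto
    have "B x $$ (p, q) = (\<Sum>j<s. (\<Sum>i<s. b p i * A x $$ (i, j)) * b q j)"
      unfolding B_def index_mult_mat_sum[OF c U(1) pq(1,2)]
    proof (intro sum.cong refl)
      fix j assume "j \<in> {..<s}"
      then have j: "j < s" by simp
      have "(?T * A x) $$ (p, j) = (\<Sum>i<s. b p i * A x $$ (i, j))"
        unfolding index_mult_mat_sum[OF U(2) letter_carrier[OF sym] pq(1) j]
        using pq by (intro sum.cong) (auto simp: U_def)
      then show "(?T * A x) $$ (p, j) * U $$ (j, q) = (\<Sum>i<s. b p i * A x $$ (i, j)) * b q j"
        using pq j by (simp add: U_def)
    qed
    also have "\<dots> = bilin s (\<lambda>i j. A x $$ (i, j)) (b p) (b q)"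
      unfolding bilin_def sum_distrib_right by (rule sum.swap)
    finally show ?thesis using diag pq by simp
  qed
  ultimately show ?thesis using symB by blast
qed

section \<open>Trace inequalities\<close>

lemma eval_word_mult_index:
  assumes "sym_tuple s A" "i < s" "j < s"
  shows "eval_word s A (u @ v) $$ (i, j) = (\<Sum>l<s. eval_word s A u $$ (i, l) * eval_word s A v $$ (l, j))"
  unfolding eval_word_append[OF assms(1)]
  by (rule index_mult_mat_sum[OF eval_word_carrier[OF assms(1)] eval_word_carrier[OF assms(1)] assms(2,3)])

lemma eval_word_rev_index:
  assumes "sym_tuple s A" "i < s" "j < s"
  shows "eval_word s A (rev w) $$ (i, j) = eval_word s A w $$ (j, i)"
  unfolding eval_word_rev[OF assms(1)]
  using assms(2,3) by (simp add: carrier_matD[OF eval_word_carrier[OF assms(1)]])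

lemma eval_word_Cons_diag:
  assumes sym: "sym_tuple s A" and diag: "\<And>i j. i < s \<Longrightarrow> j < s \<Longrightarrow> i \<noteq> j \<Longrightarrow> A x $$ (i, j) = 0"
    and ij: "i < s" "j < s"
  shows "eval_word s A (x # w) $$ (i, j) = A x $$ (i, i) * eval_word s A w $$ (i, j)"
proof -
  have "eval_word s A (x # w) $$ (i, j) = (\<Sum>l<s. A x $$ (i, l) * eval_word s A w $$ (l, j))"
    using index_mult_mat_sum[OF letter_carrier[OF sym] eval_word_carrier[OF sym] ij] by simp
  also have "\<dots> = (\<Sum>l<s. if l = i then A x $$ (i, i) * eval_word s A w $$ (i, j) else 0)"
    using diag[OF ij(1)] by (intro sum.cong) auto
  finally show ?thesis using ij by simp
qed

lemma eval_word_two_index: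
  assumes sym: "sym_tuple s A" and ij: "i < s" "j < s"
  shows "eval_word s A [x, y] $$ (i, j) = (\<Sum>l<s. A x $$ (i, l) * A y $$ (l, j))"
proof -
  have "A y * 1\<^sub>m s = A y" using letter_carrier[OF sym, of y] by simp
  then show ?thesis
    using index_mult_mat_sum[OF letter_carrier[OF sym] letter_carrier[OF sym] ij] by simp
qed

lemma eval_word_two_diag:
  assumes sym: "sym_tuple s A" and i: "i < s"
  shows "eval_word s A [y, y] $$ (i, i) = (\<Sum>l<s. (A y $$ (i, l))\<^sup>2)"
  unfolding eval_word_two_index[OF sym i i] power2_eq_square
  by (intro sum.cong refl) (simp add: letter_symmetric[OF sym i])

lemma word_trace_sum:
  assumes sym: "sym_tuple s A"
  shows "word_trace s A w = (\<Sum>i<s. eval_word s A w $$ (i, i)) / real s"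
  unfolding word_trace_def by (rule normalized_trace_alt[OF eval_word_carrier[OF sym]])

text \<open>Here \<open>d\<close> stands for the entry of \<open>x y\<close>, and \<open>p\<close>,
  \<open>q\<close> for those of \<open>x x\<close> and \<open>y y\<close>. Three estimates suffice:
  twice \<open>\<bar>z\<bar>\<close> is at most \<open>1 + z\<^sup>2\<close>, twice
  \<open>\<bar>d\<bar>\<close> is at most \<open>1 + d\<^sup>2\<close>, and the assumption.\<close>

lemma choi_lam_diagonal_entry:
  fixes z d p q :: real
  assumes "2 * \<bar>d\<bar> \<le> p + q"
  shows "0 \<le> 1 + d\<^sup>2 + z\<^sup>2 * p + z\<^sup>2 * q - 4 * (z * d)"
proof -
  have "4 * (z * d) \<le> 4 * (\<bar>z\<bar> * \<bar>d\<bar>)" by (simp flip: abs_mult)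
  also have "\<dots> = 2 * \<bar>d\<bar> * (2 * \<bar>z\<bar>)" by simp
  also have "\<dots> \<le> 2 * \<bar>d\<bar> * (1 + z\<^sup>2)"
    using sum_squares_bound[of 1 "\<bar>z\<bar>"] by (intro mult_left_mono) auto
  also have "\<dots> = 2 * \<bar>d\<bar> + z\<^sup>2 * (2 * \<bar>d\<bar>)" by (simp add: algebra_simps)
  also have "\<dots> \<le> (1 + d\<^sup>2) + z\<^sup>2 * (p + q)"
    using sum_squares_bound[of 1 "\<bar>d\<bar>"] assms by (intro add_mono mult_left_mono) auto
  finally show ?thesis by (simp add: algebra_simps)
qed

text \<open>In an eigenbasis of \<open>z\<close> the trace of \<open>z x y\<close> only involves the diagonal of \<open>x y\<close>, and the
  inequality becomes a scalar one for each diagonal entry.\<close>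

lemma choi_lam_trace_nonneg:
  assumes "s > 0" "sym_tuple s A"
  shows "0 \<le> 1 + word_trace s A [y, x, x, y] + word_trace s A [z, z, x, x] + word_trace s A [z, z, y, y]
    - 4 * word_trace s A [z, x, y]"
proof -
  obtain B where sym: "sym_tuple s B" and tr: "\<And>w. word_trace s A w = word_trace s B w"
    and diag: "\<And>i j. i < s \<Longrightarrow> j < s \<Longrightarrow> i \<noteq> j \<Longrightarrow> B z $$ (i, j) = 0"
    using diagonalize_letter[OF assms(2), of z] by metis
  let ?z = "\<lambda>i. B z $$ (i, i)" and ?d = "\<lambda>i. eval_word s B [x, y] $$ (i, i)"
    and ?p = "\<lambda>i. eval_word s B [x, x] $$ (i, i)" and ?q = "\<lambda>i. eval_word s B [y, y] $$ (i, i)"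
  have diagz: "eval_word s B (z # w) $$ (i, i) = ?z i * eval_word s B w $$ (i, i)" if "i < s" for i w
    by (rule eval_word_Cons_diag[OF sym diag that that])
  have zz: "eval_word s B [z, z, u, u] $$ (i, i) = (?z i)\<^sup>2 * eval_word s B [u, u] $$ (i, i)" if "i < s" for i u
    unfolding diagz[OF that] by (simp only: power2_eq_square mult.assoc)
  have zxy: "eval_word s B [z, x, y] $$ (i, i) = ?z i * ?d i" if "i < s" for i
    by (rule diagz[OF that])
  \<comment> \<open>The diagonal entry of \<open>y x x y\<close> is the squared norm of column
    \<open>i\<close> of \<open>x y\<close>, and \<open>?d i\<close> is one entry of that
    column.\<close>
  have yxxy: "(?d i)\<^sup>2 \<le> eval_word s B [y, x, x, y] $$ (i, i)" if i: "i < s" for i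
  proof -
    have "eval_word s B [y, x, x, y] $$ (i, i) = (\<Sum>l<s. (eval_word s B [x, y] $$ (l, i))\<^sup>2)"
    proof -
      have "eval_word s B ([y, x] @ [x, y]) $$ (i, i)
          = (\<Sum>l<s. eval_word s B [y, x] $$ (i, l) * eval_word s B [x, y] $$ (l, i))"
        by (rule eval_word_mult_index[OF sym i i])
      moreover have "eval_word s B [y, x] $$ (i, l) = eval_word s B [x, y] $$ (l, i)" if "l < s" for l
        using eval_word_rev_index[OF sym i that, of "[x, y]"] by (simp only: rev.simps append.simps)
      ultimately show ?thesis
        by (simp only: append.simps) (intro sum.cong refl, simp only: lessThan_iff power2_eq_square)
    qed
    also have "\<dots> \<ge> (?d i)\<^sup>2" using i by (intro member_le_sum) auto
    finally show ?thesis .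
  qed
  have pq: "2 * \<bar>?d i\<bar> \<le> ?p i + ?q i" if i: "i < s" for i
  proof -
    have "2 * \<bar>?d i\<bar> \<le> (\<Sum>l<s. 2 * \<bar>B x $$ (i, l) * B y $$ (i, l)\<bar>)"
    proof -
      have "?d i = (\<Sum>l<s. B x $$ (i, l) * B y $$ (i, l))"
        unfolding eval_word_two_index[OF sym i i]
        by (intro sum.cong refl) (simp add: letter_symmetric[OF sym i])
      then show ?thesis using sum_abs by (simp flip: sum_distrib_left)
    qed
    also have "\<dots> \<le> (\<Sum>l<s. (B x $$ (i, l))\<^sup>2 + (B y $$ (i, l))\<^sup>2)"
    proof (rule sum_mono)
      fix l
      show "2 * \<bar>B x $$ (i, l) * B y $$ (i, l)\<bar> \<le> (B x $$ (i, l))\<^sup>2 + (B y $$ (i, l))\<^sup>2"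
        using sum_squares_bound[of "\<bar>B x $$ (i, l)\<bar>" "\<bar>B y $$ (i, l)\<bar>"] by (simp add: abs_mult)
    qed
    also have "\<dots> = ?p i + ?q i" by (simp only: eval_word_two_diag[OF sym i] sum.distrib)
    finally show ?thesis .
  qed
  have "0 \<le> (\<Sum>i<s. 1 + eval_word s B [y, x, x, y] $$ (i, i) + eval_word s B [z, z, x, x] $$ (i, i)
      + eval_word s B [z, z, y, y] $$ (i, i) - 4 * eval_word s B [z, x, y] $$ (i, i))"
  proof (rule sum_nonneg)
    fix i assume "i \<in> {..<s}"
    then have i: "i < s" by simp
    show "0 \<le> 1 + eval_word s B [y, x, x, y] $$ (i, i) + eval_word s B [z, z, x, x] $$ (i, i)
      + eval_word s B [z, z, y, y] $$ (i, i) - 4 * eval_word s B [z, x, y] $$ (i, i)"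
      using choi_lam_diagonal_entry[OF pq[OF i], of "?z i"] yxxy[OF i] unfolding zz[OF i] zxy[OF i] by linarith
  qed
  also have "\<dots> = real s * (1 + word_trace s B [y, x, x, y] + word_trace s B [z, z, x, x]
      + word_trace s B [z, z, y, y] - 4 * word_trace s B [z, x, y])"
    unfolding word_trace_sum[OF sym] using assms(1)
    by (simp only: sum.distrib sum_subtractf flip: sum_distrib_left) (simp add: field_simps)
  finally show ?thesis using assms(1) by (simp add: tr zero_le_mult_iff)
qed

text \<open>For \<open>a + q < 3\<close> the product \<open>a * q\<close> has a negative factor and
  may be replaced by its upper bound \<open>(a + q)\<^sup>2 / 4\<close>; with
  \<open>t = a + q\<close> the result is \<open>(t - 2)\<^sup>2 * (t + 1) / 4\<close>.\<close>

lemma motzkin_nonneg: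
  fixes a q :: real
  assumes "0 \<le> a" "0 \<le> q"
  shows "0 \<le> 1 + a * q\<^sup>2 + a\<^sup>2 * q - 3 * (a * q)"
proof -
  have eq: "1 + a * q\<^sup>2 + a\<^sup>2 * q - 3 * (a * q) = 1 + a * q * (a + q - 3)"
    by (simp add: power2_eq_square algebra_simps)
  show ?thesis
  proof (cases "a + q \<ge> 3")
    case True
    then show ?thesis unfolding eq using assms by simp
  next
    case False
    have "a * q \<le> (a + q)\<^sup>2 / 4" using sum_squares_bound[of a q] by (simp add: power2_sum)
    then have "(a + q)\<^sup>2 / 4 * (a + q - 3) \<le> a * q * (a + q - 3)"
      using False by (intro mult_right_mono_neg) auto
    moreover have "1 + (a + q)\<^sup>2 / 4 * (a + q - 3) = (a + q - 2)\<^sup>2 * (a + q + 1) / 4"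
      by (simp add: power2_eq_square field_simps)
    moreover have "0 \<le> (a + q - 2)\<^sup>2 * (a + q + 1) / 4" using assms by simp
    ultimately show ?thesis unfolding eq by linarith
  qed
qed

text \<open>In an eigenbasis of \<open>x\<close> each diagonal entry is the scalar expression with
  \<open>a\<close> a squared eigenvalue and \<open>q\<close> the entry of \<open>y y\<close>, except
  that the entry of \<open>y y y y\<close> replaces \<open>q\<^sup>2\<close>. It is at least as
  large, and its factor \<open>a\<close> is nonnegative.\<close>

lemma motzkin_trace_nonneg:
  assumes "s > 0" "sym_tuple s A"
  shows "0 \<le> 1 + word_trace s A [x, x, y, y, y, y] + word_trace s A [x, x, x, x, y, y]
    - 3 * word_trace s A [x, x, y, y]"
proof -
  obtain B where sym: "sym_tuple s B" and tr: "\<And>w. word_trace s A w = word_trace s B w"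
    and diag: "\<And>i j. i < s \<Longrightarrow> j < s \<Longrightarrow> i \<noteq> j \<Longrightarrow> B x $$ (i, j) = 0"
    using diagonalize_letter[OF assms(2), of x] by metis
  let ?a = "\<lambda>i. (B x $$ (i, i))\<^sup>2" and ?q = "\<lambda>i. eval_word s B [y, y] $$ (i, i)"
  have diagx: "eval_word s B (x # w) $$ (i, i) = B x $$ (i, i) * eval_word s B w $$ (i, i)" if "i < s" for i w
    by (rule eval_word_Cons_diag[OF sym diag that that])
  have xx: "eval_word s B (x # x # w) $$ (i, i) = ?a i * eval_word s B w $$ (i, i)" if "i < s" for i w
    unfolding diagx[OF that] by (simp only: power2_eq_square mult.assoc)
  have yyyy: "(?q i)\<^sup>2 \<le> eval_word s B [y, y, y, y] $$ (i, i)" if i: "i < s" for i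
  proof -
    have "eval_word s B ([y, y] @ [y, y]) $$ (i, i)
        = (\<Sum>l<s. eval_word s B [y, y] $$ (i, l) * eval_word s B [y, y] $$ (l, i))"
      by (rule eval_word_mult_index[OF sym i i])
    also have "\<dots> = (\<Sum>l<s. (eval_word s B [y, y] $$ (l, i))\<^sup>2)"
    proof (intro sum.cong refl)
      fix l assume "l \<in> {..<s}"
      then have "eval_word s B [y, y] $$ (i, l) = eval_word s B [y, y] $$ (l, i)"
        using eval_word_rev_index[OF sym i, of l "[y, y]"] by (simp only: rev.simps append.simps lessThan_iff)
      then show "eval_word s B [y, y] $$ (i, l) * eval_word s B [y, y] $$ (l, i) = (eval_word s B [y, y] $$ (l, i))\<^sup>2"
        by (simp only: power2_eq_square)
    qed
    also have "\<dots> \<ge> (?q i)\<^sup>2" using i by (intro member_le_sum) auto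
    finally show ?thesis by (simp only: append_Cons append_Nil)
  qed
  have "0 \<le> (\<Sum>i<s. 1 + eval_word s B [x, x, y, y, y, y] $$ (i, i)
      + eval_word s B [x, x, x, x, y, y] $$ (i, i) - 3 * eval_word s B [x, x, y, y] $$ (i, i))"
  proof (rule sum_nonneg)
    fix i assume "i \<in> {..<s}"
    then have i: "i < s" by simp
    have q: "0 \<le> ?q i" unfolding eval_word_two_diag[OF sym i] by (intro sum_nonneg) auto
    have "?a i * (?q i)\<^sup>2 \<le> ?a i * eval_word s B [y, y, y, y] $$ (i, i)"
      using yyyy[OF i] by (intro mult_left_mono) auto
    moreover have "?a i * (?a i * ?q i) = (?a i)\<^sup>2 * ?q i" by (simp add: power2_eq_square)
    ultimately show "0 \<le> 1 + eval_word s B [x, x, y, y, y, y] $$ (i, i)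
      + eval_word s B [x, x, x, x, y, y] $$ (i, i) - 3 * eval_word s B [x, x, y, y] $$ (i, i)"
      using motzkin_nonneg[OF _ q, of "?a i"] unfolding xx[OF i] by simp
  qed
  also have "\<dots> = real s * (1 + word_trace s B [x, x, y, y, y, y] + word_trace s B [x, x, x, x, y, y]
      - 3 * word_trace s B [x, x, y, y])"
    unfolding word_trace_sum[OF sym] using assms(1)
    by (simp only: sum.distrib sum_subtractf flip: sum_distrib_left) (simp add: field_simps)
  finally show ?thesis using assms(1) by (simp add: tr zero_le_mult_iff)
qed

section \<open>Trace-positive polynomials that are not sums of squares\<close>

text \<open>When membership of a product in a class decouples into conditions on its two factors,
  the class sum of a hermitian square is a real square; for empty \<open>S\<close> it is 0.\<close>

lemma riesz_square_factorized:
  assumes "\<And>u v. u \<in> Poly_Mapping.keys g \<Longrightarrow> v \<in> Poly_Mapping.keys g \<Longrightarrow>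
    P (rev u @ v) \<longleftrightarrow> u \<in> S \<and> v \<in> S"
  shows "riesz (\<lambda>w. of_bool (P w)) (nc_star g * g)
    = (\<Sum>u\<in>Poly_Mapping.keys g. Poly_Mapping.lookup g u * of_bool (u \<in> S))\<^sup>2"
proof -
  have "Poly_Mapping.lookup g u * Poly_Mapping.lookup g v * of_bool (P (rev u @ v))
      = (Poly_Mapping.lookup g u * of_bool (u \<in> S)) * (Poly_Mapping.lookup g v * of_bool (v \<in> S))"
    if "u \<in> Poly_Mapping.keys g" "v \<in> Poly_Mapping.keys g" for u v
    using assms[OF that] by (simp add: of_bool_conj)
  then show ?thesis unfolding riesz_square power2_eq_square sum_product by (intro sum.cong refl)
qed

text \<open>A Newton polytope argument at a vertex: for the highest power of \<open>x\<close> in any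
  summand, the coefficient of its square is a sum of squares and cannot cancel, while
  \<open>f\<close> contains no such power.\<close>

lemma no_pure_powers_in_squares:
  fixes f :: "'n nc_poly"
  assumes cyc: "cyc_equiv f (\<Sum>g\<leftarrow>gs. nc_star g * g)"
    and pure: "\<And>w. w \<in> Poly_Mapping.keys f \<Longrightarrow> set w \<subseteq> {x} \<Longrightarrow> w = []"
    and g: "g \<in> set gs" "1 \<le> j"
  shows "replicate j x \<notin> Poly_Mapping.keys g"
proof
  assume "replicate j x \<in> Poly_Mapping.keys g"
  \<comment> \<open>The exponent 0 is left out since constant terms may well occur in the
    summands.\<close>
  define J where "J = {j. 1 \<le> j \<and> (\<exists>g\<in>set gs. replicate j x \<in> Poly_Mapping.keys g)}"
  have "J \<subseteq> length ` (\<Union>g\<in>set gs. Poly_Mapping.keys g)"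
    by (force simp: J_def image_iff)
  then have "finite J" by (rule finite_subset) auto
  moreover have "j \<in> J" using g \<open>replicate j x \<in> _\<close> by (auto simp: J_def)
  ultimately have "Max J \<in> J" by (intro Max_in) auto
  define m where "m = Max J"
  have m: "1 \<le> m" and max: "\<And>i. i \<in> J \<Longrightarrow> i \<le> m"
    using \<open>Max J \<in> J\<close> \<open>finite J\<close> by (auto simp: m_def J_def)
  obtain h where h: "h \<in> set gs" "replicate m x \<in> Poly_Mapping.keys h"
    using \<open>Max J \<in> J\<close> by (auto simp: m_def J_def)
  define P where "P w \<longleftrightarrow> length w = 2 * m \<and> set w \<subseteq> {x}" for w
  have "tracial (\<lambda>w. of_bool (P w))" by (auto simp: tracial_def P_def)
  have sq: "riesz (\<lambda>w. of_bool (P w)) (nc_star g * g) = (Poly_Mapping.lookup g (replicate m x))\<^sup>2"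
    if g: "g \<in> set gs" for g
  proof -
    have short: "length u \<le> m" if "u \<in> Poly_Mapping.keys g" "set u \<subseteq> {x}" for u
    proof (cases u)
      case (Cons a v)
      have "u = replicate (length u) x" using that(2) by (intro replicate_eqI) auto
      then have "length u \<in> J" unfolding J_def using g that(1) Cons by force
      then show ?thesis by (rule max)
    qed simp
    have "P (rev u @ v) \<longleftrightarrow> u \<in> {replicate m x} \<and> v \<in> {replicate m x}"
      if "u \<in> Poly_Mapping.keys g" "v \<in> Poly_Mapping.keys g" for u v
    proof
      assume "P (rev u @ v)"
      then have sub: "set u \<subseteq> {x}" "set v \<subseteq> {x}" and len: "length u + length v = 2 * m"
        by (auto simp: P_def)
      have "length u = m" "length v = m" using short[OF that(1) sub(1)] short[OF that(2) sub(2)] len by auto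
      then show "u \<in> {replicate m x} \<and> v \<in> {replicate m x}"
        using sub by (auto intro!: replicate_eqI)
    qed (auto simp: P_def)
    then have "riesz (\<lambda>w. of_bool (P w)) (nc_star g * g)
        = (\<Sum>u\<in>Poly_Mapping.keys g. Poly_Mapping.lookup g u * of_bool (u \<in> {replicate m x}))\<^sup>2"
      by (rule riesz_square_factorized)
    also have "(\<Sum>u\<in>Poly_Mapping.keys g. Poly_Mapping.lookup g u * of_bool (u \<in> {replicate m x}))
        = Poly_Mapping.lookup g (replicate m x)"
      using riesz_indicator[of "replicate m x" g] by (simp add: riesz_def)
    finally show ?thesis .
  qed
  have "0 < riesz (\<lambda>w. of_bool (P w)) (nc_star h * h)"
    unfolding sq[OF h(1)] using h(2) by (simp add: in_keys_iff)
  also have "\<dots> \<le> (\<Sum>g\<leftarrow>gs. riesz (\<lambda>w. of_bool (P w)) (nc_star g * g))"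
    by (rule member_le_sum_list_nonneg) (simp_all add: sq h)
  also have "\<dots> = riesz (\<lambda>w. of_bool (P w)) f"
    using riesz_cyc_equiv[OF \<open>tracial _\<close> cyc] by (simp add: riesz_sum_list)
  also have "\<dots> = 0" unfolding riesz_def using m by (intro sum.neutral) (auto simp: P_def dest: pure)
  finally show False by simp
qed

text \<open>A lift of the dehomogenized Choi-Lam form, 1 plus the three products of two squared
  variables minus \<open>4 x y z\<close>. The last coefficient is shared between a word and its
  reverse to make the polynomial symmetric up to rotation.\<close>

definition choi_lam :: "'n \<Rightarrow> 'n \<Rightarrow> 'n \<Rightarrow> 'n nc_poly" where
  "choi_lam x y z = word_poly [] + word_poly [y, x, x, y] + word_poly [z, z, x, x] + word_poly [z, z, y, y]
     - Poly_Mapping.single [z, x, y] 2 - Poly_Mapping.single [y, x, z] 2"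

text \<open>A lift of the Motzkin polynomial with all letters \<open>x\<close> in front, so that
  \<open>x\<close> can be diagonalized.\<close>

definition motzkin :: "'n \<Rightarrow> 'n \<Rightarrow> 'n nc_poly" where
  "motzkin x y = word_poly [] + word_poly [x, x, y, y, y, y] + word_poly [x, x, x, x, y, y]
     - Poly_Mapping.single [x, x, y, y] 3"

lemma riesz_choi_lam:
  "riesz t (choi_lam x y z) = t [] + t [y, x, x, y] + t [z, z, x, x] + t [z, z, y, y]
     - 2 * t [z, x, y] - 2 * t [y, x, z]"
  by (simp add: choi_lam_def riesz_add riesz_diff)

lemma riesz_motzkin:
  "riesz t (motzkin x y) = t [] + t [x, x, y, y, y, y] + t [x, x, x, x, y, y] - 3 * t [x, x, y, y]"
  by (simp add: motzkin_def riesz_add riesz_diff)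

lemma keys_choi_lam:
  "Poly_Mapping.keys (choi_lam x y z)
    \<subseteq> {[], [y, x, x, y], [z, z, x, x], [z, z, y, y], [z, x, y], [y, x, z]}"
  by (auto simp: choi_lam_def in_keys_iff lookup_add lookup_minus lookup_single when_def split: if_splits)

lemma keys_motzkin:
  "Poly_Mapping.keys (motzkin x y)
    \<subseteq> {[], [x, x, y, y, y, y], [x, x, x, x, y, y], [x, x, y, y]}"
  by (auto simp: motzkin_def in_keys_iff lookup_add lookup_minus lookup_single when_def split: if_splits)

lemma nc_degree_choi_lam: "nc_degree (choi_lam x y z) \<le> 4"
  using keys_choi_lam[of x y z] by (auto simp: nc_degree_le_iff)

lemma nc_degree_motzkin: "nc_degree (motzkin x y) \<le> 6"
  using keys_motzkin[of x y] by (auto simp: nc_degree_le_iff)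

lemma choi_lam_cyc_symmetric: "cyc_equiv (choi_lam x y z) (nc_star (choi_lam x y z))"
  unfolding cyc_equiv_iff_riesz
proof (intro allI impI)
  fix t :: "'a list \<Rightarrow> real" assume "tracial t"
  then have "t ([z, z] @ [u, u]) = t ([u, u] @ [z, z])" for u unfolding tracial_def by blast
  then show "riesz t (choi_lam x y z) = riesz t (nc_star (choi_lam x y z))"
    by (simp add: riesz_nc_star riesz_choi_lam)
qed

lemma motzkin_cyc_symmetric: "cyc_equiv (motzkin x y) (nc_star (motzkin x y))"
  unfolding cyc_equiv_iff_riesz
proof (intro allI impI)
  fix t :: "'a list \<Rightarrow> real" assume t: "tracial t"
  then have "t ([x, x] @ v) = t (v @ [x, x])" for v unfolding tracial_def by blast
  from this[of "[y, y]"] this[of "[y, y, y, y]"] this[of "[x, x, y, y]"] this[of "[y, y, x, x]"]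
  show "riesz t (motzkin x y) = riesz t (nc_star (motzkin x y))"
    by (simp add: riesz_nc_star riesz_motzkin)
qed

lemma trace_positive_choi_lam: "trace_positive (choi_lam x y z)"
proof (rule trace_positiveI)
  fix s and A :: "'a \<Rightarrow> real mat" assume A: "s > 0" "sym_tuple s A"
  have "word_trace s A [y, x, z] = word_trace s A [z, x, y]"
    using word_trace_rev[OF A(2), of "[z, x, y]"] by simp
  then show "0 \<le> riesz (word_trace s A) (choi_lam x y z)"
    using choi_lam_trace_nonneg[OF A, of y x z] by (simp add: riesz_choi_lam word_trace_Nil[OF A(2,1)])
qed

lemma trace_positive_motzkin: "trace_positive (motzkin x y)"
proof (rule trace_positiveI)
  fix s and A :: "'a \<Rightarrow> real mat" assume A: "s > 0" "sym_tuple s A"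
  show "0 \<le> riesz (word_trace s A) (motzkin x y)"
    using motzkin_trace_nonneg[OF A, of x y] by (simp add: riesz_motzkin word_trace_Nil[OF A(2,1)])
qed

text \<open>Forgetting the order of letters is invariant under rotation; the functional reads off a
  coefficient of the commutative image.\<close>

lemma tracial_mset: "tracial (\<lambda>w. of_bool (mset w = M))"
  by (simp add: tracial_def add.commute)

text \<open>The commutative coefficient of \<open>x y z\<close> is -4. In squares of degree at most
  4 it needs a summand containing a single letter, and these are excluded because no pure power
  occurs in the polynomial.\<close>

lemma choi_lam_not_in_Theta_sq:
  fixes x y z :: "'n::finite"
  assumes "x \<noteq> y" "y \<noteq> z" "x \<noteq> z"
  shows "choi_lam x y z \<notin> Theta_sq"
proof
  assume "choi_lam x y z \<in> Theta_sq"
  then obtain gs where gs: "cyc_equiv (choi_lam x y z) (\<Sum>g\<leftarrow>gs. nc_star g * g)"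
    by (auto simp: Theta_sq_def)
  have "nc_degree (choi_lam x y z) \<le> 2 * 2" using nc_degree_choi_lam[of x y z] by simp
  note deg = square_summands_nc_degree[OF gs this]
  have pure: "[u] \<notin> Poly_Mapping.keys g" if "g \<in> set gs" "u \<in> {x, y, z}" for g u
  proof -
    have "w = []" if "w \<in> Poly_Mapping.keys (choi_lam x y z)" "set w \<subseteq> {u}" for w
      using that keys_choi_lam[of x y z] assms by auto
    from no_pure_powers_in_squares[OF gs this \<open>g \<in> set gs\<close>, where j = 1] show ?thesis by simp
  qed
  let ?M = "{#x, y, z#}"
  have zero: "riesz (\<lambda>w. of_bool (mset w = ?M)) (nc_star g * g) = 0" if g: "g \<in> set gs" for g
  proof -
    have "mset (rev u @ v) = ?M \<longleftrightarrow> u \<in> {} \<and> v \<in> {}"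
      if uv: "u \<in> Poly_Mapping.keys g" "v \<in> Poly_Mapping.keys g" for u v
    proof -
      have len: "length u \<le> 2" "length v \<le> 2" using deg[OF g] uv by (auto simp: nc_degree_le_iff)
      have "mset (rev u @ v) \<noteq> ?M"
      proof
        assume M: "mset (rev u @ v) = ?M"
        have "length u + length v = 3" using arg_cong[OF M, of size] by simp
        with len have "length u = 1 \<or> length v = 1" by arith
        moreover have "set u \<subseteq> {x, y, z}" "set v \<subseteq> {x, y, z}" using arg_cong[OF M, of set_mset] by auto
        ultimately show False using pure[OF g] uv by (auto simp: length_Suc_conv)
      qed
      then show ?thesis by simp
    qed
    then have "riesz (\<lambda>w. of_bool (mset w = ?M)) (nc_star g * g)
        = (\<Sum>u\<in>Poly_Mapping.keys g. Poly_Mapping.lookup g u * of_bool (u \<in> {}))\<^sup>2"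
      by (rule riesz_square_factorized)
    then show ?thesis by simp
  qed
  have "riesz (\<lambda>w. of_bool (mset w = ?M)) (choi_lam x y z)
      = (\<Sum>g\<leftarrow>gs. riesz (\<lambda>w. of_bool (mset w = ?M)) (nc_star g * g))"
    using riesz_cyc_equiv[OF tracial_mset gs] by (simp add: riesz_sum_list)
  also have "\<dots> = (\<Sum>g\<leftarrow>gs. 0)" by (rule arg_cong[where f = sum_list], rule map_cong) (simp_all add: zero)
  also have "\<dots> = 0" by (induction gs) auto
  finally show False using assms by (simp add: riesz_choi_lam add_mset_commute)
qed

text \<open>The commutative coefficient of \<open>x x y y\<close> is -3. Without pure powers in the
  summands it arises only from pairs of words among \<open>x y\<close> and \<open>y x\<close>, so on
  each square it is a real square.\<close>

lemma motzkin_not_in_Theta_sq: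
  fixes x y :: "'n::finite"
  assumes "x \<noteq> y"
  shows "motzkin x y \<notin> Theta_sq"
proof
  assume "motzkin x y \<in> Theta_sq"
  then obtain gs where gs: "cyc_equiv (motzkin x y) (\<Sum>g\<leftarrow>gs. nc_star g * g)"
    by (auto simp: Theta_sq_def)
  have "nc_degree (motzkin x y) \<le> 2 * 3" using nc_degree_motzkin[of x y] by simp
  note deg = square_summands_nc_degree[OF gs this]
  have pure: "replicate j u \<notin> Poly_Mapping.keys g" if "g \<in> set gs" "u \<in> {x, y}" "1 \<le> j" for g u j
  proof -
    have "w = []" if "w \<in> Poly_Mapping.keys (motzkin x y)" "set w \<subseteq> {u}" for w
      using that keys_motzkin[of x y] assms by auto
    from no_pure_powers_in_squares[OF gs this \<open>g \<in> set gs\<close> \<open>1 \<le> j\<close>] show ?thesis .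
  qed
  let ?M = "{#x, x, y, y#}" and ?S = "{w. mset w = {#x, y#}}"
  have nonneg: "0 \<le> riesz (\<lambda>w. of_bool (mset w = ?M)) (nc_star g * g)" if g: "g \<in> set gs" for g
  proof -
    have "mset (rev u @ v) = ?M \<longleftrightarrow> u \<in> ?S \<and> v \<in> ?S"
      if uv: "u \<in> Poly_Mapping.keys g" "v \<in> Poly_Mapping.keys g" for u v
    proof
      assume M: "mset (rev u @ v) = ?M"
      have len: "length u \<le> 3" "length v \<le> 3" using deg[OF g] uv by (auto simp: nc_degree_le_iff)
      have sub: "set u \<subseteq> {x, y}" "set v \<subseteq> {x, y}" using arg_cong[OF M, of set_mset] by auto
      have one: "length w \<noteq> 1" if "w \<in> Poly_Mapping.keys g" "set w \<subseteq> {x, y}" for w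
        using pure[OF g, of _ 1] that by (auto simp: length_Suc_conv)
      have two: "w \<in> ?S" if "w \<in> Poly_Mapping.keys g" "set w \<subseteq> {x, y}" "length w = 2" for w
      proof -
        from that(3) obtain a b where w: "w = [a, b]" by (auto simp: numeral_2_eq_2 length_Suc_conv)
        have "a \<noteq> b" using pure[OF g, of a 2] that w by (auto simp: numeral_2_eq_2)
        then show ?thesis using that(2) w by (auto simp: add_mset_commute)
      qed
      have "length u + length v = 4" using arg_cong[OF M, of size] by simp
      with len one[OF uv(1) sub(1)] one[OF uv(2) sub(2)] have "length u = 2" "length v = 2" by arith+
      then show "u \<in> ?S \<and> v \<in> ?S" using two uv sub by blast
    next
      assume "u \<in> ?S \<and> v \<in> ?S"
      then show "mset (rev u @ v) = ?M" by (simp add: add_mset_commute)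
    qed
    then have "riesz (\<lambda>w. of_bool (mset w = ?M)) (nc_star g * g)
        = (\<Sum>u\<in>Poly_Mapping.keys g. Poly_Mapping.lookup g u * of_bool (u \<in> ?S))\<^sup>2"
      by (rule riesz_square_factorized)
    then show ?thesis by simp
  qed
  have "0 \<le> (\<Sum>g\<leftarrow>gs. riesz (\<lambda>w. of_bool (mset w = ?M)) (nc_star g * g))"
    using nonneg by (intro sum_list_nonneg) auto
  also have "\<dots> = riesz (\<lambda>w. of_bool (mset w = ?M)) (motzkin x y)"
    using riesz_cyc_equiv[OF tracial_mset gs] by (simp add: riesz_sum_list)
  also have "\<dots> = -3" using assms by (simp add: riesz_motzkin)
  finally show False by simp
qed

section \<open>Words that are rotations of their reverses, and the equivalence\<close>

lemma tracial_rev_short_word: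
  fixes y :: "'n list \<Rightarrow> real"
  assumes "tracial y" "length w \<le> 2 * k"
    and small: "k \<le> 1 \<or> (\<forall>a b :: 'n. a = b) \<or>
      k \<le> 2 \<and> (\<forall>a b c :: 'n. a = b \<or> b = c \<or> a = c)"
  shows "y (rev w) = y w"
proof -
  have swap: "y (u @ v) = y (v @ u)" for u v using assms(1) by (simp add: tracial_def)
  have two: "y (rev [a, b]) = y [a, b]" for a b using swap[of "[a]" "[b]"] by simp
  have "length w \<le> 2" if "k \<le> 1" using that assms(2) by linarith
  moreover have "length w \<le> 2 \<or> length w = 3 \<or> length w = 4" if "k \<le> 2" using that assms(2) by linarith
  ultimately consider "length w \<le> 2" | "\<forall>a b :: 'n. a = b" |
      "length w = 3 \<or> length w = 4" "\<forall>a b c :: 'n. a = b \<or> b = c \<or> a = c"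
    using small by blast
  then show ?thesis
  proof cases
    case 1
    show ?thesis
    proof (cases w)
      case w: (Cons a v)
      show ?thesis
      proof (cases v)
        case (Cons b v')
        with 1 w have "w = [a, b]" by simp
        then show ?thesis by (simp only: two)
      qed (simp add: w)
    qed simp
  next
    case 2
    then have "rev w = w" by (intro nth_equalityI) auto
    then show ?thesis by simp
  next
    case 3
    from 3(1) show ?thesis
    proof
      assume "length w = 3"
      then obtain a b c where w: "w = [a, b, c]" by (auto simp: numeral_3_eq_3 length_Suc_conv)
      have "a = b \<or> b = c \<or> a = c" using 3(2) by blast
      then show ?thesis
        using swap[of "[a, a]" "[c]"] swap[of "[a]" "[c, c]"] by (auto simp: w)
    next
      assume "length w = 4"
      then obtain a b c d where w: "w = [a, b, c, d]" by (auto simp: numeral_eq_Suc length_Suc_conv)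
      \<comment> \<open>With two letters, a word that repeats none at distance two has the shape
        \<open>a a c c\<close> or is a palindrome. In the first two cases it is a palindrome of
        length three with one further letter at an end.\<close>
      consider "a = c" | "b = d" | "a = b" "c = d" | "a = d" "b = c"
        using 3(2) by metis
      then show ?thesis
        using swap[of "[a, b, a]" "[d]"] swap[of "[a]" "[b, c, b]"] swap[of "[a, a]" "[c, c]"]
        by cases (auto simp: w)
    qed
  qed
qed

theorem theorem4p4:
  fixes k :: nat
  shows "(\<forall>y :: 'n::finite list \<Rightarrow> real.
            tracial_seq (2 * k) y \<and> pos_def_on {w. length w \<le> k} (moment_matrix y) \<longrightarrow>
            has_tracial_rep (2 * k) y)
     \<longleftrightarrow> (\<forall>f :: 'n nc_poly.
            trace_positive f \<and> nc_degree f \<le> 2 * k \<longrightarrow> f \<in> Theta_sq_trunc k)"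
    (is "?rep \<longleftrightarrow> ?sos")
proof
  assume ?rep
  then have rep: "has_tracial_rep (2 * k) y"
    if "tracial_seq (2 * k) y" "pos_def_on {w. length w \<le> k} (moment_matrix y)" for y :: "'n list \<Rightarrow> real"
    using that by blast
  note sos = symmetric_trace_positive_in_Theta_sq[OF rep]
  \<comment> \<open>Outside these cases there are three distinct letters with
    \<open>k \<ge> 2\<close> or two with \<open>k \<ge> 3\<close>, and \<open>sos\<close> would put
    one of the two counterexamples into the cone.\<close>
  have small: "k \<le> 1 \<or> (\<forall>a b :: 'n. a = b) \<or> k \<le> 2 \<and> (\<forall>a b c :: 'n. a = b \<or> b = c \<or> a = c)"
  proof (rule ccontr)
    assume "\<not> ?thesis"
    then consider a b c :: 'n where "a \<noteq> b" "b \<noteq> c" "a \<noteq> c" "4 \<le> 2 * k" | a b :: 'n where "a \<noteq> b" "6 \<le> 2 * k"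
      by (cases "k \<le> 2") (auto simp: not_le)
    then show False
    proof cases
      case 1
      then have "choi_lam a b c \<in> Theta_sq"
        using nc_degree_choi_lam[of a b c] by (intro sos trace_positive_choi_lam choi_lam_cyc_symmetric) auto
      with choi_lam_not_in_Theta_sq 1 show False by blast
    next
      case 2
      then have "motzkin a b \<in> Theta_sq"
        using nc_degree_motzkin[of a b] by (intro sos trace_positive_motzkin motzkin_cyc_symmetric) auto
      with motzkin_not_in_Theta_sq 2 show False by blast
    qed
  qed
  show ?sos
  proof (intro allI impI)
    fix f :: "'n nc_poly"
    assume f: "trace_positive f \<and> nc_degree f \<le> 2 * k"
    \<comment> \<open>In the small cases every word that can occur in \<open>f\<close> is cyclically
      equivalent to its reverse, so \<open>sos\<close> covers all \<open>f\<close>.\<close>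
    have "cyc_equiv f (nc_star f)" unfolding cyc_equiv_iff_riesz
    proof (intro allI impI)
      fix y :: "'n list \<Rightarrow> real" assume "tracial y"
      then show "riesz y f = riesz y (nc_star f)"
        unfolding riesz_nc_star using f
        by (intro riesz_cong tracial_rev_short_word[OF _ _ small, symmetric]) (auto simp: nc_degree_le_iff)
    qed
    then have "f \<in> Theta_sq" using f by (intro sos) auto
    then show "f \<in> Theta_sq_trunc k" using f by (simp add: Theta_sq_trunc_def)
  qed
next
  assume ?sos
  then have "f \<in> Theta_sq" if "trace_positive f" "nc_degree f \<le> 2 * k" for f :: "'n nc_poly"
    using that by (auto simp: Theta_sq_trunc_def)
  then show ?rep using trace_positive_squares_imp_tracial_rep by blast
qed

end
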